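(* Let $p$ be a prime, let $R$ be a commutative Noetherian local pro-$p$ domain of characteristic $0$ and Krull dimension greater than $1$, and let $D$ be its field of quotients. Let $G$ be a finitely generated $R$-standard group of level $1$ and let $\mathbb L=\mathbb L(G)$ be its Lie algebra. Then the soluble radical $R_s(\mathbb L_D)$ of $\mathbb L_D=D\otimes_R\mathbb L$ is nilpotent.
   Context: A commutative Noetherian local pro-$p$ domain $R$ is a commutative Noetherian local integral domain with maximal ideal $\mathfrak m$, complete in the $\mathfrak m$-adic topology, with finite residue field of characteristic $p$; it carries the $\mathfrak m$-adic topology. A formal group law of dimension $d$ over $R$ is a $d$-tuple $\mathbf F=(F_1,\dots,F_d)$ of power series over $R$ in the $2d$ variables $\mathbf x=(x_1,\dots,x_d)$, $\mathbf y=(y_1,\dots,y_d)$ with $\mathbf F(\mathbf x,\mathbf 0)=\mathbf x$, $\mathbf F(\mathbf 0,\mathbf y)=\mathbf y$, $\mathbf F(\mathbf F(\mathbf x,\mathbf y),\mathbf z)=\mathbf F(\mathbf x,\mathbf F(\mathbf y,\mathbf z))$. An $R$-standard group $G$ of dimension $d$ and level $1$ is the topological group with underlying space $\mathfrak m^{(d)}$ (product of $d$ copies of $\mathfrak m$) and multiplication $\mathbf x\cdot\mathbf y=\mathbf F(\mathbf x,\mathbf y)$. "Finitely generated" means topologically finitely generated. Let $\mathbf B(\mathbf x,\mathbf y)$ be the sum of the terms of total degree $2$ of $\mathbf F(\mathbf x,\mathbf y)$ and put $\mathbf C(\mathbf x,\mathbf y)=\mathbf B(\mathbf x,\mathbf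 y)-\mathbf B(\mathbf y,\mathbf x)$. The Lie algebra $\mathbb L(G)$ is the Lie $R$-algebra $(R^{(d)},+,\mathbf C)$ with bracket $\mathbf C$. (Equivalently, up to isomorphism, $\mathbb L(G)$ is the Lie $R$-algebra of $R$-derivations of $A=R[[x_1,\dots,x_d]]$ commuting with all left translations $(\lambda_{\mathbf x}f)(\mathbf y)=f(\mathbf x^{-1}\mathbf y)$, $\mathbf x\in G$, where elements of $A$ are viewed as functions on $G$.) $\mathbb L_D$ is a finite dimensional Lie algebra over $D$, and $R_s(\mathbb L_D)$ denotes its soluble radical. *)

theory Defs
  imports
    "HOL-Analysis.Analysis"
    "HOL-Algebra.Algebraic_Closure_Type"
    "HOL-Algebra.Ideal_Product"
    "HOL-Algebra.Ring_Divisibility"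
    "HOL-Algebra.Multiplicative_Group"
    "HOL-Algebra.Generated_Groups"
    "HOL-Library.Poly_Mapping"
    "HOL-Library.Function_Algebras"
    "HOL-Library.Extended_Nat"
    "HOL-Computational_Algebra.Fraction_Field"
begin

section \<open>Local pro-\<open>p\<close> domains\<close>

text \<open>
  A commutative domain \<open>R\<close> is a type \<^typ>\<open>'a\<close> of class \<^class>\<open>idom\<close>; its ideals are those of the
  record \<^const>\<open>ring_of_type_algebra\<close>, and its field of fractions is the type \<open>'a fract\<close>.
\<close>

definition ideal_power :: "'a::comm_ring_1 set \<Rightarrow> nat \<Rightarrow> 'a set" where
  "ideal_power M n = M [^]\<^bsub>ideals_set (ring_of_type_algebra :: 'a ring)\<^esub> n"

definition adic_topology :: "'a::comm_ring_1 set \<Rightarrow> 'a topology" where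
  "adic_topology M = topology (\<lambda>U. \<forall>x\<in>U. \<exists>n. \<forall>y. y - x \<in> ideal_power M n \<longrightarrow> y \<in> U)"

lemma ideal_power_0: "ideal_power M 0 = (UNIV :: 'a::comm_ring_1 set)"
  by (simp add: ideal_power_def ideals_set_def ring_of_type_algebra_def)

lemma ideal_power_Suc:
  "ideal_power M (Suc n) = ideal_prod (ring_of_type_algebra :: 'a ring) (ideal_power M n) M"
  for M :: "'a::comm_ring_1 set"
  by (simp add: ideal_power_def ideals_set_def)

lemma ideal_ideal_power:
  fixes M :: "'a::comm_ring_1 set"
  assumes "ideal M (ring_of_type_algebra :: 'a ring)"
  shows "ideal (ideal_power M n) (ring_of_type_algebra :: 'a ring)"
proof -
  interpret ring "ring_of_type_algebra :: 'a ring" by (rule ring_from_type_algebra)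
  show ?thesis
  proof (induction n)
    case 0
    then show ?case
      using oneideal by (simp add: ideal_power_0 ring_of_type_algebra_def)
  next
    case (Suc n)
    then show ?case
      using ideal_prod_is_ideal[OF Suc assms] by (simp add: ideal_power_Suc)
  qed
qed

lemma ideal_power_antimono:
  fixes M :: "'a::comm_ring_1 set"
  assumes M: "ideal M (ring_of_type_algebra :: 'a ring)" and "m \<le> n"
  shows "ideal_power M n \<subseteq> ideal_power M m"
  using \<open>m \<le> n\<close>
proof (induction n rule: dec_induct)
  case (step n)
  interpret ring "ring_of_type_algebra :: 'a ring" by (rule ring_from_type_algebra)
  have "ideal_power M (Suc n) \<subseteq> ideal_power M n"
    using ideal_prod_inter[OF ideal_ideal_power[OF M, of n] M] by (simp add: ideal_power_Suc)
  with step show ?case by blast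
qed simp

lemma openin_adic_topology:
  fixes M :: "'a::comm_ring_1 set"
  assumes M: "ideal M (ring_of_type_algebra :: 'a ring)"
  shows "openin (adic_topology M) U \<longleftrightarrow> (\<forall>x\<in>U. \<exists>n. \<forall>y. y - x \<in> ideal_power M n \<longrightarrow> y \<in> U)"
proof -
  have "istopology (\<lambda>U. \<forall>x\<in>U. \<exists>n. \<forall>y. y - x \<in> ideal_power M n \<longrightarrow> y \<in> U)"
    unfolding istopology_def
  proof (intro conjI allI impI ballI)
    fix S T x
    assume S: "\<forall>x\<in>S. \<exists>n. \<forall>y. y - x \<in> ideal_power M n \<longrightarrow> y \<in> S"
      and T: "\<forall>x\<in>T. \<exists>n. \<forall>y. y - x \<in> ideal_power M n \<longrightarrow> y \<in> T" and "x \<in> S \<inter> T"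
    then obtain m n where m: "\<And>y. y - x \<in> ideal_power M m \<Longrightarrow> y \<in> S"
      and n: "\<And>y. y - x \<in> ideal_power M n \<Longrightarrow> y \<in> T" by blast
    show "\<exists>n. \<forall>y. y - x \<in> ideal_power M n \<longrightarrow> y \<in> S \<inter> T"
      using m n ideal_power_antimono[OF M, of m "max m n"] ideal_power_antimono[OF M, of n "max m n"]
      by (intro exI[of _ "max m n"]) auto
  next
    fix K x
    assume *: "\<forall>S\<in>K. \<forall>x\<in>S. \<exists>n. \<forall>y. y - x \<in> ideal_power M n \<longrightarrow> y \<in> S" and "x \<in> \<Union>K"
    then show "\<exists>n. \<forall>y. y - x \<in> ideal_power M n \<longrightarrow> y \<in> \<Union>K" by (meson UnionE UnionI)
  qed
  then show ?thesis by (simp add: adic_topology_def topology_inverse')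
qed

text \<open>Completeness includes separatedness: limits are required to be unique.\<close>

definition adic_complete :: "'a::comm_ring_1 set \<Rightarrow> bool" where
  "adic_complete M \<longleftrightarrow>
     (\<forall>s :: nat \<Rightarrow> 'a. (\<forall>n. \<exists>N. \<forall>i\<ge>N. \<forall>j\<ge>N. s i - s j \<in> ideal_power M n)
        \<longrightarrow> (\<exists>!l. limitin (adic_topology M) s l sequentially))"

text \<open>
  The characteristic of the residue field is expressed as the additive order of its unit element.
\<close>

definition noetherian_local_pro_p_domain :: "nat \<Rightarrow> 'a::idom set \<Rightarrow> bool" where
  "noetherian_local_pro_p_domain p M \<longleftrightarrow>
     (let R = (ring_of_type_algebra :: 'a ring); k = R Quot M in
        noetherian_ring R \<and> maximalideal M R \<and> (\<forall>N. maximalideal N R \<longrightarrow> N = M)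
        \<and> adic_complete M \<and> finite (carrier k) \<and> group.ord (add_monoid k) \<one>\<^bsub>k\<^esub> = p)"

definition krull_dim :: "('a, 'b) ring_scheme \<Rightarrow> enat" where
  "krull_dim R = Sup {enat n |n. \<exists>P :: nat \<Rightarrow> 'a set.
      (\<forall>i\<le>n. primeideal (P i) R) \<and> (\<forall>i<n. P i \<subset> P (Suc i))}"


section \<open>Power series in several variables\<close>

text \<open>
  Formal sums of monomials in the variables \<^typ>\<open>'v\<close>. A power series in a finite set \<open>V\<close> of
  variables is one whose monomials only involve variables of \<open>V\<close> (\<open>mps_vars_in\<close> below).
\<close>

typedef ('v, 'a) mps = "UNIV :: (('v \<Rightarrow>\<^sub>0 nat) \<Rightarrow> 'a) set"
  morphisms mps_coeff Abs_mps ..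

setup_lifting type_definition_mps

lemma mps_eqI: "(\<And>m. mps_coeff f m = mps_coeff g m) \<Longrightarrow> f = g"
  by transfer auto

lemma finite_monom_le:
  "finite {a. \<forall>v. Poly_Mapping.lookup a v \<le> Poly_Mapping.lookup (m :: 'v \<Rightarrow>\<^sub>0 nat) v}"
proof (rule finite_imageD)
  let ?S = "{a. \<forall>v. Poly_Mapping.lookup a v \<le> Poly_Mapping.lookup m v}"
  let ?N = "\<Sum>v\<in>Poly_Mapping.keys m. Poly_Mapping.lookup m v"
  let ?T = "{f. \<forall>v. (v \<in> Poly_Mapping.keys m \<longrightarrow> f v \<in> {..?N}) \<and> (v \<notin> Poly_Mapping.keys m \<longrightarrow> f v = 0)}"
  have N: "Poly_Mapping.lookup m v \<le> ?N" if "v \<in> Poly_Mapping.keys m" for v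
    using that by (intro member_le_sum) auto
  have "Poly_Mapping.lookup a \<in> ?T" if a: "a \<in> ?S" for a
  proof (clarsimp, intro conjI impI allI)
    fix v
    from a have le: "Poly_Mapping.lookup a v \<le> Poly_Mapping.lookup m v" by simp
    show "Poly_Mapping.lookup a v \<le> ?N" if "v \<in> Poly_Mapping.keys m"
      using le N[OF that] by (rule order_trans)
    show "Poly_Mapping.lookup a v = 0" if "v \<notin> Poly_Mapping.keys m"
      using le that by (simp add: in_keys_iff)
  qed
  then have "Poly_Mapping.lookup ` ?S \<subseteq> ?T" by (rule image_subsetI)
  moreover have "finite ?T" by (rule finite_set_of_finite_funs) auto
  ultimately show "finite (Poly_Mapping.lookup ` ?S)" by (rule finite_subset)
  show "inj_on Poly_Mapping.lookup ?S" by (rule inj_onI, rule poly_mapping_eqI) simp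
qed

lemma finite_monom_splits: "finite {(a, b). a + b = (m :: 'v \<Rightarrow>\<^sub>0 nat)}"
proof (rule finite_subset)
  let ?S = "{a. \<forall>v. Poly_Mapping.lookup a v \<le> Poly_Mapping.lookup m v}"
  show "{(a, b). a + b = m} \<subseteq> ?S \<times> ?S" by (auto simp: lookup_add)
  show "finite (?S \<times> ?S)" using finite_monom_le[of m] by simp
qed

instantiation mps :: (type, comm_ring_1) comm_ring_1
begin

lift_definition zero_mps :: "('a, 'b) mps" is "\<lambda>_. 0" .
lift_definition one_mps :: "('a, 'b) mps" is "\<lambda>m. if m = 0 then 1 else 0" .
lift_definition plus_mps :: "('a, 'b) mps \<Rightarrow> ('a, 'b) mps \<Rightarrow> ('a, 'b) mps" is "\<lambda>f g m. f m + g m" .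
lift_definition minus_mps :: "('a, 'b) mps \<Rightarrow> ('a, 'b) mps \<Rightarrow> ('a, 'b) mps" is "\<lambda>f g m. f m - g m" .
lift_definition uminus_mps :: "('a, 'b) mps \<Rightarrow> ('a, 'b) mps" is "\<lambda>f m. - f m" .
lift_definition times_mps :: "('a, 'b) mps \<Rightarrow> ('a, 'b) mps \<Rightarrow> ('a, 'b) mps"
  is "\<lambda>f g m. \<Sum>(a, b) | a + b = m. f a * g b" .

instance
proof
  fix f g h :: "('a, 'b) mps"
  show "f + g + h = f + (g + h)" "f + g = g + f" "0 + f = f" "- f + f = 0" "f - g = f + - g"
    by (transfer, rule ext, simp add: algebra_simps)+
  show "(0 :: ('a, 'b) mps) \<noteq> 1" by transfer (metis zero_neq_one)
  show "(f + g) * h = f * h + g * h"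
    by (transfer, rule ext) (simp add: distrib_right sum.distrib case_prod_unfold)
  show "f * g = g * f"
  proof (transfer, rule ext)
    fix f g :: "('a \<Rightarrow>\<^sub>0 nat) \<Rightarrow> 'b" and m :: "'a \<Rightarrow>\<^sub>0 nat"
    show "(\<Sum>(a, b) | a + b = m. f a * g b) = (\<Sum>(a, b) | a + b = m. g a * f b)"
      by (rule sum.reindex_bij_witness[of _ prod.swap prod.swap])
        (auto simp: add.commute mult.commute)
  qed
  show "1 * f = f"
  proof (transfer, rule ext)
    fix f :: "('a \<Rightarrow>\<^sub>0 nat) \<Rightarrow> 'b" and m :: "'a \<Rightarrow>\<^sub>0 nat"
    have "(\<Sum>(a, b) | a + b = m. (if a = 0 then 1 else 0) * f b)
        = (\<Sum>(a, b) \<in> {(0 :: 'a \<Rightarrow>\<^sub>0 nat, m)}. (if a = 0 then 1 else 0) * f b)"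
      by (rule sum.mono_neutral_right[OF finite_monom_splits]) (auto split: if_splits)
    then show "(\<Sum>(a, b) | a + b = m. (if a = 0 then 1 else 0) * f b) = f m" by simp
  qed
  show "f * g * h = f * (g * h)"
  proof (transfer, rule ext)
    fix f g h :: "('a \<Rightarrow>\<^sub>0 nat) \<Rightarrow> 'b" and m :: "'a \<Rightarrow>\<^sub>0 nat"
    have "(\<Sum>(a, b) | a + b = m. (\<Sum>(c, e) | c + e = a. f c * g e) * h b)
        = (\<Sum>x \<in> {(a, b). a + b = m}. \<Sum>y \<in> {(c, e). c + e = fst x}. f (fst y) * g (snd y) * h (snd x))"
      by (simp add: case_prod_unfold sum_distrib_right)
    also have "\<dots> = (\<Sum>(x, y) \<in> Sigma {(a, b). a + b = m} (\<lambda>x. {(c, e). c + e = fst x}).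
        f (fst y) * g (snd y) * h (snd x))"
      by (rule sum.Sigma) (auto simp: finite_monom_splits)
    also have "\<dots> = (\<Sum>(x, y) \<in> Sigma {(a, b). a + b = m} (\<lambda>x. {(c, e). c + e = snd x}).
        f (fst x) * (g (fst y) * h (snd y)))"
      by (rule sum.reindex_bij_witness[of _ "\<lambda>((a, b), (c, e)). ((a + c, e), (a, c))"
            "\<lambda>((a, b), (c, e)). ((c, e + b), (e, b))"])
        (auto simp: add.assoc mult.assoc)
    also have "\<dots> = (\<Sum>x \<in> {(a, b). a + b = m}. \<Sum>y \<in> {(c, e). c + e = snd x}. f (fst x) * (g (fst y) * h (snd y)))"
      by (rule sum.Sigma[symmetric]) (auto simp: finite_monom_splits)
    also have "\<dots> = (\<Sum>(a, b) | a + b = m. f a * (\<Sum>(c, e) | c + e = b. g c * h e))"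
      by (simp add: case_prod_unfold sum_distrib_left)
    finally show "(\<Sum>(a, b) | a + b = m. (\<Sum>(c, e) | c + e = a. f c * g e) * h b)
        = (\<Sum>(a, b) | a + b = m. f a * (\<Sum>(c, e) | c + e = b. g c * h e))" .
  qed
qed

end

definition mps_var :: "'v \<Rightarrow> ('v, 'a::comm_ring_1) mps" where
  "mps_var v = Abs_mps (\<lambda>m. if m = Poly_Mapping.single v 1 then 1 else 0)"

definition mps_vars_in :: "'v set \<Rightarrow> ('v, 'a::comm_ring_1) mps \<Rightarrow> bool" where
  "mps_vars_in V f \<longleftrightarrow> (\<forall>m. mps_coeff f m \<noteq> 0 \<longrightarrow> Poly_Mapping.keys m \<subseteq> V)"

definition mdeg :: "('v \<Rightarrow>\<^sub>0 nat) \<Rightarrow> nat" where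
  "mdeg m = (\<Sum>v\<in>Poly_Mapping.keys m. Poly_Mapping.lookup m v)"

text \<open>
  Substitution of series \<open>g v\<close> without constant term for the variables \<open>v \<in> V\<close> of a series \<open>f\<close> in
  the variables \<open>V\<close>. The monomial \<open>\<alpha>\<close> of \<open>f\<close> then contributes only to monomials \<open>m\<close> with
  \<open>mdeg \<alpha> \<le> mdeg m\<close>, so each coefficient is a finite sum.
\<close>

definition mps_subst ::
    "'v set \<Rightarrow> ('v \<Rightarrow> ('w, 'a::comm_ring_1) mps) \<Rightarrow> ('v, 'a) mps \<Rightarrow> ('w, 'a) mps" where
  "mps_subst V g f = Abs_mps (\<lambda>m. \<Sum>\<alpha> | Poly_Mapping.keys \<alpha> \<subseteq> V \<and> mdeg \<alpha> \<le> mdeg m.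
      mps_coeff f \<alpha> * mps_coeff (\<Prod>v\<in>V. g v ^ Poly_Mapping.lookup \<alpha> v) m)"

definition monom_eval :: "'v set \<Rightarrow> ('v \<Rightarrow> 'a::comm_ring_1) \<Rightarrow> ('v \<Rightarrow>\<^sub>0 nat) \<Rightarrow> 'a" where
  "monom_eval V x \<alpha> = (\<Prod>v\<in>V. x v ^ Poly_Mapping.lookup \<alpha> v)"

text \<open>The value of a series at a point of \<open>M\<close>, as a limit in the \<open>M\<close>-adic topology.\<close>

definition mps_eval ::
    "'a::comm_ring_1 set \<Rightarrow> 'v set \<Rightarrow> ('v, 'a) mps \<Rightarrow> ('v \<Rightarrow> 'a) \<Rightarrow> 'a" where
  "mps_eval M V f x = (THE l. limitin (adic_topology M)
      (\<lambda>n. \<Sum>\<alpha> | Poly_Mapping.keys \<alpha> \<subseteq> V \<and> mdeg \<alpha> \<le> n. mps_coeff f \<alpha> * monom_eval V x \<alpha>)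
      l sequentially)"


section \<open>Formal group laws and standard groups\<close>

text \<open>
  In \<open>F\<^sub>i(x, y)\<close> the variables \<open>x\<^sub>j\<close> and \<open>y\<^sub>j\<close> are \<open>Inl j\<close> and \<open>Inr j\<close> for \<open>j < d\<close>; in the
  associativity law, \<open>x\<^sub>j\<close>, \<open>y\<^sub>j\<close> and \<open>z\<^sub>j\<close> are \<open>Inl j\<close>, \<open>Inr (Inl j)\<close> and \<open>Inr (Inr j)\<close>.
  Only the components \<open>F i\<close> with \<open>i < d\<close> matter.
\<close>

definition xy_vars :: "nat \<Rightarrow> (nat + nat) set" where
  "xy_vars d = {..<d} <+> {..<d}"

definition fgl_subst ::
    "nat \<Rightarrow> (nat + nat, 'a::comm_ring_1) mps \<Rightarrow> (nat \<Rightarrow> ('w, 'a) mps) \<Rightarrow> (nat \<Rightarrow> ('w, 'a) mps) \<Rightarrow> ('w, 'a) mps"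
  where "fgl_subst d f g h = mps_subst (xy_vars d) (case_sum g h) f"

definition formal_group_law :: "nat \<Rightarrow> (nat \<Rightarrow> (nat + nat, 'a::comm_ring_1) mps) \<Rightarrow> bool" where
  "formal_group_law d F \<longleftrightarrow>
     (\<forall>i<d. mps_vars_in (xy_vars d) (F i)) \<and>
     (\<forall>i<d. fgl_subst d (F i) mps_var (\<lambda>_. 0) = (mps_var i :: (nat, 'a) mps)) \<and>
     (\<forall>i<d. fgl_subst d (F i) (\<lambda>_. 0) mps_var = (mps_var i :: (nat, 'a) mps)) \<and>
     (let x = (\<lambda>j. mps_var (Inl j)); y = (\<lambda>j. mps_var (Inr (Inl j))); z = (\<lambda>j. mps_var (Inr (Inr j)))
      in \<forall>i<d. (fgl_subst d (F i) (\<lambda>j. fgl_subst d (F j) x y) z :: (nat + nat + nat, 'a) mps)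
              = fgl_subst d (F i) x (\<lambda>j. fgl_subst d (F j) y z))"

definition standard_group ::
    "'a::comm_ring_1 set \<Rightarrow> nat \<Rightarrow> (nat \<Rightarrow> (nat + nat, 'a) mps) \<Rightarrow> (nat \<Rightarrow> 'a) monoid" where
  "standard_group M d F =
     \<lparr> carrier = {..<d} \<rightarrow>\<^sub>E M,
       monoid.mult = (\<lambda>x y. \<lambda>i\<in>{..<d}. mps_eval M (xy_vars d) (F i) (case_sum x y)),
       one = (\<lambda>i\<in>{..<d}. 0) \<rparr>"

definition standard_group_topology :: "'a::comm_ring_1 set \<Rightarrow> nat \<Rightarrow> (nat \<Rightarrow> 'a) topology" where
  "standard_group_topology M d = product_topology (\<lambda>_. subtopology (adic_topology M) M) {..<d}"

definition topologically_finitely_generated :: "('g, 'b) monoid_scheme \<Rightarrow> 'g topology \<Rightarrow> bool" where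
  "topologically_finitely_generated G T \<longleftrightarrow>
     (\<exists>S \<subseteq> carrier G. finite S \<and> T closure_of (generate G S) = carrier G)"


section \<open>The Lie algebra of a standard group\<close>

text \<open>
  For a ring or field \<open>K\<close>, the module \<open>K\<^sup>d\<close> consists of the functions \<^typ>\<open>nat \<Rightarrow> 'k\<close>
  vanishing outside \<open>{..<d}\<close>.
\<close>

definition coord_space :: "nat \<Rightarrow> (nat \<Rightarrow> 'k::zero) set" where
  "coord_space d = {u. \<forall>i\<ge>d. u i = 0}"

definition coord_scale :: "'k::times \<Rightarrow> (nat \<Rightarrow> 'k) \<Rightarrow> (nat \<Rightarrow> 'k)" where
  "coord_scale c u = (\<lambda>i. c * u i)"

definition coord_basis :: "nat \<Rightarrow> (nat \<Rightarrow> 'k::zero_neq_one)" where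
  "coord_basis i = (\<lambda>j. if j = i then 1 else 0)"

lemma vector_space_coord_scale: "vector_space (coord_scale :: 'k::field \<Rightarrow> _)"
  by unfold_locales (auto simp: coord_scale_def fun_eq_iff algebra_simps)

text \<open>The degree 2 part \<open>B\<close> of \<open>F\<close>, and the bracket \<open>C(x, y) = B(x, y) - B(y, x)\<close> on \<open>R\<^sup>d\<close>.\<close>

definition fgl_quadratic_part ::
    "nat \<Rightarrow> (nat \<Rightarrow> (nat + nat, 'a::comm_ring_1) mps) \<Rightarrow> (nat \<Rightarrow> 'a) \<Rightarrow> (nat \<Rightarrow> 'a) \<Rightarrow> (nat \<Rightarrow> 'a)" where
  "fgl_quadratic_part d F x y = (\<lambda>i. if i < d
     then \<Sum>\<alpha> | Poly_Mapping.keys \<alpha> \<subseteq> xy_vars d \<and> mdeg \<alpha> = 2.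
            mps_coeff (F i) \<alpha> * monom_eval (xy_vars d) (case_sum x y) \<alpha>
     else 0)"

definition fgl_bracket ::
    "nat \<Rightarrow> (nat \<Rightarrow> (nat + nat, 'a::comm_ring_1) mps) \<Rightarrow> (nat \<Rightarrow> 'a) \<Rightarrow> (nat \<Rightarrow> 'a) \<Rightarrow> (nat \<Rightarrow> 'a)" where
  "fgl_bracket d F x y = fgl_quadratic_part d F x y - fgl_quadratic_part d F y x"

text \<open>
  Extension of scalars of the free \<open>R\<close>-module \<open>R\<^sup>d\<close> with an \<open>R\<close>-bilinear bracket to the field of
  fractions \<open>D\<close> of \<open>R\<close>: \<open>D \<otimes>\<^sub>R R\<^sup>d\<close> is \<open>D\<^sup>d\<close>, with \<open>1 \<otimes> e\<^sub>i\<close> corresponding to the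
  \<open>i\<close>-th unit vector, and \<open>[a \<otimes> e\<^sub>i, b \<otimes> e\<^sub>j] = ab \<otimes> [e\<^sub>i, e\<^sub>j]\<close>.
\<close>

definition fract_bracket ::
    "nat \<Rightarrow> ((nat \<Rightarrow> 'a::idom) \<Rightarrow> (nat \<Rightarrow> 'a) \<Rightarrow> (nat \<Rightarrow> 'a))
      \<Rightarrow> (nat \<Rightarrow> 'a fract) \<Rightarrow> (nat \<Rightarrow> 'a fract) \<Rightarrow> (nat \<Rightarrow> 'a fract)" where
  "fract_bracket d br u v =
     (\<lambda>k. \<Sum>i<d. \<Sum>j<d. u i * v j * Fract (br (coord_basis i) (coord_basis j) k) 1)"


section \<open>Soluble radical and nilpotency of Lie algebras\<close>

text \<open>
  A Lie algebra over a field is given by the scalar multiplication \<open>sc\<close> of a vector space, a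
  subspace \<open>L\<close> as its carrier, and its bracket \<open>br\<close>.
\<close>

definition lie_commutator ::
    "('k::field \<Rightarrow> 'v \<Rightarrow> 'v::ab_group_add) \<Rightarrow> ('v \<Rightarrow> 'v \<Rightarrow> 'v) \<Rightarrow> 'v set \<Rightarrow> 'v set \<Rightarrow> 'v set" where
  "lie_commutator sc br A B = module.span sc {br x y |x y. x \<in> A \<and> y \<in> B}"

definition lie_ideal ::
    "('k::field \<Rightarrow> 'v \<Rightarrow> 'v::ab_group_add) \<Rightarrow> ('v \<Rightarrow> 'v \<Rightarrow> 'v) \<Rightarrow> 'v set \<Rightarrow> 'v set \<Rightarrow> bool" where
  "lie_ideal sc br L I \<longleftrightarrow> module.subspace sc I \<and> I \<subseteq> L \<and> (\<forall>x\<in>L. \<forall>y\<in>I. br x y \<in> I)"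

primrec lie_derived_series ::
    "('k::field \<Rightarrow> 'v \<Rightarrow> 'v::ab_group_add) \<Rightarrow> ('v \<Rightarrow> 'v \<Rightarrow> 'v) \<Rightarrow> 'v set \<Rightarrow> nat \<Rightarrow> 'v set" where
  "lie_derived_series sc br L 0 = L"
| "lie_derived_series sc br L (Suc n) =
     lie_commutator sc br (lie_derived_series sc br L n) (lie_derived_series sc br L n)"

primrec lie_lower_central_series ::
    "('k::field \<Rightarrow> 'v \<Rightarrow> 'v::ab_group_add) \<Rightarrow> ('v \<Rightarrow> 'v \<Rightarrow> 'v) \<Rightarrow> 'v set \<Rightarrow> nat \<Rightarrow> 'v set" where
  "lie_lower_central_series sc br L 0 = L"
| "lie_lower_central_series sc br L (Suc n) =
     lie_commutator sc br (lie_lower_central_series sc br L n) L"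

definition lie_soluble ::
    "('k::field \<Rightarrow> 'v \<Rightarrow> 'v::ab_group_add) \<Rightarrow> ('v \<Rightarrow> 'v \<Rightarrow> 'v) \<Rightarrow> 'v set \<Rightarrow> bool" where
  "lie_soluble sc br L \<longleftrightarrow> (\<exists>n. lie_derived_series sc br L n = {0})"

definition lie_nilpotent ::
    "('k::field \<Rightarrow> 'v \<Rightarrow> 'v::ab_group_add) \<Rightarrow> ('v \<Rightarrow> 'v \<Rightarrow> 'v) \<Rightarrow> 'v set \<Rightarrow> bool" where
  "lie_nilpotent sc br L \<longleftrightarrow> (\<exists>n. lie_lower_central_series sc br L n = {0})"

text \<open>The sum of all soluble ideals; for finite dimensional \<open>L\<close> it is the largest soluble ideal.\<close>

definition soluble_radical ::
    "('k::field \<Rightarrow> 'v \<Rightarrow> 'v::ab_group_add) \<Rightarrow> ('v \<Rightarrow> 'v \<Rightarrow> 'v) \<Rightarrow> 'v set \<Rightarrow> 'v set" where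
  "soluble_radical sc br L = module.span sc (\<Union>{I. lie_ideal sc br L I \<and> lie_soluble sc br I})"

end

theory Submission
  imports Defs
begin

text \<open>
  The radical is nilpotent as soon as \<open>L = D \<otimes> L(G)\<close> is perfect: modulo stable subspaces, an
  abelian ideal \<open>A\<close> acts on an irreducible subquotient by operators all of whose powers have trace
  zero, so \<open>A\<close> acts as zero, and by induction on the derived length so does every soluble ideal.

  To see that \<open>L\<close> is perfect, let \<open>\<lambda>\<close> be a linear form on \<open>R\<^sup>d\<close> that vanishes on all brackets. For
  every \<open>s\<close> there is a polynomial \<open>g\<close> with linear part \<open>p\<^sup>s\<^sup>-\<^sup>1 \<lambda>\<close> such that \<open>g (F(x, y)) - g x - g y\<close>
  has order greater than \<open>s\<close>: its terms are found degree by degree, the obstruction in degree \<open>n\<close>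
  being a symmetric cocycle, which is a coboundary after multiplication by \<open>p\<close>. Hence \<open>g\<close> is a
  homomorphism from a congruence subgroup of \<open>G\<close> to the additive group of \<open>R\<close> modulo a high power
  of \<open>M\<close>. The number of generators of its image is bounded independently of \<open>s\<close>, because a
  subgroup of finite index of a finitely generated group is finitely generated. On the other hand
  \<open>M\<^sup>i\<close> is not contained in \<open>M\<^sup>i\<^sup>+\<^sup>1 + p R\<close> for any \<open>i\<close>, as the Krull dimension is greater than one,
  so the image needs more and more generators as \<open>s\<close> grows, unless \<open>\<lambda> = 0\<close>.
\<close>

section \<open>Traces on subquotients of a vector space\<close>

text \<open>Over D the form \<lambda> integrates to a full logarithm of the formal group, but in
  general its denominators contain unbounded powers of p. The construction therefore stays in R and
  truncates: raising the order by one costs exactly one factor p, because the other factor to be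
  divided by, 1 - p^(n-1), is a unit. So the loss is linear in s. Cancelling p^N with N = s - 1 + e
  costs at most c N steps of the M-adic filtration, where c is the Artin-Rees constant of p, while
  on the level K subgroup the error lies in M^(K (s + 1)). With K = c + 1 the remaining precision is
  s plus a constant, however large c is. The number of generators depends on K but not on s, so s
  can be chosen after it.

  On the Lie side traces take the place of eigenvalues, which keeps the argument over D without
  passing to an algebraic closure; in characteristic 0 the dimension of a nonzero space is a nonzero
  scalar, and this is what a vanishing trace contradicts.\<close>

locale subquotient_trace = vector_space scale
  for scale :: "'a::field \<Rightarrow> 'b::ab_group_add \<Rightarrow> 'b"
begin

lemma independent_extend_basis:
  assumes "subspace U" "U \<subseteq> span E" "finite E" "independent B0" "B0 \<subseteq> U"
  obtains B where "B0 \<subseteq> B" "finite B" "independent B" "span B = U"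
proof -
  obtain B where B: "B0 \<subseteq> B" "B \<subseteq> U" "independent B" "U \<subseteq> span B"
    using maximal_independent_subset_extend[OF assms(5,4)] by blast
  have "finite B"
    using independent_span_bound[OF assms(3) B(3)] B(2) assms(2) by blast
  moreover have "span B = U"
    using B(2,4) assms(1) span_minimal by blast
  ultimately show ?thesis using that B by blast
qed

text \<open>The ambient type is not assumed finite dimensional, so comparisons of dimensions carry a
  finite set \<open>E\<close> whose span contains the larger space.\<close>

lemma subspace_dim_less:
  assumes "subspace S" "subspace T" "S \<subset> T" "T \<subseteq> span E" "finite E"
  shows "dim S < dim T"
proof -
  obtain B0 where B0: "finite B0" "independent B0" "span B0 = S"
    using independent_extend_basis[of S E "{}"] assms by (metis order.trans empty_subsetI independent_empty psubset_imp_subset)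
  then have "B0 \<subseteq> T" using assms(3) span_superset by blast
  then obtain B where B: "B0 \<subseteq> B" "finite B" "independent B" "span B = T"
    using independent_extend_basis[OF assms(2,4,5) B0(2)] by blast
  have "B0 \<subset> B" using B0 B assms(3) by blast
  then have "card B0 < card B" using B(2) psubset_card_mono by blast
  then show ?thesis
    using B0 B dim_span_eq_card_independent by metis
qed

text \<open>
  For \<open>B0 \<subseteq> B\<close> spanning subspaces \<open>W \<subseteq> U\<close>, this is the trace of the operator induced by \<open>f\<close>
  on \<open>U / W\<close>.
\<close>

definition qtrace :: "'b set \<Rightarrow> 'b set \<Rightarrow> ('b \<Rightarrow> 'b) \<Rightarrow> 'a" where
  "qtrace B0 B f = (\<Sum>b\<in>B - B0. representation B (f b) b)"

definition adapted :: "'b set \<Rightarrow> 'b set \<Rightarrow> 'b set \<Rightarrow> 'b set \<Rightarrow> bool" where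
  "adapted W U B0 B \<longleftrightarrow> B0 \<subseteq> B \<and> finite B \<and> independent B \<and> span B0 = W \<and> span B = U"

definition preserves :: "'b set \<Rightarrow> 'b set \<Rightarrow> ('b \<Rightarrow> 'b) \<Rightarrow> bool" where
  "preserves W U f \<longleftrightarrow> Vector_Spaces.linear scale scale f \<and> f ` U \<subseteq> U \<and> f ` W \<subseteq> W"

lemma preserves_comp: "preserves W U f \<Longrightarrow> preserves W U g \<Longrightarrow> preserves W U (f \<circ> g)"
  unfolding preserves_def by (auto simp: image_subset_iff intro: Vector_Spaces.linear_compose)

lemma preserves_funpow: "preserves W U f \<Longrightarrow> preserves W U (f ^^ n)"
proof (induction n)
  case 0
  then show ?case by (auto simp: preserves_def linear_ident id_def)
next
  case (Suc n)
  then show ?case using preserves_comp[of W U f "f ^^ n"] by (simp only: funpow.simps(2))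
qed

lemma adapted_span:
  assumes "adapted W U B0 B"
  shows "subspace W" "subspace U" "W \<subseteq> U"
  using assms unfolding adapted_def by (auto intro: span_mono[THEN subsetD])

lemma representation_sub:
  assumes "adapted W U B0 B" "w \<in> W" "b \<notin> B0"
  shows "representation B w b = 0"
proof -
  have "representation B w = representation B0 w"
    using assms representation_extend unfolding adapted_def by metis
  then show ?thesis using assms(3) representation_ne_zero by metis
qed

text \<open>Elements of \<open>W\<close> have no coefficient at basis vectors outside
  \<open>B0\<close>, so \<open>qtrace\<close> sees operators only modulo \<open>W\<close>.\<close>

lemma qtrace_cong:
  assumes "adapted W U B0 B" "f ` U \<subseteq> U" "g ` U \<subseteq> U" "\<And>u. u \<in> U \<Longrightarrow> f u - g u \<in> W"
  shows "qtrace B0 B f = qtrace B0 B g"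
  unfolding qtrace_def
proof (rule sum.cong[OF refl])
  fix b assume b: "b \<in> B - B0"
  then have bU: "b \<in> U" using assms(1) span_base unfolding adapted_def by blast
  then have "representation B (f b - g b) b = 0"
    using representation_sub[OF assms(1)] assms(4) b by blast
  moreover have "representation B (f b - g b) b = representation B (f b) b - representation B (g b) b"
    using assms bU representation_diff[of B "g b" "f b"] unfolding adapted_def by (auto simp: image_subset_iff)
  ultimately show "representation B (f b) b = representation B (g b) b" by simp
qed

lemma qtrace_add:
  assumes "adapted W U B0 B" "f ` U \<subseteq> U" "g ` U \<subseteq> U"
  shows "qtrace B0 B (\<lambda>x. f x + g x) = qtrace B0 B f + qtrace B0 B g"
  unfolding qtrace_def sum.distrib[symmetric]
proof (rule sum.cong[OF refl])
  fix b assume b: "b \<in> B - B0"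
  then have bU: "b \<in> U" using assms(1) span_base unfolding adapted_def by blast
  then show "representation B (f b + g b) b = representation B (f b) b + representation B (g b) b"
    using assms representation_add[of B "f b" "g b"] representation_add[of B "g b" "f b"]
    unfolding adapted_def by (auto simp: image_subset_iff)
qed

lemma qtrace_scale:
  assumes "adapted W U B0 B" "f ` U \<subseteq> U"
  shows "qtrace B0 B (\<lambda>x. scale c (f x)) = c * qtrace B0 B f"
  unfolding qtrace_def sum_distrib_left
proof (rule sum.cong[OF refl])
  fix b assume b: "b \<in> B - B0"
  then have bU: "b \<in> U" using assms(1) span_base unfolding adapted_def by blast
  then show "representation B (scale c (f b)) b = c * representation B (f b) b"
    using assms representation_scale[of B "f b" c] unfolding adapted_def by auto
qed

lemma qtrace_zero: "adapted W U B0 B \<Longrightarrow> qtrace B0 B (\<lambda>x. 0) = 0"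
  unfolding qtrace_def adapted_def by (simp add: representation_zero)

lemma qtrace_id: "adapted W U B0 B \<Longrightarrow> qtrace B0 B (\<lambda>x. x) = of_nat (card (B - B0))"
  unfolding qtrace_def adapted_def by (simp add: representation_basis)

lemma qtrace_comp_expand:
  assumes ad: "adapted W U B0 B" and f: "preserves W U f" and g: "preserves W U g"
  shows "qtrace B0 B (f \<circ> g)
    = (\<Sum>b\<in>B - B0. \<Sum>c\<in>B - B0. representation B (g b) c * representation B (f c) b)"
  unfolding qtrace_def
proof (rule sum.cong[OF refl])
  fix b assume b: "b \<in> B - B0"
  have B: "independent B" "finite B" "span B = U" "span B0 = W" "B0 \<subseteq> B"
    using ad unfolding adapted_def by auto
  have U: "c \<in> U" if "c \<in> B" for c using that B(3) span_base by blast
  have gU: "g b \<in> span B" using U[of b] b g B(3) unfolding preserves_def by auto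
  have fU: "f c \<in> span B" if "c \<in> B" for c using U[of c] that f B(3) unfolding preserves_def by auto
  have lf: "Vector_Spaces.linear scale scale f" using f unfolding preserves_def by blast
  interpret f: Vector_Spaces.linear scale scale f by (rule lf)
  have "f (g b) = f (\<Sum>c\<in>B. scale (representation B (g b) c) c)"
    using sum_representation_eq[OF B(1) gU B(2)] by simp
  also have "\<dots> = (\<Sum>c\<in>B. scale (representation B (g b) c) (f c))"
    by (simp add: f.sum f.scale)
  finally have "representation B (f (g b)) b = (\<Sum>c\<in>B. representation B (scale (representation B (g b) c) (f c)) b)"
    using representation_sum[OF B(1), of B "\<lambda>c. scale (representation B (g b) c) (f c)"]
    by (simp add: fU span_scale)
  also have "\<dots> = (\<Sum>c\<in>B. representation B (g b) c * representation B (f c) b)"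
    by (rule sum.cong[OF refl]) (simp add: representation_scale[OF B(1) fU])
  \<comment> \<open>The matrix of \<open>f\<close> is block triangular: \<open>f\<close> maps
    \<open>B0\<close> into \<open>W\<close>, so the vectors \<open>c\<close> in \<open>B0\<close>
    contribute nothing at \<open>b\<close>.\<close>
  also have "\<dots> = (\<Sum>c\<in>B - B0. representation B (g b) c * representation B (f c) b)"
  proof (rule sum.mono_neutral_right)
    show "\<forall>c\<in>B - (B - B0). representation B (g b) c * representation B (f c) b = 0"
    proof
      fix c assume "c \<in> B - (B - B0)"
      then have "c \<in> W" using B(4) span_base by blast
      then have "f c \<in> W" using f unfolding preserves_def by blast
      then show "representation B (g b) c * representation B (f c) b = 0"
        using representation_sub[OF ad] b by simp
    qed
  qed (use B(2) in auto)
  finally show "representation B ((f \<circ> g) b) b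
      = (\<Sum>c\<in>B - B0. representation B (g b) c * representation B (f c) b)" by simp
qed

lemma qtrace_commute:
  assumes "adapted W U B0 B" "preserves W U f" "preserves W U g"
  shows "qtrace B0 B (f \<circ> g) = qtrace B0 B (g \<circ> f)"
  unfolding qtrace_comp_expand[OF assms] qtrace_comp_expand[OF assms(1,3,2)]
  by (subst sum.swap) (simp add: mult.commute)

end

text \<open>Gaussian elimination: equation \<open>a\<close> expresses the unknown number
  \<open>m\<close> through the others, which \<open>s\<close> renumbers. It later yields a linear
  relation between the powers of an operator.\<close>

lemma homogeneous_system_nontrivial:
  fixes x :: "nat \<Rightarrow> 'j \<Rightarrow> 'k::field"
  assumes "finite J"
  shows "\<exists>c. (\<exists>i\<le>card J. c i \<noteq> 0) \<and> (\<forall>j\<in>J. (\<Sum>i\<le>card J. c i * x i j) = 0)"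
  using assms
proof (induction J arbitrary: x rule: finite_induct)
  case empty
  show ?case by (rule exI[of _ "\<lambda>_. 1"]) auto
next
  case (insert a J)
  let ?n = "card J"
  show ?case
  proof (cases "\<forall>i\<le>Suc ?n. x i a = 0")
    case True
    obtain c where c: "\<exists>i\<le>?n. c i \<noteq> 0" "\<forall>j\<in>J. (\<Sum>i\<le>?n. c i * x i j) = 0"
      using insert.IH[of x] by blast
    show ?thesis
      using c insert.hyps True
      by (intro exI[of _ "\<lambda>i. if i \<le> ?n then c i else 0"]) auto
  next
    case False
    then obtain m where m: "m \<le> Suc ?n" "x m a \<noteq> 0" by blast
    define s where "s i = (if i < m then i else Suc i)" for i
    define y where "y i j = x (s i) j - x (s i) a / x m a * x m j" for i j
    obtain c where c: "\<exists>i\<le>?n. c i \<noteq> 0" "\<forall>j\<in>J. (\<Sum>i\<le>?n. c i * y i j) = 0"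
      using insert.IH[of y] by blast
    define c' where "c' i = (if i = m then - (\<Sum>i\<le>?n. c i * (x (s i) a / x m a))
        else if i < m then c i else c (i - 1))" for i
    have inj: "inj_on s {..?n}" by (auto simp: inj_on_def s_def split: if_splits)
    have im: "{..Suc ?n} = insert m (s ` {..?n})"
    proof -
      have "i \<in> insert m (s ` {..?n})" if "i \<le> Suc ?n" for i
      proof -
        have "i < m \<Longrightarrow> i = s i \<and> i \<le> ?n" using m(1) by (auto simp: s_def)
        moreover have "i > m \<Longrightarrow> i = s (i - 1) \<and> i - 1 \<le> ?n" using that by (auto simp: s_def)
        ultimately show ?thesis by (cases i m rule: linorder_cases) auto
      qed
      then show ?thesis using m(1) by (auto simp: s_def)
    qed
    have ms: "m \<notin> s ` {..?n}" by (auto simp: s_def split: if_splits)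
    have c's: "c' (s i) = c i" for i by (auto simp: c'_def s_def)
    have eq: "(\<Sum>i\<le>Suc ?n. c' i * x i j) = (\<Sum>i\<le>?n. c i * y i j)" for j
    proof -
      have "(\<Sum>i\<le>Suc ?n. c' i * x i j) = c' m * x m j + (\<Sum>i\<le>?n. c i * x (s i) j)"
        unfolding im using ms by (simp add: sum.reindex[OF inj] c's)
      then show ?thesis
        by (simp add: y_def c'_def algebra_simps sum_subtractf sum_distrib_left sum_distrib_right)
    qed
    have "(\<Sum>i\<le>?n. c i * y i a) = 0" using m(2) by (simp add: y_def)
    moreover obtain i where "i \<le> ?n" "c i \<noteq> 0" using c(1) by blast
    moreover have "s i \<le> Suc ?n" if "i \<le> ?n" for i using that by (auto simp: s_def)
    ultimately show ?thesis
      using c(2) insert.hyps eq c's by (intro exI[of _ c']) (auto, metis)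
  qed
qed

section \<open>Nilpotent operators on a subquotient\<close>

context subquotient_trace
begin

lemma qtrace_sum:
  assumes "adapted W U B0 B" "finite J" "\<And>j. j \<in> J \<Longrightarrow> h j ` U \<subseteq> U"
  shows "qtrace B0 B (\<lambda>u. \<Sum>j\<in>J. scale (c j) (h j u)) = (\<Sum>j\<in>J. c j * qtrace B0 B (h j))"
  using assms(2,3)
proof (induction J rule: finite_induct)
  case empty
  then show ?case using qtrace_zero[OF assms(1)] by simp
next
  case (insert a J)
  have U: "subspace U" using adapted_span[OF assms(1)] by blast
  have "(\<lambda>u. scale (c a) (h a u)) ` U \<subseteq> U"
    using insert.prems[of a] U by (auto intro: subspace_scale)
  moreover have "(\<lambda>u. \<Sum>j\<in>J. scale (c j) (h j u)) ` U \<subseteq> U"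
    using insert.prems U by (fastforce intro!: subspace_sum subspace_scale)
  ultimately show ?case
    using qtrace_add[OF assms(1)] qtrace_scale[OF assms(1) insert.prems[of a]] insert by simp
qed

lemma qtrace_eq_0:
  assumes "adapted W U B0 B" "f ` U \<subseteq> W"
  shows "qtrace B0 B f = 0"
proof -
  have "qtrace B0 B f = qtrace B0 B (\<lambda>_. 0)"
    using adapted_span[OF assms(1)] assms(2)
    by (intro qtrace_cong[OF assms(1)]) (auto simp: subspace_0)
  then show ?thesis using qtrace_zero[OF assms(1)] by simp
qed

text \<open>
  On the stable part \<open>V / W\<close> of \<open>U / W\<close> a power \<open>F\<close> of \<open>f\<close> is onto, so a linear relation between
  the powers of \<open>F\<close> may be divided by a power of \<open>F\<close> until its constant term is non-zero. Taking
  traces, \<open>dim (V / W)\<close> vanishes in the field.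
\<close>

lemma traceless_powers_nilpotent:
  assumes char: "\<And>n. n > 0 \<Longrightarrow> of_nat n \<noteq> (0 :: 'a)"
    and E: "U \<subseteq> span E" "finite E" and sub: "subspace W" "subspace U" "W \<subseteq> U"
    and f: "preserves W U f"
    and tr: "\<And>k B0 B. k \<ge> 1 \<Longrightarrow> adapted W U B0 B \<Longrightarrow> qtrace B0 B (f ^^ k) = 0"
  shows "\<exists>n. (f ^^ n) ` U \<subseteq> W"
proof -
  define V where "V n = {(f ^^ n) u + w |u w. u \<in> U \<and> w \<in> W}" for n
  have lin: "Vector_Spaces.linear scale scale (f ^^ n)" and pU: "(f ^^ n) ` U \<subseteq> U"
    and pW: "(f ^^ n) ` W \<subseteq> W" for n
    using preserves_funpow[OF f] unfolding preserves_def by blast+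
  have subV: "subspace (V n)" for n
  proof -
    interpret l: Vector_Spaces.linear scale scale "f ^^ n" by (rule lin)
    have "V n = {x + y |x y. x \<in> (f ^^ n) ` U \<and> y \<in> W}" unfolding V_def by blast
    then show ?thesis using subspace_sums[OF l.subspace_image[OF sub(2)] sub(1)] by simp
  qed
  have VU: "V n \<subseteq> U" for n
    using pU sub unfolding V_def by (fastforce intro: subspace_add)
  have WV: "W \<subseteq> V n" for n
  proof -
    interpret l: Vector_Spaces.linear scale scale "f ^^ n" by (rule lin)
    have "w = (f ^^ n) 0 + w" for w by (simp add: l.zero)
    then show ?thesis using subspace_0[OF sub(2)] unfolding V_def by blast
  qed
  have fV: "(f ^^ n) ` U \<subseteq> V n" for n
  proof -
    have "(f ^^ n) u = (f ^^ n) u + 0" for u by simp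
    then show ?thesis using subspace_0[OF sub(1)] unfolding V_def by blast
  qed
  have decr: "V (Suc n) \<subseteq> V n" for n
  proof
    fix x assume "x \<in> V (Suc n)"
    then obtain u w where "u \<in> U" "w \<in> W" "x = (f ^^ n) (f u) + w"
      unfolding V_def by (auto simp: funpow_swap1)
    moreover have "f u \<in> U" using f \<open>u \<in> U\<close> unfolding preserves_def by blast
    ultimately show "x \<in> V n" unfolding V_def by blast
  qed
  then have anti: "V n \<subseteq> V m" if "m \<le> n" for m n
    using that lift_Suc_antimono_le[of V] by blast
  obtain N where N: "\<And>n. dim (V N) \<le> dim (V n)"
    using ex_has_least_nat[of "\<lambda>_. True" 0 "\<lambda>n. dim (V n)"] by blast
  have stable: "V n = V N" if "n \<ge> N" for n
    using subspace_dim_less[OF subV subV _ order.trans[OF VU E(1)] E(2), of n N] N[of n] anti[OF that]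
    by auto
  \<comment> \<open>With \<open>Suc N\<close> instead of \<open>N\<close>, \<open>F\<close> is a
    positive power of \<open>f\<close> even when \<open>N\<close> is 0, so the hypothesis on traces
    covers every positive power of \<open>F\<close>.\<close>
  define F where "F = f ^^ Suc N"
  define V1 where "V1 = V (Suc N)"
  have pF: "preserves W U F" unfolding F_def using preserves_funpow[OF f] by blast
  have linF: "Vector_Spaces.linear scale scale (F ^^ n)" for n
    using preserves_funpow[OF pF] unfolding preserves_def by blast
  have V1: "subspace V1" "V1 \<subseteq> U" "W \<subseteq> V1" "F ` U \<subseteq> V1"
    unfolding V1_def F_def by (rule subV VU WV fV)+
  have FV: "preserves W V1 F" using pF V1 unfolding preserves_def by blast
  have surj: "\<exists>u\<in>V1. \<exists>w\<in>W. v = F u + w" if v: "v \<in> V1" for v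
  proof -
    have "V1 = V (Suc N + Suc N)" unfolding V1_def using stable[of "Suc N"] stable[of "Suc N + Suc N"] by simp
    then obtain u w where "u \<in> U" "w \<in> W" "v = (f ^^ (Suc N + Suc N)) u + w"
      using v unfolding V_def by blast
    moreover have "(f ^^ (Suc N + Suc N)) u = F (F u)"
      by (simp only: F_def funpow_add o_apply)
    ultimately have "u \<in> U" "w \<in> W" "v = F (F u) + w" by auto
    then show ?thesis using V1(4) by blast
  qed
  have surjn: "\<exists>u\<in>V1. \<exists>w\<in>W. v = (F ^^ n) u + w" if "v \<in> V1" for v n
    using that
  proof (induction n arbitrary: v)
    case 0
    then show ?case using subspace_0[OF sub(1)] by (intro bexI[of _ v] bexI[of _ 0]) auto
  next
    case (Suc n)
    obtain u w where u: "u \<in> V1" "w \<in> W" "v = (F ^^ n) u + w" using Suc.IH[OF Suc.prems] by blast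
    obtain u' w' where u': "u' \<in> V1" "w' \<in> W" "u = F u' + w'" using surj[OF u(1)] by blast
    interpret l: Vector_Spaces.linear scale scale "F ^^ n" by (rule linF)
    have "v = (F ^^ Suc n) u' + ((F ^^ n) w' + w)"
      unfolding u(3) u'(3) l.add by (simp add: funpow_swap1 add.assoc)
    moreover have "(F ^^ n) w' + w \<in> W"
      using preserves_funpow[OF FV, of n] u u' sub(1) unfolding preserves_def
      by (auto intro: subspace_add)
    ultimately show ?case using u'(1) by blast
  qed
  obtain B0 where B0: "finite B0" "independent B0" "span B0 = W"
    using independent_extend_basis[OF sub(1) order.trans[OF sub(3) E(1)] E(2), of "{}"] independent_empty
    by (metis empty_subsetI)
  have "B0 \<subseteq> V1" using B0(3) V1(3) span_superset by blast
  then obtain B1 where B1: "B0 \<subseteq> B1" "finite B1" "independent B1" "span B1 = V1"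
    using independent_extend_basis[OF V1(1) order.trans[OF V1(2) E(1)] E(2) B0(2)] by blast
  have "B1 \<subseteq> U" using B1(4) V1(2) span_superset by blast
  then obtain B where B: "B1 \<subseteq> B" "finite B" "independent B" "span B = U"
    using independent_extend_basis[OF sub(2) E(1,2) B1(3)] by blast
  have ad: "adapted W U B0 B" and ad1: "adapted W V1 B0 B1" and ad2: "adapted V1 U B1 B"
    unfolding adapted_def using B0 B1 B by auto
  \<comment> \<open>A positive power of \<open>F\<close> maps \<open>U\<close> into
    \<open>V1\<close>, so its trace on U / W is already its trace on V1 / W.\<close>
  have tr1: "qtrace B0 B1 (F ^^ k) = 0" if k: "k \<ge> 1" for k
  proof -
    obtain k' where k': "k = Suc k'" using k by (cases k) auto
    have FkV: "(F ^^ k) ` U \<subseteq> V1"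
      using V1(4) preserves_funpow[OF pF, of k'] unfolding k' preserves_def by auto
    have "qtrace B0 B (F ^^ k) = (\<Sum>b\<in>B1 - B0. representation B ((F ^^ k) b) b)"
      unfolding qtrace_def
    proof (rule sum.mono_neutral_right)
      show "\<forall>b\<in>B - B0 - (B1 - B0). representation B ((F ^^ k) b) b = 0"
      proof
        fix b assume b: "b \<in> B - B0 - (B1 - B0)"
        then have "(F ^^ k) b \<in> V1" using FkV B(4) span_base by blast
        then show "representation B ((F ^^ k) b) b = 0" using representation_sub[OF ad2] b by blast
      qed
    qed (use B B1 in auto)
    also have "\<dots> = qtrace B0 B1 (F ^^ k)"
      unfolding qtrace_def
    proof (rule sum.cong[OF refl])
      fix b assume b: "b \<in> B1 - B0"
      then have "(F ^^ k) b \<in> span B1" using FkV B1(4) V1(2) span_base by blast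
      then show "representation B ((F ^^ k) b) b = representation B1 ((F ^^ k) b) b"
        using representation_extend[OF B(3) _ B(1)] by simp
    qed
    finally show ?thesis
      using tr[OF _ ad, of "Suc N * k"] that unfolding F_def funpow_mult by (simp add: mult.commute)
  qed
  \<comment> \<open>One equation for each matrix entry on V1 / W: taking one more power of
    \<open>F\<close> than there are entries forces a linear relation.\<close>
  let ?J = "(B1 - B0) \<times> (B1 - B0)"
  let ?N = "card ?J"
  obtain c where c: "\<exists>i\<le>?N. c i \<noteq> 0"
    "\<forall>j\<in>?J. (\<Sum>i\<le>?N. c i * representation B1 ((F ^^ i) (fst j)) (snd j)) = 0"
    using homogeneous_system_nontrivial[of ?J "\<lambda>i j. representation B1 ((F ^^ i) (fst j)) (snd j)"]
      B1(2) by auto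
  define G where "G u = (\<Sum>i\<le>?N. scale (c i) ((F ^^ i) u))" for u
  have FiV: "(F ^^ i) u \<in> V1" if "u \<in> V1" for i u
    using preserves_funpow[OF FV, of i] that unfolding preserves_def by blast
  have FiW: "(F ^^ i) u \<in> W" if "u \<in> W" for i u
    using preserves_funpow[OF FV, of i] that unfolding preserves_def by blast
  have linsum: "Vector_Spaces.linear scale scale (\<lambda>u. \<Sum>i\<in>I. scale (a i) ((F ^^ m i) u))"
    for a I and m :: "nat \<Rightarrow> nat"
  proof -
    have "(F ^^ i) (x + y) = (F ^^ i) x + (F ^^ i) y" "(F ^^ i) (scale r x) = scale r ((F ^^ i) x)"
      for i x y r
      using linF[of i] unfolding Vector_Spaces.linear_iff by blast+
    then show ?thesis
      unfolding Vector_Spaces.linear_iff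
      by (auto simp: vector_space_axioms scale_right_distrib sum.distrib scale_sum_right mult.commute)
  qed
  have GB: "G b \<in> W" if b: "b \<in> B1" for b
  proof (cases "b \<in> B0")
    case True
    then have "b \<in> W" using B0(3) span_base by blast
    then show ?thesis unfolding G_def using FiW sub(1) by (auto intro!: subspace_sum subspace_scale)
  next
    case False
    have b1: "b \<in> V1" using b B1(4) span_base by blast
    have GV: "G b \<in> span B1"
      unfolding G_def B1(4) using FiV[OF b1] V1(1) by (auto intro!: subspace_sum subspace_scale)
    have rep: "representation B1 (G b) b' = 0" if "b' \<in> B1 - B0" for b'
    proof -
      have "representation B1 (G b) b' = (\<Sum>i\<le>?N. c i * representation B1 ((F ^^ i) b) b')"
        unfolding G_def using FiV[OF b1] B1(4)
        by (subst representation_sum[OF B1(3)]) (auto simp: representation_scale[OF B1(3)] span_scale)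
      then show ?thesis using c(2) that b False by auto
    qed
    have "G b = (\<Sum>b'\<in>B1. scale (representation B1 (G b) b') b')"
      using sum_representation_eq[OF B1(3) GV B1(2)] by simp
    also have "\<dots> = (\<Sum>b'\<in>B0. scale (representation B1 (G b) b') b')"
      by (rule sum.mono_neutral_right) (use B1 rep in auto)
    also have "\<dots> \<in> W" unfolding B0(3)[symmetric] by (intro span_sum span_scale span_base)
    finally show ?thesis .
  qed
  have GV: "G u \<in> W" if "u \<in> V1" for u
  proof -
    interpret G: Vector_Spaces.linear scale scale G
      using linsum[where m = "\<lambda>i. i"] unfolding G_def[abs_def] .
    have "V1 \<subseteq> {u. G u \<in> W}"
      unfolding B1(4)[symmetric]
    proof (rule span_minimal)
      show "subspace {u. G u \<in> W}"
        using G.subspace_vimage[OF sub(1)] by (simp add: vimage_def)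
    qed (use GB in auto)
    then show ?thesis using that by blast
  qed
  define i0 where "i0 = (LEAST i. c i \<noteq> 0)"
  have ci0: "c i0 \<noteq> 0" using c(1) LeastI_ex[of "\<lambda>i. c i \<noteq> 0"] unfolding i0_def by blast
  have i0N: "i0 \<le> ?N" using c(1) Least_le[of "\<lambda>i. c i \<noteq> 0"] unfolding i0_def by force
  have small: "c i = 0" if "i < i0" for i using not_less_Least that unfolding i0_def by blast
  define g where "g u = (\<Sum>j\<le>?N - i0. scale (c (i0 + j)) ((F ^^ j) u))" for u
  have Gg: "G u = g ((F ^^ i0) u)" for u
  proof -
    have "G u = (\<Sum>i\<in>{i0..?N}. scale (c i) ((F ^^ i) u))"
      unfolding G_def by (rule sum.mono_neutral_right) (auto simp: small)
    also have "\<dots> = g ((F ^^ i0) u)"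
      unfolding g_def
      by (rule sum.reindex_bij_witness[of _ "\<lambda>j. i0 + j" "\<lambda>i. i - i0"])
        (use i0N in \<open>auto simp: funpow_add[symmetric, THEN fun_cong, unfolded o_def] add.commute\<close>)
    finally show ?thesis .
  qed
  have gW: "g w \<in> W" if "w \<in> W" for w
    unfolding g_def using FiW[OF that] sub(1) by (auto intro!: subspace_sum subspace_scale)
  have gV: "g v \<in> W" if v: "v \<in> V1" for v
  proof -
    obtain u w where u: "u \<in> V1" "w \<in> W" "v = (F ^^ i0) u + w" using surjn[OF v] by blast
    interpret g: Vector_Spaces.linear scale scale g
      using linsum[where m = "\<lambda>i. i" and a = "\<lambda>j. c (i0 + j)"] unfolding g_def[abs_def] .
    show ?thesis unfolding u(3) g.add
      using GV[OF u(1)] gW[OF u(2)] sub(1) by (auto simp: Gg intro: subspace_add)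
  qed
  have "0 = qtrace B0 B1 g" using qtrace_eq_0[OF ad1, of g] gV by auto
  also have "\<dots> = (\<Sum>j\<le>?N - i0. c (i0 + j) * qtrace B0 B1 (F ^^ j))"
    unfolding g_def[abs_def] using FiV by (intro qtrace_sum[OF ad1]) auto
  also have "\<dots> = (\<Sum>j\<in>{0}. c (i0 + j) * qtrace B0 B1 (F ^^ j))"
    by (rule sum.mono_neutral_right) (auto simp: tr1)
  also have "\<dots> = c i0 * of_nat (card (B1 - B0))"
    using qtrace_id[OF ad1] by (simp add: id_def)
  finally have "card (B1 - B0) = 0" using ci0 char by (metis gr0I mult_eq_0_iff)
  then have "B1 = B0" using B1 by auto
  then have "V1 = W" using B1 B0 by simp
  then show ?thesis using V1(4) unfolding F_def by blast
qed

text \<open>Take a smallest \<open>S\<close>-invariant subspace \<open>K\<close> of \<open>U\<close>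
  that properly contains \<open>W\<close>. Since the operators commute modulo \<open>W\<close>, the
  part of \<open>K\<close> that \<open>b\<close> maps into \<open>W\<close> is again invariant;
  nilpotency makes it larger than \<open>W\<close>, so by minimality it is all of
  \<open>K\<close>.\<close>

lemma commuting_nilpotents_kernel:
  assumes E: "U \<subseteq> span E" "finite E" and sub: "subspace W" "subspace U" "W \<subset> U"
    and pres: "\<And>b. b \<in> S \<Longrightarrow> preserves W U b"
    and comm: "\<And>b c u. b \<in> S \<Longrightarrow> c \<in> S \<Longrightarrow> u \<in> U \<Longrightarrow> b (c u) - c (b u) \<in> W"
    and nil: "\<And>b. b \<in> S \<Longrightarrow> \<exists>n. (b ^^ n) ` U \<subseteq> W"
  obtains u where "u \<in> U" "u \<notin> W" "\<And>b. b \<in> S \<Longrightarrow> b u \<in> W"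
proof -
  define P where "P K \<longleftrightarrow> subspace K \<and> W \<subset> K \<and> K \<subseteq> U \<and> (\<forall>b\<in>S. b ` K \<subseteq> K)" for K
  have "P U" using sub pres unfolding P_def preserves_def by blast
  then obtain K where K: "P K" "\<And>K'. P K' \<Longrightarrow> dim K \<le> dim K'"
    using ex_has_least_nat[of P U dim] by blast
  have Ksub: "subspace K" "W \<subset> K" "K \<subseteq> U" "\<And>b. b \<in> S \<Longrightarrow> b ` K \<subseteq> K" using K(1) unfolding P_def by auto
  have kill: "b u \<in> W" if b: "b \<in> S" and u: "u \<in> K" for b u
  proof -
    interpret b: Vector_Spaces.linear scale scale b using pres[OF b] unfolding preserves_def by blast
    define K' where "K' = K \<inter> {u. b u \<in> W}"
    have subK': "subspace K'"
      unfolding K'_def using b.subspace_vimage[OF sub(1)] Ksub(1)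
      by (simp add: vimage_def subspace_inter)
    have WK': "W \<subseteq> K'" unfolding K'_def using pres[OF b] Ksub unfolding preserves_def by blast
    obtain v where v: "v \<in> K" "v \<notin> W" using Ksub(2) by blast
    obtain n where n: "(b ^^ n) v \<in> W" using nil[OF b] v Ksub(3) by blast
    define m where "m = (LEAST m. (b ^^ m) v \<in> W)"
    have m: "(b ^^ m) v \<in> W" unfolding m_def using n by (rule LeastI)
    then obtain m' where m': "m = Suc m'" using v by (cases m) auto
    have nm: "(b ^^ m') v \<notin> W" using m' not_less_Least unfolding m_def by (metis lessI)
    have "(b ^^ i) v \<in> K" for i using v Ksub(4)[OF b] by (induction i) auto
    then have "(b ^^ m') v \<in> K'" unfolding K'_def using m m' by simp
    moreover have "c ` K' \<subseteq> K'" if c: "c \<in> S" for c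
    proof safe
      fix w assume w: "w \<in> K'"
      then have "c (b w) \<in> W" using pres[OF c] unfolding K'_def preserves_def by blast
      moreover have "b (c w) - c (b w) \<in> W" using comm[OF b c] w Ksub(3) unfolding K'_def by blast
      ultimately have "b (c w) \<in> W" using sub(1) by (metis diff_add_cancel subspace_add)
      then show "c w \<in> K'" using w Ksub(4)[OF c] unfolding K'_def by blast
    qed
    ultimately have "P K'" unfolding P_def using subK' WK' nm Ksub unfolding K'_def by blast
    then have "\<not> dim K' < dim K" using K(2) by fastforce
    then have "K' = K"
      using subspace_dim_less[OF subK' Ksub(1) _ order.trans[OF Ksub(3) E(1)] E(2)] unfolding K'_def by blast
    then show ?thesis using u unfolding K'_def by blast
  qed
  obtain v where "v \<in> K" "v \<notin> W" using Ksub(2) by blast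
  then show ?thesis using that kill Ksub(3) by blast
qed

end

section \<open>The soluble radical of a perfect Lie algebra\<close>

text \<open>Skew symmetry and the Jacobi identity are assumed on the whole type. The bracket
  \<open>fract_bracket d\<close> satisfies them there, because it ignores the coordinates from
  \<open>d\<close> on.\<close>

locale perfect_lie_algebra = subquotient_trace scale
  for scale :: "'a::field \<Rightarrow> 'b::ab_group_add \<Rightarrow> 'b" +
  fixes br :: "'b \<Rightarrow> 'b \<Rightarrow> 'b" and L :: "'b set"
  assumes linear_br: "Vector_Spaces.linear scale scale (br x)"
    and skew_br: "br x y = - br y x"
    and jacobi_br: "br x (br y z) = br (br x y) z + br y (br x z)"
    and subspace_L: "subspace L"
    and fin_dim_L: "\<exists>E. finite E \<and> L \<subseteq> span E"
    and br_L: "x \<in> L \<Longrightarrow> y \<in> L \<Longrightarrow> br x y \<in> L"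
    and perfect: "L \<subseteq> span {br x y |x y. x \<in> L \<and> y \<in> L}"
    and char_0: "n > 0 \<Longrightarrow> of_nat n \<noteq> (0 :: 'a)"
begin

lemma br_add: "br x (y + z) = br x y + br x z"
  and br_scale: "br x (scale c y) = scale c (br x y)"
  using linear_br[of x] unfolding Vector_Spaces.linear_iff by blast+

lemma br_add_left: "br (x + y) z = br x z + br y z"
  by (subst (1 2 3) skew_br) (simp add: br_add)

lemma br_scale_left: "br (scale c x) y = scale c (br x y)"
  by (subst (1 2) skew_br) (simp add: br_scale)

lemma br_zero_left: "br 0 x = 0"
  using br_add_left[of 0 0 x] by simp

definition stable :: "'b set \<Rightarrow> bool" where
  "stable U \<longleftrightarrow> subspace U \<and> U \<subseteq> L \<and> (\<forall>x\<in>L. br x ` U \<subseteq> U)"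

definition kills :: "'b set \<Rightarrow> 'b set \<Rightarrow> 'b \<Rightarrow> bool" where
  "kills U W x \<longleftrightarrow> br x ` U \<subseteq> W"

lemma preserves_br: "stable U \<Longrightarrow> stable W \<Longrightarrow> x \<in> L \<Longrightarrow> preserves W U (br x)"
  unfolding preserves_def stable_def using linear_br by blast

lemma br_bracket: "br (br x y) z = br x (br y z) - br y (br x z)"
  using jacobi_br[of x y z] by simp

lemma subspace_kills: "subspace W \<Longrightarrow> subspace {x. kills U W x}"
  unfolding kills_def subspace_def
  by (auto simp: br_add_left br_scale_left br_zero_left image_subset_iff)

lemma lie_ideal_stable: "lie_ideal scale br L I \<longleftrightarrow> stable I"
  unfolding lie_ideal_def stable_def by auto

lemma stable_commutator:
  assumes "stable I"
  shows "stable (lie_commutator scale br I I)"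
proof -
  let ?G = "{br x y |x y. x \<in> I \<and> y \<in> I}"
  have I: "subspace I" "I \<subseteq> L" "\<And>x y. x \<in> L \<Longrightarrow> y \<in> I \<Longrightarrow> br x y \<in> I"
    using assms unfolding stable_def by blast+
  have "span ?G \<subseteq> {y. br x y \<in> span ?G}" if x: "x \<in> L" for x
  proof (rule span_minimal)
    show "subspace {y. br x y \<in> span ?G}"
      unfolding subspace_def
      using br_add[of x] br_scale[of x] br_scale[of x 0]
      by (auto intro: span_add span_scale span_zero)
    show "?G \<subseteq> {y. br x y \<in> span ?G}"
    proof safe
      fix y z assume yz: "y \<in> I" "z \<in> I"
      show "br x (br y z) \<in> span ?G"
        unfolding jacobi_br[of x y z]
        using yz I(3)[OF x] by (intro span_add span_base) blast+
    qed
  qed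
  moreover have "span ?G \<subseteq> L"
    using I by (intro span_minimal subspace_L) blast
  ultimately show ?thesis unfolding stable_def lie_commutator_def by auto
qed

lemma stable_derived_series: "stable I \<Longrightarrow> stable (lie_derived_series scale br I n)"
  by (induction n) (auto intro: stable_commutator)

section \<open>Ideals acting on an irreducible subquotient of the adjoint module\<close>

context
  fixes U W :: "'b set"
  assumes U: "stable U" and W: "stable W" and WU: "W \<subset> U"
    and irr: "\<And>K. stable K \<Longrightarrow> W \<subseteq> K \<Longrightarrow> K \<subset> U \<Longrightarrow> K = W"
begin

lemma subspaces_UW: "subspace U" "subspace W" "U \<subseteq> L"
  using U W unfolding stable_def by auto

text \<open>This is a submodule because [s, [x, u]] = [[s, x], u] + [x, [s, u]] and \<open>S\<close>
  is closed under brackets with \<open>L\<close>.\<close>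

lemma common_kernel_stable:
  assumes "S \<subseteq> L" "\<And>x s. x \<in> L \<Longrightarrow> s \<in> S \<Longrightarrow> br x s \<in> S"
  shows "stable {u \<in> U. \<forall>s\<in>S. br s u \<in> W}"
proof -
  let ?K = "{u \<in> U. \<forall>s\<in>S. br s u \<in> W}"
  have "subspace ?K"
    using subspaces_UW br_scale[of _ 0] unfolding subspace_def by (auto simp: br_add br_scale)
  moreover have "br x u \<in> ?K" if x: "x \<in> L" and u: "u \<in> ?K" for x u
  proof -
    have "br s (br x u) \<in> W" if s: "s \<in> S" for s
    proof -
      have "br s (br x u) = br (br s x) u + br x (br s u)" by (rule jacobi_br)
      moreover have "br (br s x) u = - br (br x s) u"
        using skew_br[of s x] br_scale_left[of "-1" "br x s" u] by (simp)
      moreover have "br (br x s) u \<in> W" using u assms(2)[OF x s] by blast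
      moreover have "br x (br s u) \<in> W" using u s x W unfolding stable_def by blast
      ultimately show ?thesis
        using subspaces_UW(2) by (simp add: subspace_diff)
    qed
    moreover have "br x u \<in> U" using x u U unfolding stable_def by blast
    ultimately show ?thesis by blast
  qed
  ultimately show ?thesis using subspaces_UW unfolding stable_def by auto
qed

text \<open>Vanishing traces of powers make each element of \<open>S\<close> nilpotent on U / W, and
  these operators commute there, so some \<open>u\<close> outside \<open>W\<close> is killed by all
  of \<open>S\<close>. The vectors killed by \<open>S\<close> form a submodule, which irreducibility
  forces to be \<open>U\<close>.\<close>

lemma nilpotent_ideal_kills:
  assumes "S \<subseteq> L" "\<And>x s. x \<in> L \<Longrightarrow> s \<in> S \<Longrightarrow> br x s \<in> S"
    and comm: "\<And>s t. s \<in> S \<Longrightarrow> t \<in> S \<Longrightarrow> kills U W (br s t)"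
    and tr: "\<And>s k B0 B. s \<in> S \<Longrightarrow> k \<ge> 1 \<Longrightarrow> adapted W U B0 B \<Longrightarrow> qtrace B0 B (br s ^^ k) = 0"
    and s: "s \<in> S"
  shows "kills U W s"
proof -
  let ?K = "{u \<in> U. \<forall>s\<in>S. br s u \<in> W}"
  obtain E where E: "finite E" "U \<subseteq> span E" using fin_dim_L subspaces_UW by blast
  have pres: "preserves W U (br s)" if "s \<in> S" for s
    using preserves_br[OF U W] assms(1) that by blast
  obtain u where u: "u \<in> U" "u \<notin> W" "\<And>b. b \<in> br ` S \<Longrightarrow> b u \<in> W"
  proof (rule commuting_nilpotents_kernel[OF E(2,1) subspaces_UW(2,1) WU, of "br ` S"])
    fix b c u assume bcu: "b \<in> br ` S" "c \<in> br ` S" "u \<in> U"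
    then obtain s t where "b = br s" "c = br t" "s \<in> S" "t \<in> S" by blast
    then have "br (br s t) u \<in> W" using comm bcu(3) unfolding kills_def by blast
    then show "b (c u) - c (b u) \<in> W" using \<open>b = br s\<close> \<open>c = br t\<close> by (simp add: br_bracket)
  next
    fix b assume "b \<in> br ` S"
    then obtain s where s: "b = br s" "s \<in> S" by blast
    then show "\<exists>n. (b ^^ n) ` U \<subseteq> W"
      using traceless_powers_nilpotent[OF char_0 E(2,1) subspaces_UW(2,1) _ pres] tr WU by blast
  qed (use pres in auto)
  have "stable ?K" by (rule common_kernel_stable[OF assms(1,2)])
  moreover have "W \<subseteq> ?K" using assms(1) W WU unfolding stable_def by blast
  moreover have "?K \<noteq> W" using u by blast
  ultimately have "?K = U" using irr[of ?K] by blast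
  then show ?thesis using s unfolding kills_def by blast
qed

text \<open>For fixed \<open>s\<close> the trace is linear in \<open>y\<close>, so a spanning set
  suffices.\<close>

lemma qtrace_br_linear:
  assumes ad: "adapted W U B0 B" and s: "preserves W U s"
    and S: "S \<subseteq> L" "\<And>y. y \<in> S \<Longrightarrow> qtrace B0 B (br y \<circ> s) = 0" and y: "y \<in> span S"
  shows "qtrace B0 B (br y \<circ> s) = 0"
proof -
  have im: "(br y \<circ> s) ` U \<subseteq> U" if "y \<in> L" for y
    using preserves_comp[OF preserves_br[OF U W that] s] unfolding preserves_def by blast
  have "span S \<subseteq> {y \<in> L. qtrace B0 B (br y \<circ> s) = 0}"
  proof (rule span_minimal)
    show "subspace {y \<in> L. qtrace B0 B (br y \<circ> s) = 0}"
      unfolding subspace_def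
    proof (intro conjI ballI allI)
      show "0 \<in> {y \<in> L. qtrace B0 B (br y \<circ> s) = 0}"
        using qtrace_zero[OF ad] subspace_L by (simp add: o_def br_zero_left subspace_0)
    next
      fix x y assume "x \<in> {y \<in> L. qtrace B0 B (br y \<circ> s) = 0}" "y \<in> {y \<in> L. qtrace B0 B (br y \<circ> s) = 0}"
      then show "x + y \<in> {y \<in> L. qtrace B0 B (br y \<circ> s) = 0}"
        using qtrace_add[OF ad im im, of x y] subspace_L
        by (simp add: o_def br_add_left subspace_add)
    next
      fix c x assume "x \<in> {y \<in> L. qtrace B0 B (br y \<circ> s) = 0}"
      then show "scale c x \<in> {y \<in> L. qtrace B0 B (br y \<circ> s) = 0}"
        using qtrace_scale[OF ad im, of x c] subspace_L
        by (simp add: o_def br_scale_left subspace_scale)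
    qed
  qed (use S in auto)
  then show ?thesis using y by blast
qed

text \<open>Invariance of the trace form: tr([x, y] s) = tr(x y s) - tr(x s y) = tr(x [y, s]), and
  [y, s] maps \<open>U\<close> into \<open>W\<close>.\<close>

lemma qtrace_commutator:
  assumes ad: "adapted W U B0 B" and x: "x \<in> L" and y: "y \<in> L" and s: "preserves W U s"
    and comm: "\<And>u. u \<in> U \<Longrightarrow> br y (s u) - s (br y u) \<in> W"
  shows "qtrace B0 B (br (br x y) \<circ> s) = 0"
proof -
  note px = preserves_br[OF U W x] and py = preserves_br[OF U W y]
  note pc = preserves_comp
  have im: "f ` U \<subseteq> U" if "preserves W U f" for f using that unfolding preserves_def by blast
  have "(br (br x y) \<circ> s) = (\<lambda>u. (br x \<circ> (br y \<circ> s)) u + scale (-1) ((br y \<circ> (br x \<circ> s)) u))"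
    by (auto simp: br_bracket)
  then have "qtrace B0 B (br (br x y) \<circ> s)
      = qtrace B0 B (br x \<circ> (br y \<circ> s)) + qtrace B0 B (\<lambda>u. scale (-1) ((br y \<circ> (br x \<circ> s)) u))"
    using qtrace_add[OF ad im[OF pc[OF px pc[OF py s]]], of "\<lambda>u. scale (-1) ((br y \<circ> (br x \<circ> s)) u)"]
      im[OF pc[OF py pc[OF px s]]] subspaces_UW(1) by (auto simp: image_subset_iff subspace_neg)
  also have "\<dots> = qtrace B0 B (br x \<circ> (br y \<circ> s)) - qtrace B0 B (br y \<circ> (br x \<circ> s))"
    using qtrace_scale[OF ad im[OF pc[OF py pc[OF px s]]], of "-1"] by simp
  also have "qtrace B0 B (br y \<circ> (br x \<circ> s)) = qtrace B0 B ((br x \<circ> s) \<circ> br y)"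
    by (rule qtrace_commute[OF ad py pc[OF px s]])
  also have "qtrace B0 B (br x \<circ> (br y \<circ> s)) = qtrace B0 B ((br x \<circ> s) \<circ> br y)"
  proof (rule qtrace_cong[OF ad im[OF pc[OF px pc[OF py s]]] im[OF pc[OF pc[OF px s] py]]])
    fix u assume u: "u \<in> U"
    interpret bx: Vector_Spaces.linear scale scale "br x" by (rule linear_br)
    have "(br x \<circ> (br y \<circ> s)) u - (br x \<circ> s \<circ> br y) u = br x (br y (s u) - s (br y u))"
      by (simp add: bx.diff)
    then show "(br x \<circ> (br y \<circ> s)) u - (br x \<circ> s \<circ> br y) u \<in> W"
      using comm[OF u] x W unfolding stable_def by auto
  qed
  finally show ?thesis by (simp only: diff_self)
qed

lemma commute_funpow:
  assumes "y \<in> L" "b \<in> L" "kills U W (br y b)" "u \<in> U"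
  shows "br y ((br b ^^ n) u) - (br b ^^ n) (br y u) \<in> W"
proof (induction n)
  case 0
  then show ?case using subspaces_UW by (simp add: subspace_0)
next
  case (Suc n)
  let ?v = "(br b ^^ n) u"
  interpret b: Vector_Spaces.linear scale scale "br b" by (rule linear_br)
  have "?v \<in> U" using preserves_funpow[OF preserves_br[OF U W assms(2)]] assms(4) unfolding preserves_def by blast
  then have "br (br y b) ?v \<in> W" using assms(3) unfolding kills_def by blast
  moreover have "br b (br y ?v - (br b ^^ n) (br y u)) \<in> W"
    using Suc W assms(2) unfolding stable_def by blast
  ultimately have "br (br y b) ?v + br b (br y ?v - (br b ^^ n) (br y u)) \<in> W"
    using subspaces_UW(2) by (rule subspace_add[rotated])
  then show ?case by (simp add: br_bracket b.diff)
qed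

text \<open>
  The ideal \<open>B = [L, A]\<close> is orthogonal to the powers of its elements under the trace form, because
  \<open>A\<close> acts on \<open>U / W\<close> through commuting operators; so \<open>B\<close> acts trivially. Then \<open>A\<close> commutes with
  \<open>L\<close> on \<open>U / W\<close>, and since \<open>A \<subseteq> L = [L, L]\<close> the same argument applies to \<open>A\<close> itself.
\<close>

lemma abelian_ideal_kills:
  assumes A: "stable A" and comm: "\<And>a b. a \<in> A \<Longrightarrow> b \<in> A \<Longrightarrow> kills U W (br a b)" and a: "a \<in> A"
  shows "kills U W a"
proof -
  have AL: "A \<subseteq> L" "subspace A" and bA: "\<And>x a. x \<in> L \<Longrightarrow> a \<in> A \<Longrightarrow> br x a \<in> A"
    using A unfolding stable_def by blast+
  define G where "G = {br x a |x a. x \<in> L \<and> a \<in> A}"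
  have GA: "span G \<subseteq> A" unfolding G_def using bA by (intro span_minimal AL) blast
  \<comment> \<open>Splitting off one factor turns the trace of the k-th power into a trace form
    that is linear in this factor, so \<open>qtrace_br_linear\<close> can write the factor alone as
    a sum of commutators.\<close>
  have pw: "br b ^^ k = br b \<circ> (br b ^^ (k - 1))" if "k \<ge> 1" for k b
    using that by (cases k) auto
  have pp: "preserves W U (br b ^^ k)" if "b \<in> L" for b k
    using preserves_funpow[OF preserves_br[OF U W that]] .
  have killB: "kills U W b" if b: "b \<in> span G" for b
  proof (rule nilpotent_ideal_kills[OF _ _ _ _ b])
    show "span G \<subseteq> L" using GA AL by blast
    show "br x s \<in> span G" if "x \<in> L" "s \<in> span G" for x s
      using that GA unfolding G_def by (intro span_base) blast
    show "kills U W (br s t)" if "s \<in> span G" "t \<in> span G" for s t using comm that GA by blast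
  next
    fix s k B0 B assume s: "s \<in> span G" and k: "(1::nat) \<le> k" and ad: "adapted W U B0 B"
    have sA: "s \<in> A" using GA s by blast
    show "qtrace B0 B (br s ^^ k) = 0"
      unfolding pw[OF k]
    proof (rule qtrace_br_linear[OF ad pp _ _ s])
      show "G \<subseteq> L" using GA AL span_superset by blast
      fix y assume "y \<in> G"
      then obtain x c where y: "y = br x c" "x \<in> L" "c \<in> A" unfolding G_def by blast
      show "qtrace B0 B (br y \<circ> br s ^^ (k - 1)) = 0"
        unfolding y(1)
        using commute_funpow[of c s] comm[OF y(3) sA] y sA AL
        by (intro qtrace_commutator[OF ad y(2) _ pp]) auto
    qed (use sA AL in auto)
  qed
  show ?thesis
  proof (rule nilpotent_ideal_kills[OF AL(1) bA comm _ a])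
    fix s k B0 B assume sA: "s \<in> A" and k: "(1::nat) \<le> k" and ad: "adapted W U B0 B"
    have s: "s \<in> span {br x y |x y. x \<in> L \<and> y \<in> L}" using sA AL perfect by blast
    show "qtrace B0 B (br s ^^ k) = 0"
      unfolding pw[OF k]
    proof (rule qtrace_br_linear[OF ad pp _ _ s])
      show "{br x y |x y. x \<in> L \<and> y \<in> L} \<subseteq> L" using br_L by blast
      fix y assume "y \<in> {br x y |x y. x \<in> L \<and> y \<in> L}"
      then obtain x z where y: "y = br x z" "x \<in> L" "z \<in> L" by blast
      have "br z s \<in> span G" using y(3) sA unfolding G_def by (intro span_base) blast
      then show "qtrace B0 B (br y \<circ> br s ^^ (k - 1)) = 0"
        unfolding y(1)
        using commute_funpow[of z s] killB y sA AL
        by (intro qtrace_commutator[OF ad y(2) _ pp]) auto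
    qed (use sA AL in auto)
  qed auto
qed

text \<open>\<open>abelian_ideal_kills\<close> asks only that commutators act as zero, so the
  derived series can be climbed from its last term: once one term acts as zero, the preceding one
  acts like an abelian ideal.\<close>

lemma soluble_ideal_kills:
  assumes "stable I" "lie_soluble scale br I" "x \<in> I"
  shows "kills U W x"
proof -
  obtain n where n: "lie_derived_series scale br I n = {0}" using assms(2) unfolding lie_soluble_def by blast
  have "\<forall>x\<in>lie_derived_series scale br I k. kills U W x" if "k \<le> n" for k
    using that
  proof (induction k rule: inc_induct)
    case base
    then show ?case
      using n subspace_kills[OF subspaces_UW(2), of U] by (auto simp: subspace_0[where S = "{x. kills U W x}", simplified])
  next
    case (step k)
    have "br a b \<in> lie_derived_series scale br I (Suc k)"
      if "a \<in> lie_derived_series scale br I k" "b \<in> lie_derived_series scale br I k" for a b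
      using that unfolding lie_derived_series.simps lie_commutator_def by (intro span_base) blast
    then show ?case
      using step.IH abelian_ideal_kills[OF stable_derived_series[OF assms(1)]] by blast
  qed
  from this[of 0] show ?thesis using assms(3) by simp
qed

text \<open>Acting as zero is a linear condition, so it passes from the soluble ideals to the span
  of their union.\<close>

lemma soluble_radical_kills:
  assumes "x \<in> soluble_radical scale br L"
  shows "kills U W x"
proof -
  have "span (\<Union>{I. lie_ideal scale br L I \<and> lie_soluble scale br I}) \<subseteq> {x. kills U W x}"
    using soluble_ideal_kills
    by (intro span_minimal subspace_kills subspaces_UW(2)) (auto simp: lie_ideal_stable)
  then show ?thesis using assms unfolding soluble_radical_def by blast
qed

end

text \<open>A composition series of \<open>U\<close>, built from the top: a proper submodule
  \<open>W\<close> of largest dimension makes U / W irreducible, and induction on the dimension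
  continues with \<open>W\<close>.\<close>

lemma stable_chain:
  assumes "stable U"
  shows "\<exists>n c. c 0 = U \<and> c n = {0} \<and> (\<forall>k. subspace (c k)) \<and>
    (\<forall>k<n. \<forall>x\<in>soluble_radical scale br L. kills (c k) (c (Suc k)) x)"
  using assms
proof (induction "dim U" arbitrary: U rule: less_induct)
  case less
  show ?case
  proof (cases "U = {0}")
    case True
    then show ?thesis by (intro exI[of _ 0] exI[of _ "\<lambda>_. {0}"]) auto
  next
    case False
    obtain E where E: "finite E" "L \<subseteq> span E" using fin_dim_L by blast
    have sU: "subspace U" "U \<subseteq> L" using less.prems unfolding stable_def by auto
    have dimlt: "dim S < dim T" if "stable S" "stable T" "S \<subset> T" for S T
      using that subspace_dim_less[of S T E] E unfolding stable_def by blast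
    let ?P = "\<lambda>W. stable W \<and> W \<subset> U"
    have "?P {0}"
      using False sU subspace_L br_scale[of _ 0] unfolding stable_def
      by (auto simp: subspace_0 subspace_single_0)
    moreover have "\<forall>W. ?P W \<longrightarrow> dim W < Suc (dim U)" using dimlt[OF _ less.prems] by (simp add: less_SucI)
    ultimately obtain W where W: "?P W" "\<And>W'. ?P W' \<Longrightarrow> dim W' \<le> dim W"
      using ex_has_greatest_nat[of ?P "{0}" dim "Suc (dim U)"] by (metis (no_types, lifting) less_imp_le)
    have irr: "K = W" if "stable K" "W \<subseteq> K" "K \<subset> U" for K
    proof -
      have "dim K \<le> dim W" using W(2) that by blast
      then have "\<not> W \<subset> K" using dimlt[of W K] W(1) that by linarith
      then show ?thesis using that by blast
    qed
    have sW: "stable W" and dW: "dim W < dim U" using W(1) dimlt[OF _ less.prems, of W] by auto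
    obtain n c where c: "c 0 = W" "c n = {0}" "\<forall>k. subspace (c k)"
      "\<forall>k<n. \<forall>x\<in>soluble_radical scale br L. kills (c k) (c (Suc k)) x"
      using less.hyps[OF dW sW] by (elim exE conjE)
    have "\<forall>x\<in>soluble_radical scale br L. kills U W x"
      using soluble_radical_kills[OF less.prems _ _ irr] W(1) by blast
    then have "\<forall>k<Suc n. \<forall>x\<in>soluble_radical scale br L. kills (case_nat U c k) (case_nat U c (Suc k)) x"
      using c(1,4) by (auto split: nat.splits)
    then show ?thesis
      using c(2,3) sU by (intro exI[of _ "Suc n"] exI[of _ "case_nat U c"]) (auto split: nat.splits)
  qed
qed

theorem soluble_radical_nilpotent: "lie_nilpotent scale br (soluble_radical scale br L)"
proof -
  let ?R = "soluble_radical scale br L"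
  have "stable L" using subspace_L br_L unfolding stable_def by auto
  then obtain n c where c: "c 0 = L" "c n = {0}" "\<And>k. subspace (c k)"
    "\<And>k x. k < n \<Longrightarrow> x \<in> ?R \<Longrightarrow> kills (c k) (c (Suc k)) x"
  proof -
    obtain n c where "c 0 = L" "c n = {0}" "\<forall>k. subspace (c k)"
      "\<forall>k<n. \<forall>x\<in>?R. kills (c k) (c (Suc k)) x"
      using stable_chain[OF \<open>stable L\<close>] by (elim exE conjE)
    then show ?thesis by (intro that[of c n]) simp_all
  qed
  have RL: "?R \<subseteq> L"
    unfolding soluble_radical_def by (intro span_minimal subspace_L) (auto simp: lie_ideal_def)
  \<comment> \<open>A bracket with an element of the radical moves one step down the chain.\<close>
  have "lie_lower_central_series scale br ?R k \<subseteq> c k" if "k \<le> n" for k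
    using that
  proof (induction k)
    case 0
    then show ?case using c(1) RL by simp
  next
    case (Suc k)
    have "br x y \<in> c (Suc k)" if "x \<in> lie_lower_central_series scale br ?R k" "y \<in> ?R" for x y
    proof -
      have "br y x \<in> c (Suc k)" using c(4)[of k y] Suc that unfolding kills_def by auto
      then show ?thesis using skew_br[of x y] c(3) by (simp add: subspace_neg)
    qed
    then show ?case
      unfolding lie_lower_central_series.simps lie_commutator_def
      by (intro span_minimal c(3)) blast
  qed
  then have "lie_lower_central_series scale br ?R n \<subseteq> {0}" using c(2) by blast
  moreover have "subspace (lie_lower_central_series scale br ?R n)"
    by (cases n) (auto simp: soluble_radical_def lie_commutator_def)
  ultimately have "lie_lower_central_series scale br ?R n = {0}" using subspace_0 by blast
  then show ?thesis unfolding lie_nilpotent_def by blast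
qed

end

section \<open>Ideals of a ring given as a type\<close>

abbreviation (input) tring :: "'a::comm_ring_1 ring" where
  "tring \<equiv> ring_of_type_algebra"

lemma ideal_tring_iff:
  "ideal I (tring :: 'a::comm_ring_1 ring) \<longleftrightarrow>
     0 \<in> I \<and> (\<forall>x\<in>I. \<forall>y\<in>I. x + y \<in> I) \<and> (\<forall>a. \<forall>x\<in>I. a * x \<in> I)"
  (is "?L \<longleftrightarrow> ?R")
proof -
  interpret ring "tring :: 'a ring" by (rule ring_from_type_algebra)
  have simps: "carrier (tring :: 'a ring) = UNIV" "x \<otimes>\<^bsub>tring\<^esub> y = x * y" "x \<oplus>\<^bsub>tring\<^esub> y = x + y"
    "\<zero>\<^bsub>tring\<^esub> = (0 :: 'a)" for x y :: 'a
    by (auto simp: ring_of_type_algebra_def)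
  have minus: "\<ominus>\<^bsub>tring\<^esub> x = - x" for x :: 'a
    by (rule minus_equality) (simp_all add: simps)
  show ?thesis
  proof
    assume ?L
    then interpret ideal I "tring :: 'a ring" .
    show ?R
      using zero_closed a_closed I_l_closed by (auto simp: simps)
  next
    assume R: ?R
    show ?L
    proof (rule idealI[OF ring_axioms])
      have "- x \<in> I" if "x \<in> I" for x
        using R that by (metis mult_minus1)
      then show "subgroup I (add_monoid tring)"
        using R by (intro add.subgroupI) (auto simp: simps minus)
      show "x \<otimes>\<^bsub>tring\<^esub> a \<in> I" "a \<otimes>\<^bsub>tring\<^esub> x \<in> I" if "a \<in> I" for a x
        using R that by (auto simp: simps) (metis mult.commute)
    qed
  qed
qed

lemma ideal_tring_closed:
  assumes "ideal I (tring :: 'a::comm_ring_1 ring)"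
  shows "0 \<in> I" "x \<in> I \<Longrightarrow> y \<in> I \<Longrightarrow> x + y \<in> I" "x \<in> I \<Longrightarrow> a * x \<in> I" "x \<in> I \<Longrightarrow> x * a \<in> I"
    "x \<in> I \<Longrightarrow> - x \<in> I" "x \<in> I \<Longrightarrow> y \<in> I \<Longrightarrow> x - y \<in> I"
proof -
  have I: "0 \<in> I" "\<And>x y. x \<in> I \<Longrightarrow> y \<in> I \<Longrightarrow> x + y \<in> I" "\<And>a x. x \<in> I \<Longrightarrow> a * x \<in> I"
    using assms unfolding ideal_tring_iff by blast+
  have neg: "\<And>x. x \<in> I \<Longrightarrow> - x \<in> I" using I(3) by (metis mult_minus1)
  show "0 \<in> I" "x \<in> I \<Longrightarrow> y \<in> I \<Longrightarrow> x + y \<in> I" "x \<in> I \<Longrightarrow> a * x \<in> I" "x \<in> I \<Longrightarrow> - x \<in> I"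
    using I neg by auto
  show "x \<in> I \<Longrightarrow> x * a \<in> I" using I(3)[of x a] by (simp add: mult.commute)
  show "x \<in> I \<Longrightarrow> y \<in> I \<Longrightarrow> x - y \<in> I" using I(2) neg by (metis uminus_add_conv_diff add.commute)
qed

lemma ideal_tring_sum:
  assumes "ideal I (tring :: 'a::comm_ring_1 ring)" "\<And>i. i \<in> A \<Longrightarrow> f i \<in> I"
  shows "sum f A \<in> I"
  using assms(2) by (induction A rule: infinite_finite_induct) (auto intro: ideal_tring_closed[OF assms(1)])

lemma ideal_prod_tring:
  fixes I J :: "'a::comm_ring_1 set"
  shows "i \<in> I \<Longrightarrow> j \<in> J \<Longrightarrow> i * j \<in> ideal_prod tring I J"
    and "x \<in> ideal_prod tring I J \<Longrightarrow> y \<in> ideal_prod tring I J \<Longrightarrow> x + y \<in> ideal_prod tring I J"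
  using ideal_prod.prod[of i I j J tring] ideal_prod.sum[of x tring I J y]
  by (auto simp: ring_of_type_algebra_def)

lemma ideal_prod_tring_induct [consumes 1, case_names prod sum]:
  fixes I J :: "'a::comm_ring_1 set"
  assumes "x \<in> ideal_prod tring I J"
    and "\<And>i j. i \<in> I \<Longrightarrow> j \<in> J \<Longrightarrow> P (i * j)" and "\<And>x y. P x \<Longrightarrow> P y \<Longrightarrow> P (x + y)"
  shows "P x"
  using assms(1)
  by (induction rule: ideal_prod.induct) (use assms(2,3) in \<open>auto simp: ring_of_type_algebra_def\<close>)

lemma ideal_prod_tring_ideal:
  "ideal I (tring :: 'a::comm_ring_1 ring) \<Longrightarrow> ideal J (tring :: 'a ring) \<Longrightarrow>
    ideal (ideal_prod tring I J) (tring :: 'a ring)"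
  using ring.ideal_prod_is_ideal[OF ring_from_type_algebra] .

lemma ideal_power_mult:
  fixes M :: "'a::comm_ring_1 set"
  assumes M: "ideal M (tring :: 'a ring)" and "x \<in> ideal_power M m" "y \<in> ideal_power M n"
  shows "x * y \<in> ideal_power M (m + n)"
  using assms(3)
proof (induction n arbitrary: y)
  case 0
  then show ?case using ideal_tring_closed[OF ideal_ideal_power[OF M, of m]] assms(2) by simp
next
  case (Suc n)
  note cl = ideal_tring_closed[OF ideal_ideal_power[OF M]]
  have "y \<in> ideal_prod tring (ideal_power M n) M" using Suc.prems by (simp add: ideal_power_Suc)
  then show ?case
  proof (induction rule: ideal_prod_tring_induct)
    case (prod i j)
    then have "x * i * j \<in> ideal_prod tring (ideal_power M (m + n)) M"
      using Suc.IH by (intro ideal_prod_tring)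
    then show ?case by (simp add: ideal_power_Suc mult.assoc)
  next
    case (sum y z)
    then show ?case using cl by (simp add: distrib_left)
  qed
qed

lemma ideal_power_1: "ideal M (tring :: 'a::comm_ring_1 ring) \<Longrightarrow> ideal_power M (Suc 0) = M"
proof
  assume M: "ideal M (tring :: 'a ring)"
  show "ideal_power M (Suc 0) \<subseteq> M"
  proof
    fix x assume "x \<in> ideal_power M (Suc 0)"
    then have "x \<in> ideal_prod tring UNIV M" by (simp add: ideal_power_Suc ideal_power_0)
    then show "x \<in> M"
      by (induction rule: ideal_prod_tring_induct) (auto intro: ideal_tring_closed[OF M])
  qed
  show "M \<subseteq> ideal_power M (Suc 0)"
    using ideal_prod_tring(1)[of 1 UNIV _ M] by (auto simp: ideal_power_Suc ideal_power_0)
qed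

lemma ideal_power_power:
  assumes "ideal M (tring :: 'a::comm_ring_1 ring)" "x \<in> ideal_power M k"
  shows "x ^ n \<in> ideal_power M (k * n)"
  using ideal_power_mult[OF assms(1)] assms(2)
  by (induction n) (auto simp: ideal_power_0 algebra_simps)

section \<open>The Artin-Rees lemma\<close>

definition subring_of :: "'b::comm_ring_1 set \<Rightarrow> bool" where
  "subring_of A \<longleftrightarrow> 1 \<in> A \<and> (\<forall>x\<in>A. \<forall>y\<in>A. x - y \<in> A \<and> x * y \<in> A)"

definition ideal_of :: "'b::comm_ring_1 set \<Rightarrow> 'b set \<Rightarrow> bool" where
  "ideal_of A I \<longleftrightarrow> I \<subseteq> A \<and> 0 \<in> I \<and> (\<forall>x\<in>I. \<forall>y\<in>I. x + y \<in> I) \<and> (\<forall>a\<in>A. \<forall>x\<in>I. a * x \<in> I)"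

definition noetherian_subring :: "'b::comm_ring_1 set \<Rightarrow> bool" where
  "noetherian_subring A \<longleftrightarrow> (\<forall>I :: nat \<Rightarrow> 'b set. (\<forall>n. ideal_of A (I n)) \<longrightarrow> (\<forall>n. I n \<subseteq> I (Suc n)) \<longrightarrow>
     (\<exists>N. \<forall>n\<ge>N. I n = I N))"

text \<open>The ring A[t], where \<open>t\<close> may satisfy algebraic relations over
  \<open>A\<close>; an element does not determine the polynomial of which it is a value.\<close>

definition adjoin :: "'b::comm_ring_1 \<Rightarrow> 'b set \<Rightarrow> 'b set" where
  "adjoin t A = {poly q t |q. \<forall>i. Polynomial.coeff q i \<in> A}"

lemma subring_ofD:
  assumes "subring_of A"
  shows "1 \<in> A" "0 \<in> A" "x \<in> A \<Longrightarrow> y \<in> A \<Longrightarrow> x - y \<in> A" "x \<in> A \<Longrightarrow> y \<in> A \<Longrightarrow> x * y \<in> A"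
    "x \<in> A \<Longrightarrow> - x \<in> A" "x \<in> A \<Longrightarrow> y \<in> A \<Longrightarrow> x + y \<in> A"
proof -
  show A: "1 \<in> A" "x \<in> A \<Longrightarrow> y \<in> A \<Longrightarrow> x - y \<in> A" "x \<in> A \<Longrightarrow> y \<in> A \<Longrightarrow> x * y \<in> A" for x y
    using assms unfolding subring_of_def by blast+
  show z: "0 \<in> A" using A(1) A(2)[of 1 1] by simp
  show n: "x \<in> A \<Longrightarrow> - x \<in> A" for x using A(2)[OF z, of x] by simp
  show "x \<in> A \<Longrightarrow> y \<in> A \<Longrightarrow> x + y \<in> A" using A(2)[of x "- y"] n by simp
qed

lemma subring_of_sum:
  assumes "subring_of A" "\<And>i. i \<in> S \<Longrightarrow> f i \<in> A"
  shows "sum f S \<in> A"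
  using assms(2) by (induction S rule: infinite_finite_induct) (auto intro: subring_ofD[OF assms(1)])

lemma subring_of_power: "subring_of A \<Longrightarrow> x \<in> A \<Longrightarrow> x ^ n \<in> A"
  by (induction n) (auto intro: subring_ofD)

lemma ideal_ofD:
  assumes "ideal_of A I" "subring_of A"
  shows "I \<subseteq> A" "0 \<in> I" "x \<in> I \<Longrightarrow> y \<in> I \<Longrightarrow> x + y \<in> I" "a \<in> A \<Longrightarrow> x \<in> I \<Longrightarrow> a * x \<in> I"
    "x \<in> I \<Longrightarrow> y \<in> I \<Longrightarrow> x - y \<in> I"
proof -
  show I: "I \<subseteq> A" "0 \<in> I" "x \<in> I \<Longrightarrow> y \<in> I \<Longrightarrow> x + y \<in> I" "a \<in> A \<Longrightarrow> x \<in> I \<Longrightarrow> a * x \<in> I" for x y a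
    using assms(1) unfolding ideal_of_def by blast+
  have "- 1 \<in> A" using subring_ofD(1,5)[OF assms(2)] by blast
  then show "x \<in> I \<Longrightarrow> y \<in> I \<Longrightarrow> x - y \<in> I" using I(3)[of x "- 1 * y"] I(4)[of "- 1" y] by simp
qed

lemma subring_of_adjoin:
  assumes "subring_of A"
  shows "subring_of (adjoin t A)"
  unfolding subring_of_def
proof (intro conjI ballI)
  note A = subring_ofD[OF assms]
  show "1 \<in> adjoin t A"
    unfolding adjoin_def using A by (auto intro!: exI[of _ 1])
  fix x y assume "x \<in> adjoin t A" "y \<in> adjoin t A"
  then obtain q r where qr: "\<forall>i. Polynomial.coeff q i \<in> A" "\<forall>i. Polynomial.coeff r i \<in> A" "x = poly q t" "y = poly r t"
    unfolding adjoin_def by blast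
  show "x - y \<in> adjoin t A"
    unfolding adjoin_def using qr A by (auto intro!: exI[of _ "q - r"])
  have "Polynomial.coeff (q * r) i \<in> A" for i
    unfolding coeff_mult using qr A by (intro subring_of_sum[OF assms]) blast
  then show "x * y \<in> adjoin t A"
    unfolding adjoin_def using qr by (auto intro!: exI[of _ "q * r"])
qed

lemma adjoin_superset:
  assumes "subring_of A"
  shows "insert t A \<subseteq> adjoin t A"
proof -
  note A = subring_ofD[OF assms]
  have "t \<in> adjoin t A"
    unfolding adjoin_def using A by (auto simp: coeff_pCons split: nat.splits intro!: exI[of _ "[:0, 1:]"])
  moreover have "a \<in> adjoin t A" if "a \<in> A" for a
    unfolding adjoin_def using A that by (auto simp: coeff_pCons split: nat.splits intro!: exI[of _ "[:a:]"])
  ultimately show ?thesis by blast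
qed

lemma adjoin_minimal:
  assumes "subring_of C" "A \<subseteq> C" "t \<in> C"
  shows "adjoin t A \<subseteq> C"
proof
  fix x assume "x \<in> adjoin t A"
  then obtain q where "\<forall>i. Polynomial.coeff q i \<in> A" "x = poly q t" unfolding adjoin_def by blast
  then show "x \<in> C"
    unfolding poly_altdef using assms subring_ofD(4)[OF assms(1)] subring_of_power[OF assms(1)]
    by (auto intro!: subring_of_sum[OF assms(1)]) blast
qed

text \<open>The ideals of leading coefficients in Hilbert's theorem. As \<open>t\<close> need not be
  transcendental, they are formed from all formal polynomials whose value at \<open>t\<close> lies
  in \<open>I\<close>, and \<open>n\<close> is only a bound for the degree.\<close>

definition leading_coeffs :: "'b::comm_ring_1 set \<Rightarrow> 'b \<Rightarrow> 'b set \<Rightarrow> nat \<Rightarrow> 'b set" where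
  "leading_coeffs A t I n = {Polynomial.coeff q n |q. (\<forall>i. Polynomial.coeff q i \<in> A) \<and> (\<forall>i>n. Polynomial.coeff q i = 0) \<and> poly q t \<in> I}"

lemma ideal_of_leading_coeffs:
  assumes A: "subring_of A" and I: "ideal_of (adjoin t A) I"
  shows "ideal_of A (leading_coeffs A t I n)"
  unfolding ideal_of_def
proof (intro conjI ballI)
  note D = subring_ofD[OF A] and D' = ideal_ofD[OF I subring_of_adjoin[OF A]]
  show "leading_coeffs A t I n \<subseteq> A" unfolding leading_coeffs_def by auto
  show "0 \<in> leading_coeffs A t I n" unfolding leading_coeffs_def
    using D D' by (auto intro!: exI[of _ 0])
  fix x assume "x \<in> leading_coeffs A t I n"
  then obtain q where q: "\<forall>i. Polynomial.coeff q i \<in> A" "\<forall>i>n. Polynomial.coeff q i = 0" "poly q t \<in> I" "x = Polynomial.coeff q n"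
    unfolding leading_coeffs_def by blast
  show "x + y \<in> leading_coeffs A t I n" if "y \<in> leading_coeffs A t I n" for y
  proof -
    from that obtain r where "\<forall>i. Polynomial.coeff r i \<in> A" "\<forall>i>n. Polynomial.coeff r i = 0" "poly r t \<in> I" "y = Polynomial.coeff r n"
      unfolding leading_coeffs_def by blast
    then show ?thesis unfolding leading_coeffs_def
      using q D D' by (auto intro!: exI[of _ "q + r"])
  qed
  show "a * x \<in> leading_coeffs A t I n" if "a \<in> A" for a
    unfolding leading_coeffs_def
    using that q D D'(4)[of a] adjoin_superset[OF A, of t] by (auto intro!: exI[of _ "Polynomial.smult a q"])
qed

lemma leading_coeffs_Suc:
  assumes A: "subring_of A" and I: "ideal_of (adjoin t A) I"
  shows "leading_coeffs A t I n \<subseteq> leading_coeffs A t I (Suc n)"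
proof
  note D = subring_ofD[OF A] and D' = ideal_ofD[OF I subring_of_adjoin[OF A]]
  fix x assume "x \<in> leading_coeffs A t I n"
  then obtain q where q: "\<forall>i. Polynomial.coeff q i \<in> A" "\<forall>i>n. Polynomial.coeff q i = 0" "poly q t \<in> I" "x = Polynomial.coeff q n"
    unfolding leading_coeffs_def by blast
  have "t \<in> adjoin t A" using adjoin_superset[OF A] by blast
  then show "x \<in> leading_coeffs A t I (Suc n)" unfolding leading_coeffs_def
    using q D D'(4)[of t] by (auto intro!: exI[of _ "pCons 0 q"] simp: coeff_pCons split: nat.splits)
qed

lemma leading_coeffs_mono: "I \<subseteq> J \<Longrightarrow> leading_coeffs A t I n \<subseteq> leading_coeffs A t J n"
  unfolding leading_coeffs_def by blast

text \<open>Induction on a bound for the degree: subtracting a polynomial with value in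
  \<open>I\<close> and the same top coefficient lowers the bound.\<close>

lemma leading_coeffs_determine:
  assumes A: "subring_of A" and I: "ideal_of (adjoin t A) I" and J: "ideal_of (adjoin t A) J"
    and "I \<subseteq> J" and lc: "\<And>n. leading_coeffs A t J n \<subseteq> leading_coeffs A t I n"
  shows "J \<subseteq> I"
proof
  note D = subring_ofD[OF A]
  note DI = ideal_ofD[OF I subring_of_adjoin[OF A]] and DJ = ideal_ofD[OF J subring_of_adjoin[OF A]]
  have main: "poly q t \<in> I"
    if "\<forall>i. Polynomial.coeff q i \<in> A" "\<forall>i\<ge>n. Polynomial.coeff q i = 0" "poly q t \<in> J" for q n
    using that
  proof (induction n arbitrary: q)
    case 0
    then have "q = 0" by (simp add: poly_eq_iff)
    then show ?case using DI by simp
  next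
    case (Suc n)
    have "Polynomial.coeff q n \<in> leading_coeffs A t J n"
      unfolding leading_coeffs_def using Suc.prems by (auto intro!: exI[of _ q])
    then have "Polynomial.coeff q n \<in> leading_coeffs A t I n" using lc by blast
    then obtain r where r: "\<forall>i. Polynomial.coeff r i \<in> A" "\<forall>i>n. Polynomial.coeff r i = 0" "poly r t \<in> I" "Polynomial.coeff q n = Polynomial.coeff r n"
      unfolding leading_coeffs_def by blast
    have "poly (q - r) t \<in> I"
    proof (rule Suc.IH)
      show "\<forall>i\<ge>n. Polynomial.coeff (q - r) i = 0"
      proof (intro allI impI)
        fix i assume "n \<le> i"
        then show "Polynomial.coeff (q - r) i = 0" using Suc.prems(2) r(2,4) by (cases "i = n") auto
      qed
      show "poly (q - r) t \<in> J" using Suc.prems r(3) \<open>I \<subseteq> J\<close> DJ(5) by auto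
    qed (use Suc.prems r D in auto)
    then show ?case using DI(3)[of "poly (q - r) t" "poly r t"] r(3) by simp
  qed
  fix x assume x: "x \<in> J"
  then obtain q where q: "\<forall>i. Polynomial.coeff q i \<in> A" "x = poly q t" using DJ(1) unfolding adjoin_def by blast
  show "x \<in> I"
    unfolding q(2) by (rule main[of q "Suc (Polynomial.degree q)"]) (use q x coeff_eq_0[of q] in auto)
qed

text \<open>The ideals \<open>?lc k n\<close> increase in both indices. Their diagonal is constant
  from \<open>N\<close> on, which settles all n \<ge> N at once; each of the finitely many columns n
  < N becomes stationary separately. From \<open>m\<close> on all leading coefficients agree, and
  they determine the ideals.\<close>

lemma noetherian_adjoin:
  assumes A: "subring_of A" and noeth: "noetherian_subring A"
  shows "noetherian_subring (adjoin t A)"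
  unfolding noetherian_subring_def
proof (intro allI impI)
  fix I :: "nat \<Rightarrow> 'a set"
  assume I: "\<forall>n. ideal_of (adjoin t A) (I n)" and asc: "\<forall>n. I n \<subseteq> I (Suc n)"
  have Imono: "I m \<subseteq> I n" if "m \<le> n" for m n using that asc lift_Suc_mono_le[of I] by blast
  let ?lc = "\<lambda>k n. leading_coeffs A t (I k) n"
  have id: "ideal_of A (?lc k n)" for k n using ideal_of_leading_coeffs[OF A] I by blast
  have m1: "?lc k n \<subseteq> ?lc k' n" if "k \<le> k'" for k k' n using leading_coeffs_mono[OF Imono[OF that]] .
  have m2: "?lc k n \<subseteq> ?lc k n'" if "n \<le> n'" for k n n'
    using that leading_coeffs_Suc[OF A, of t "I k"] I lift_Suc_mono_le[of "?lc k"] by blast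
  have "?lc n n \<subseteq> ?lc (Suc n) (Suc n)" for n
    using m1[of n "Suc n" n] m2[of n "Suc n" "Suc n"] by auto
  then obtain N where N: "\<And>n. n \<ge> N \<Longrightarrow> ?lc n n = ?lc N N"
    using noeth[unfolded noetherian_subring_def, rule_format, of "\<lambda>n. ?lc n n"] id by blast
  have "\<exists>K. \<forall>k\<ge>K. ?lc k n = ?lc K n" for n
    using noeth[unfolded noetherian_subring_def, rule_format, of "\<lambda>k. ?lc k n"] id m1 by auto
  then obtain K where K: "\<And>n k. k \<ge> K n \<Longrightarrow> ?lc k n = ?lc (K n) n" by metis
  define m where "m = Max (insert N (K ` {..<N}))"
  have mN: "N \<le> m" and mK: "n < N \<Longrightarrow> K n \<le> m" for n unfolding m_def by auto
  have "I k \<subseteq> I m" if k: "k \<ge> m" for k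
  proof (rule leading_coeffs_determine[OF A])
    fix n
    show "?lc k n \<subseteq> ?lc m n"
    proof (cases "n < N")
      case True
      then show ?thesis using K[of n k] K[of n m] mK[OF True] k by simp
    next
      case False
      let ?x = "max k n"
      have "?lc k n \<subseteq> ?lc ?x ?x" using m1[of k ?x n] m2[of n ?x ?x] by auto
      also have "\<dots> = ?lc N N" using False by (intro N) auto
      also have "\<dots> \<subseteq> ?lc m n" using m1[OF mN, of N] m2[of N n m] False by auto
      finally show ?thesis .
    qed
  qed (use I Imono k in auto)
  then show "\<exists>N. \<forall>n\<ge>N. I n = I N" using Imono by (intro exI[of _ m]) blast
qed

lemma noetherian_adjoin_list:
  assumes "subring_of A" "noetherian_subring A"
  shows "subring_of (foldr adjoin ts A) \<and> noetherian_subring (foldr adjoin ts A)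
    \<and> A \<union> set ts \<subseteq> foldr adjoin ts A"
  using assms
proof (induction ts)
  case (Cons t ts)
  then show ?case
    using subring_of_adjoin[of "foldr adjoin ts A" t] noetherian_adjoin[of "foldr adjoin ts A" t]
      adjoin_superset[of "foldr adjoin ts A" t] by auto
qed auto

lemma foldr_adjoin_minimal:
  assumes "subring_of C" "A \<subseteq> C" "set ts \<subseteq> C"
  shows "foldr adjoin ts A \<subseteq> C"
  using assms(3) by (induction ts) (use assms(2) adjoin_minimal[OF assms(1)] in auto)

text \<open>For a subring \<open>A\<close> containing \<open>S\<close> this is the ideal of
  \<open>A\<close> generated by \<open>S\<close>.\<close>

inductive_set lin_span :: "'b::comm_ring_1 set \<Rightarrow> 'b set \<Rightarrow> 'b set" for A S where
  zero: "0 \<in> lin_span A S"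
| add: "x \<in> lin_span A S \<Longrightarrow> a \<in> A \<Longrightarrow> s \<in> S \<Longrightarrow> x + a * s \<in> lin_span A S"

lemma ideal_of_lin_span:
  assumes A: "subring_of A" and S: "S \<subseteq> A"
  shows "ideal_of A (lin_span A S)" and "S \<subseteq> lin_span A S"
proof -
  note D = subring_ofD[OF A]
  have sub: "x \<in> A" if "x \<in> lin_span A S" for x
    using that by induction (use S D in auto)
  have add: "x + y \<in> lin_span A S" if "y \<in> lin_span A S" "x \<in> lin_span A S" for x y
    using that by induction (auto simp: add.assoc[symmetric] intro: lin_span.intros)
  have mult: "a * x \<in> lin_span A S" if "x \<in> lin_span A S" "a \<in> A" for x a
    using that by induction (auto simp: distrib_left mult.assoc[symmetric] intro: lin_span.intros D)
  show "ideal_of A (lin_span A S)"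
    unfolding ideal_of_def using sub add mult by (auto intro: lin_span.zero)
  show "S \<subseteq> lin_span A S"
    using lin_span.add[OF lin_span.zero D(1)] by auto
qed

lemma lin_span_mono: "S \<subseteq> T \<Longrightarrow> lin_span A S \<subseteq> lin_span A T"
proof
  fix x assume "x \<in> lin_span A S" "S \<subseteq> T"
  then show "x \<in> lin_span A T" by induction (auto intro: lin_span.intros)
qed

lemma noetherian_tring_chain:
  fixes I :: "nat \<Rightarrow> 'a::comm_ring_1 set"
  assumes "noetherian_ring (tring :: 'a ring)" "\<And>n. ideal (I n) (tring :: 'a ring)" "\<And>n. I n \<subseteq> I (Suc n)"
  shows "\<exists>N. \<forall>n\<ge>N. I n = I N"
proof -
  have mono: "I m \<subseteq> I n" if "m \<le> n" for m n using that assms(3) lift_Suc_mono_le[of I] by blast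
  have "I m \<subseteq> I n \<or> I n \<subseteq> I m" for m n using mono nat_le_linear[of m n] by blast
  then have "\<forall>A\<in>range I. \<forall>B\<in>range I. A \<subseteq> B \<or> B \<subseteq> A" by blast
  then have "subset.chain {I. ideal I (tring :: 'a ring)} (range I)"
    using assms(2) by (auto simp: subset_chain_def)
  then have "\<Union>(range I) \<in> range I"
    using noetherian_ring.ideal_chain_is_trivial[OF assms(1), of "range I"] by blast
  then obtain N where N: "\<Union>(range I) = I N" by blast
  have "I n = I N" if "n \<ge> N" for n using mono[OF that] N by blast
  then show ?thesis by blast
qed

lemma noetherian_tring_finite_generators:
  assumes "noetherian_ring (tring :: 'a::comm_ring_1 ring)" "ideal I (tring :: 'a ring)"
  obtains as where "set as \<subseteq> I" "I = lin_span UNIV (set as)"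
proof -
  interpret noetherian_ring "tring :: 'a ring" by fact
  obtain A where A: "finite A" "I = Idl\<^bsub>tring\<^esub> A" using finetely_gen[OF assms(2)] by blast
  obtain as where as: "set as = A" using finite_list[OF A(1)] by blast
  have sub: "A \<subseteq> I" using A(2) genideal_self[of A] by (simp add: ring_of_type_algebra_def)
  have "subring_of (UNIV :: 'a set)" unfolding subring_of_def by simp
  from ideal_of_lin_span[OF this, of A]
  have lin: "ideal (lin_span UNIV A) (tring :: 'a ring)" "A \<subseteq> lin_span UNIV A"
    unfolding ideal_tring_iff ideal_of_def by auto
  have "I \<subseteq> lin_span UNIV A" unfolding A(2) by (rule genideal_minimal[OF lin])
  moreover have "x \<in> I" if "x \<in> lin_span UNIV A" for x
    using that by induction (use sub ideal_tring_closed[OF assms(2)] in auto)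
  ultimately have "I = lin_span UNIV (set as)" using as by blast
  then show ?thesis using that as sub by blast
qed

text \<open>
  The Rees ring \<open>\<Oplus>\<^sub>n M\<^sup>n X\<^sup>n\<close> is generated over \<open>R\<close> by finitely many elements of degree one,
  hence Noetherian; the ideals generated by the elements of \<open>J \<inter> M\<^sup>j\<close> in degrees \<open>j \<le> k\<close> therefore
  become stationary.
\<close>

theorem artin_rees:
  fixes M J :: "'a::comm_ring_1 set"
  assumes noeth: "noetherian_ring (tring :: 'a ring)" and M: "ideal M (tring :: 'a ring)"
    and J: "ideal J (tring :: 'a ring)"
  shows "\<exists>c. \<forall>n. \<forall>x\<in>J \<inter> ideal_power M n. x \<in> ideal_prod tring J (ideal_power M (n - c))"
proof -
  define C where "C = range (\<lambda>c::'a. [:c:])"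
  note MD = ideal_tring_closed[OF ideal_ideal_power[OF M]]
  have subC: "subring_of C"
    unfolding subring_of_def C_def by (auto simp: one_pCons image_iff)
  have noethC: "noetherian_subring C"
    unfolding noetherian_subring_def
  proof (intro allI impI)
    fix I :: "nat \<Rightarrow> 'a poly set" assume I: "\<forall>n. ideal_of C (I n)" "\<forall>n. I n \<subseteq> I (Suc n)"
    define I' where "I' n = {c. [:c:] \<in> I n}" for n
    have II': "I n = (\<lambda>c. [:c:]) ` I' n" for n
      using I(1) unfolding ideal_of_def I'_def C_def by blast
    have "ideal (I' n) (tring :: 'a ring)" for n
    proof -
      have "ideal_of C (I n)" using I by blast
      note D = ideal_ofD[OF this subC]
      have "[:a * x:] \<in> I n" if "[:x:] \<in> I n" for a x
        using D(4)[of "[:a:]" "[:x:]"] that unfolding C_def by (simp add: mult.commute)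
      moreover have "[:x + y:] \<in> I n" if "[:x:] \<in> I n" "[:y:] \<in> I n" for x y
        using D(3)[OF that] by simp
      ultimately show ?thesis
        unfolding ideal_tring_iff I'_def using D(2) by simp
    qed
    then obtain N where "\<forall>n\<ge>N. I' n = I' N"
      using noetherian_tring_chain[OF noeth, of I'] I(2) unfolding I'_def by blast
    then show "\<exists>N. \<forall>n\<ge>N. I n = I N" unfolding II' by metis
  qed
  obtain as where as: "set as \<subseteq> M" "M = lin_span UNIV (set as)"
    using noetherian_tring_finite_generators[OF noeth M] by blast
  define A where "A = foldr adjoin (map (\<lambda>a. Polynomial.monom a 1) as) C"
  have A: "subring_of A" "noetherian_subring A" "C \<subseteq> A" "a \<in> set as \<Longrightarrow> Polynomial.monom a 1 \<in> A" for a
    using noetherian_adjoin_list[OF subC noethC, of "map (\<lambda>a. Polynomial.monom a 1) as"] unfolding A_def by auto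
  note AD = subring_ofD[OF A(1)]
  \<comment> \<open>\<open>A\<close> is the Rees ring: by \<open>coeffA\<close> its elements have
    their n-th coefficient in M^n, and by \<open>monomA\<close> it contains every monomial of this
    kind.\<close>
  have coeffA: "Polynomial.coeff f n \<in> ideal_power M n" if "f \<in> A" for f n
  proof -
    let ?B = "{f. \<forall>n. Polynomial.coeff f n \<in> ideal_power M n}"
    have "subring_of ?B"
      unfolding subring_of_def
    proof (intro conjI ballI)
      show "1 \<in> ?B" using MD(1) by (auto simp: ideal_power_0 coeff_1)
      fix f g assume fg: "f \<in> ?B" "g \<in> ?B"
      then show "f - g \<in> ?B" using MD(6) by auto
      have "Polynomial.coeff f i * Polynomial.coeff g (n - i) \<in> ideal_power M n" if "i \<le> n" for i n
        using ideal_power_mult[OF M, of "Polynomial.coeff f i" i "Polynomial.coeff g (n - i)" "n - i"] fg that by auto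
      then show "f * g \<in> ?B"
        unfolding coeff_mult mem_Collect_eq by (intro allI ideal_tring_sum[OF ideal_ideal_power[OF M]]) auto
    qed
    moreover have "C \<subseteq> ?B" unfolding C_def using MD(1) by (auto simp: coeff_pCons ideal_power_0 split: nat.splits)
    moreover have "Polynomial.monom a 1 \<in> ?B" if "a \<in> set as" for a
      using that as(1) MD(1) by (auto simp: ideal_power_1[OF M])
    ultimately have "A \<subseteq> ?B"
      unfolding A_def by (intro foldr_adjoin_minimal) auto
    then show ?thesis using that by blast
  qed
  have monomA: "Polynomial.monom y n \<in> A" if "y \<in> ideal_power M n" for y n
    using that
  proof (induction n arbitrary: y)
    case 0
    then show ?case using A(3) unfolding C_def by (auto simp: monom_0)
  next
    case (Suc n)
    have m1: "Polynomial.monom z 1 \<in> A" if "z \<in> M" for z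
    proof -
      have "z \<in> lin_span UNIV (set as)" using that as(2) by simp
      then show ?thesis
      proof induction
        case zero
        then show ?case using AD by simp
      next
        case (add x a s)
        have "[:a:] * Polynomial.monom s 1 \<in> A" using A(3) A(4)[of s] add AD(4) unfolding C_def by blast
        then have "Polynomial.monom (a * s) 1 \<in> A" by (simp add: smult_monom)
        then show ?case using add AD(6) by (simp flip: add_monom)
      qed
    qed
    have "y \<in> ideal_prod tring (ideal_power M n) M" using Suc.prems by (simp add: ideal_power_Suc)
    then show ?case
    proof (induction rule: ideal_prod_tring_induct)
      case (prod i j)
      then have "Polynomial.monom i n * Polynomial.monom j 1 \<in> A" using Suc.IH m1 AD(4) by blast
      then show ?case by (simp add: mult_monom)
    next
      case (sum x y)
      then show ?case using AD(6) by (simp flip: add_monom)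
    qed
  qed
  define S where "S k = {Polynomial.monom y j |y j. j \<le> k \<and> y \<in> J \<inter> ideal_power M j}" for k
  have SA: "S k \<subseteq> A" for k unfolding S_def using monomA by blast
  have "lin_span A (S k) \<subseteq> lin_span A (S (Suc k))" for k
    by (rule lin_span_mono) (auto simp: S_def intro: le_SucI)
  then obtain c where c: "\<And>n. n \<ge> c \<Longrightarrow> lin_span A (S n) = lin_span A (S c)"
    using A(2)[unfolded noetherian_subring_def, rule_format, of "\<lambda>k. lin_span A (S k)"]
      ideal_of_lin_span[OF A(1) SA] by blast
  have id: "ideal (ideal_prod tring J (ideal_power M k)) (tring :: 'a ring)" for k
    by (rule ideal_prod_tring_ideal[OF J ideal_ideal_power[OF M]])
  \<comment> \<open>A generator has degree j \<le> c and its coefficient \<open>y\<close> in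
    \<open>J\<close>. In degree n its cofactor contributes an element of M^(n-j), hence of M^(n-c);
    so the bound \<open>c\<close> of the stationary chain is the constant sought.\<close>
  have coeffS: "Polynomial.coeff f n \<in> ideal_prod tring J (ideal_power M (n - c))" if "f \<in> lin_span A (S c)" for f n
    using that
  proof induction
    case zero
    then show ?case using ideal_tring_closed(1)[OF id] by simp
  next
    case (add x a s)
    obtain y j where s: "s = Polynomial.monom y j" "j \<le> c" "y \<in> J" using add unfolding S_def by blast
    have "Polynomial.coeff (a * s) n \<in> ideal_prod tring J (ideal_power M (n - c))"
    proof (cases "n < j")
      case True
      then show ?thesis using ideal_tring_closed(1)[OF id] by (simp add: s coeff_monom_mult mult.commute[of a])
    next
      case False
      have "n - c \<le> n - j" using s by simp
      then have "Polynomial.coeff a (n - j) \<in> ideal_power M (n - c)"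
        using subsetD[OF ideal_power_antimono[OF M] coeffA[OF add.hyps(2), of "n - j"]] by blast
      then have "y * Polynomial.coeff a (n - j) \<in> ideal_prod tring J (ideal_power M (n - c))"
        using s by (intro ideal_prod_tring)
      moreover have "Polynomial.coeff (a * s) n = y * Polynomial.coeff a (n - j)"
        using False by (simp add: s mult.commute[of a] coeff_monom_mult)
      ultimately show ?thesis by simp
    qed
    then show ?case using add ideal_tring_closed(2)[OF id] by simp
  qed
  show ?thesis
  proof (intro exI[of _ c] allI ballI)
    fix n x assume x: "x \<in> J \<inter> ideal_power M n"
    \<comment> \<open>The chain is known to be constant only from \<open>c\<close> on, hence the
      maximum.\<close>
    then have "Polynomial.monom x n \<in> S (max n c)" unfolding S_def by (auto intro!: exI[of _ x] exI[of _ n])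
    then have "Polynomial.monom x n \<in> lin_span A (S c)"
      using ideal_of_lin_span(2)[OF A(1) SA] c[of "max n c"] by auto
    then show "x \<in> ideal_prod tring J (ideal_power M (n - c))" using coeffS[of "Polynomial.monom x n" n] by simp
  qed
qed

section \<open>Evaluation of power series in filtered algebras\<close>

lemma mdeg_eq_sum: "finite V \<Longrightarrow> Poly_Mapping.keys m \<subseteq> V \<Longrightarrow> mdeg m = (\<Sum>v\<in>V. Poly_Mapping.lookup m v)"
  unfolding mdeg_def by (rule sum.mono_neutral_left) (auto simp: in_keys_iff)

lemma keys_add_nat: "Poly_Mapping.keys (a + b) = Poly_Mapping.keys a \<union> Poly_Mapping.keys (b :: 'v \<Rightarrow>\<^sub>0 nat)"
  by (auto simp: in_keys_iff lookup_add)

lemma mdeg_add: "mdeg (a + b) = mdeg a + mdeg b"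
  using mdeg_eq_sum[of "Poly_Mapping.keys a \<union> Poly_Mapping.keys b"]
  by (simp add: keys_add_nat lookup_add sum.distrib)

lemma mdeg_0 [simp]: "mdeg 0 = 0"
  by (simp add: mdeg_def)

lemma mdeg_eq_0_iff: "mdeg m = 0 \<longleftrightarrow> m = 0"
  by (auto simp: mdeg_def in_keys_iff intro!: poly_mapping_eqI)

lemma mdeg_single [simp]: "mdeg (Poly_Mapping.single v n) = n"
  by (auto simp: mdeg_def)

abbreviation monoms_upto :: "'v set \<Rightarrow> nat \<Rightarrow> ('v \<Rightarrow>\<^sub>0 nat) set" where
  "monoms_upto V s \<equiv> {\<alpha>. Poly_Mapping.keys \<alpha> \<subseteq> V \<and> mdeg \<alpha> \<le> s}"

lemma finite_monoms_upto [simp]: "finite V \<Longrightarrow> finite (monoms_upto V s)"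
proof (rule finite_imageD)
  assume V: "finite V"
  let ?T = "{f. \<forall>v. (v \<in> V \<longrightarrow> f v \<in> {..s}) \<and> (v \<notin> V \<longrightarrow> f v = 0)}"
  have "Poly_Mapping.lookup a v \<le> s" if "a \<in> monoms_upto V s" "v \<in> V" for a v
    using member_le_sum[of v V "Poly_Mapping.lookup a"] mdeg_eq_sum[of V a] that V by auto
  then have "Poly_Mapping.lookup ` monoms_upto V s \<subseteq> ?T"
    by (auto simp: in_keys_iff)
  moreover have "finite ?T" using V by (intro finite_set_of_finite_funs) auto
  ultimately show "finite (Poly_Mapping.lookup ` monoms_upto V s)" by (rule finite_subset)
  show "inj_on Poly_Mapping.lookup (monoms_upto V s)" by (rule inj_onI, rule poly_mapping_eqI) simp
qed

lemma monom_eval_0 [simp]: "monom_eval V x 0 = 1"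
  by (simp add: monom_eval_def)

lemma monom_eval_add: "monom_eval V x (a + b) = monom_eval V x a * monom_eval V x b"
  by (simp add: monom_eval_def lookup_add power_add prod.distrib)

lemma monom_eval_cong: "(\<And>v. v \<in> V \<Longrightarrow> x v = y v) \<Longrightarrow> monom_eval V x a = monom_eval V y a"
  unfolding monom_eval_def by (rule prod.cong) auto

lemma monom_eval_single:
  assumes "finite V" "v \<in> V"
  shows "monom_eval V x (Poly_Mapping.single v n) = x v ^ n"
proof -
  have "monom_eval V x (Poly_Mapping.single v n) = (\<Prod>w\<in>V. if v = w then x v ^ n else 1)"
    unfolding monom_eval_def by (rule prod.cong) (auto simp: lookup_single when_def)
  then show ?thesis using assms by simp
qed

lemma monom_decompose:
  assumes "Poly_Mapping.keys \<alpha> \<subseteq> V" "mdeg \<alpha> = Suc n"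
  obtains v \<beta> where "v \<in> V" "Poly_Mapping.keys \<beta> \<subseteq> V" "mdeg \<beta> = n" "\<alpha> = Poly_Mapping.single v 1 + \<beta>"
proof -
  have "\<alpha> \<noteq> 0" using assms(2) by auto
  then obtain v where v: "v \<in> Poly_Mapping.keys \<alpha>" by (metis all_not_in_conv keys_eq_empty)
  define \<beta> where "\<beta> = \<alpha> - Poly_Mapping.single v 1"
  have eq: "\<alpha> = Poly_Mapping.single v 1 + \<beta>"
    unfolding \<beta>_def using v
    by (intro poly_mapping_eqI) (auto simp: lookup_add lookup_minus lookup_single when_def in_keys_iff)
  then have "Poly_Mapping.keys \<beta> \<subseteq> V" using assms(1) keys_add_nat[of "Poly_Mapping.single v 1" \<beta>] by auto
  moreover have "mdeg \<beta> = n" using assms(2) arg_cong[OF eq, of mdeg] by (simp add: mdeg_add)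
  ultimately show ?thesis using that v eq assms(1) by blast
qed

lemma monom_induct [consumes 1, case_names zero Suc]:
  fixes \<alpha> :: "'v \<Rightarrow>\<^sub>0 nat"
  assumes "Poly_Mapping.keys \<alpha> \<subseteq> V" and "P 0"
    and "\<And>v \<beta>. v \<in> V \<Longrightarrow> Poly_Mapping.keys \<beta> \<subseteq> V \<Longrightarrow> P \<beta> \<Longrightarrow> P (Poly_Mapping.single v 1 + \<beta>)"
  shows "P \<alpha>"
  using assms(1)
proof (induction "mdeg \<alpha>" arbitrary: \<alpha>)
  case 0
  then have "\<alpha> = 0" using mdeg_eq_0_iff[of \<alpha>] by simp
  then show ?case using assms(2) by simp
next
  case (Suc n)
  obtain v \<beta> where "v \<in> V" "Poly_Mapping.keys \<beta> \<subseteq> V" "mdeg \<beta> = n" "\<alpha> = Poly_Mapping.single v 1 + \<beta>"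
    using monom_decompose[OF Suc.prems Suc.hyps(2)[symmetric]] .
  then show ?case using Suc.hyps(1) assms(3) by metis
qed

text \<open>One frame for three filtrations: series in several variables by order, R by the powers
  of M^K, and series in one variable by order. The first serves formal substitution, the second the
  group G, the third the Jacobi identity.\<close>

locale filtered_ring =
  fixes E :: "nat \<Rightarrow> 'e::comm_ring_1 set"
  assumes E_0: "E 0 = UNIV" and E_zero: "0 \<in> E n" and E_add: "x \<in> E n \<Longrightarrow> y \<in> E n \<Longrightarrow> x + y \<in> E n"
    and E_mult: "x \<in> E m \<Longrightarrow> y \<in> E n \<Longrightarrow> x * y \<in> E (m + n)" and E_Suc: "E (Suc n) \<subseteq> E n"
begin

lemma E_mult_left: "x \<in> E n \<Longrightarrow> a * x \<in> E n"
  using E_mult[of a 0 x n] E_0 by simp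

lemma E_minus: "x \<in> E n \<Longrightarrow> - x \<in> E n"
  using E_mult_left[of x n "-1"] by simp

lemma E_diff: "x \<in> E n \<Longrightarrow> y \<in> E n \<Longrightarrow> x - y \<in> E n"
  using E_add[OF _ E_minus, of x n y] by simp

lemma E_sum: "(\<And>i. i \<in> A \<Longrightarrow> f i \<in> E n) \<Longrightarrow> sum f A \<in> E n"
  by (induction A rule: infinite_finite_induct) (auto intro: E_zero E_add)

lemma E_antimono: "m \<le> n \<Longrightarrow> x \<in> E n \<Longrightarrow> x \<in> E m"
  using lift_Suc_antimono_le[of E, OF E_Suc] by blast

lemma E_diff_trans: "x - y \<in> E n \<Longrightarrow> y - z \<in> E n \<Longrightarrow> x - z \<in> E n"
  using E_add[of "x - y" n "y - z"] by simp

lemma E_diff_sym: "x - y \<in> E n \<Longrightarrow> y - x \<in> E n"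
  using E_minus[of "x - y"] by simp

lemma E_diff_mult: "x - x' \<in> E n \<Longrightarrow> y - y' \<in> E n \<Longrightarrow> x * y - x' * y' \<in> E n"
  using E_add[OF E_mult_left[of "y - y'" n x] E_mult_left[of "x - x'" n y']] by (simp add: algebra_simps)

lemma E_diff_power: "x - x' \<in> E n \<Longrightarrow> x ^ k - x' ^ k \<in> E n"
  by (induction k) (auto intro: E_zero E_diff_mult)

lemma E_diff_prod: "(\<And>i. i \<in> A \<Longrightarrow> f i - g i \<in> E n) \<Longrightarrow> prod f A - prod g A \<in> E n"
  by (induction A rule: infinite_finite_induct) (auto intro: E_zero E_diff_mult)

lemma E_diff_sum: "(\<And>i. i \<in> A \<Longrightarrow> f i - g i \<in> E n) \<Longrightarrow> sum f A - sum g A \<in> E n"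
  unfolding sum_subtractf[symmetric] by (rule E_sum)

lemma monom_eval_in_E:
  assumes "finite V" "Poly_Mapping.keys \<alpha> \<subseteq> V" "\<forall>v\<in>V. x v \<in> E 1"
  shows "monom_eval V x \<alpha> \<in> E (mdeg \<alpha>)"
  using assms(2)
proof (induction rule: monom_induct)
  case zero
  then show ?case using E_0 by simp
next
  case (Suc v \<beta>)
  then show ?case
    using E_mult[OF bspec[OF assms(3) Suc(1)] Suc(3)] monom_eval_single[OF assms(1) Suc(1), of x 1]
    by (simp add: monom_eval_add mdeg_add)
qed

text \<open>If the variables are exchanged one at a time, each difference has one factor in
  \<open>E (Suc k)\<close> in place of \<open>E 1\<close>, which gains \<open>k\<close>
  steps.\<close>

lemma monom_eval_diff:
  fixes x y :: "'v \<Rightarrow> 'e"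
  assumes "finite V" "Poly_Mapping.keys \<alpha> \<subseteq> V" "\<forall>v\<in>V. x v \<in> E 1" "\<forall>v\<in>V. y v \<in> E 1"
    and "\<forall>v\<in>V. x v - y v \<in> E (Suc k)"
  shows "monom_eval V x \<alpha> - monom_eval V y \<alpha> \<in> E (mdeg \<alpha> + k)"
  using assms(2)
proof (induction rule: monom_induct)
  case zero
  then show ?case using E_zero by simp
next
  case (Suc v \<beta>)
  let ?s = "Poly_Mapping.single v (1::nat)"
  have "x v * (monom_eval V x \<beta> - monom_eval V y \<beta>) \<in> E (1 + (mdeg \<beta> + k))"
    using assms(3) Suc by (intro E_mult) auto
  moreover have "(x v - y v) * monom_eval V y \<beta> \<in> E (Suc k + mdeg \<beta>)"
    using assms Suc by (intro E_mult monom_eval_in_E) auto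
  ultimately have "x v * (monom_eval V x \<beta> - monom_eval V y \<beta>) + (x v - y v) * monom_eval V y \<beta>
      \<in> E (Suc (mdeg \<beta> + k))"
    by (intro E_add) (simp_all add: add.commute)
  moreover have "monom_eval V z ?s = z v" for z :: "'v \<Rightarrow> 'e"
    using monom_eval_single[OF assms(1) Suc(1), of z 1] by simp
  then have "monom_eval V x (?s + \<beta>) - monom_eval V y (?s + \<beta>)
      = x v * (monom_eval V x \<beta> - monom_eval V y \<beta>) + (x v - y v) * monom_eval V y \<beta>"
    by (simp only: monom_eval_add) (simp add: algebra_simps)
  ultimately show ?case by (simp only: mdeg_add mdeg_single) simp
qed

end

locale filtered_algebra = filtered_ring E
  for E :: "nat \<Rightarrow> 'e::comm_ring_1 set" +
  fixes \<phi> :: "'a::comm_ring_1 \<Rightarrow> 'e"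
  assumes \<phi>_add: "\<phi> (a + b) = \<phi> a + \<phi> b" and \<phi>_mult: "\<phi> (a * b) = \<phi> a * \<phi> b" and \<phi>_1: "\<phi> 1 = 1"
begin

lemma \<phi>_0: "\<phi> 0 = 0"
  using \<phi>_add[of 0 0] by simp

lemma \<phi>_sum: "\<phi> (sum f A) = (\<Sum>i\<in>A. \<phi> (f i))"
  by (induction A rule: infinite_finite_induct) (auto simp: \<phi>_0 \<phi>_add)

text \<open>Evaluation cut off at degree \<open>s\<close> is a finite sum, so no convergence is
  involved; the rules of evaluation then hold modulo \<open>E (Suc s)\<close>.\<close>

definition ev :: "'v set \<Rightarrow> nat \<Rightarrow> ('v \<Rightarrow> 'e) \<Rightarrow> ('v, 'a) mps \<Rightarrow> 'e" where
  "ev V s x f = (\<Sum>\<alpha>\<in>monoms_upto V s. \<phi> (mps_coeff f \<alpha>) * monom_eval V x \<alpha>)"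

lemma ev_cong: "(\<And>v. v \<in> V \<Longrightarrow> x v = y v) \<Longrightarrow> ev V s x f = ev V s y f"
  unfolding ev_def using monom_eval_cong[of V x y] by simp

lemma ev_add: "ev V s x (f + g) = ev V s x f + ev V s x g"
  by (simp add: ev_def plus_mps.rep_eq \<phi>_add distrib_right sum.distrib)

lemma ev_0: "ev V s x 0 = 0"
  by (simp add: ev_def zero_mps.rep_eq \<phi>_0)

lemma ev_1: "finite V \<Longrightarrow> ev V s x 1 = 1"
proof -
  assume V: "finite V"
  have "ev V s x 1 = (\<Sum>\<alpha>\<in>{0}. \<phi> (mps_coeff 1 \<alpha>) * monom_eval V x \<alpha>)"
    unfolding ev_def using V by (intro sum.mono_neutral_right) (auto simp: one_mps.rep_eq \<phi>_0)
  then show ?thesis by (simp add: one_mps.rep_eq \<phi>_1)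
qed

lemma ev_var:
  assumes V: "finite V" "v \<in> V" and s: "s \<ge> 1"
  shows "ev V s x (mps_var v) = x v"
proof -
  have c: "mps_coeff (mps_var v :: ('b, 'a) mps) m = (if m = Poly_Mapping.single v 1 then 1 else 0)" for m
    unfolding mps_var_def by (simp add: Abs_mps_inverse)
  have "ev V s x (mps_var v)
      = (\<Sum>\<alpha>\<in>{Poly_Mapping.single v 1}. \<phi> (mps_coeff (mps_var v) \<alpha>) * monom_eval V x \<alpha>)"
    unfolding ev_def using V s by (intro sum.mono_neutral_right) (auto simp: c \<phi>_0)
  then show ?thesis using monom_eval_single[OF V, of x 1] by (simp add: c \<phi>_1)
qed

lemma ev_order:
  assumes V: "finite V" and x: "\<forall>v\<in>V. x v \<in> E 1"
    and f: "\<And>m. mdeg m < n \<Longrightarrow> mps_coeff f m = 0"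
  shows "ev V s x f \<in> E n"
  unfolding ev_def
proof (rule E_sum)
  fix \<alpha> assume \<alpha>: "\<alpha> \<in> monoms_upto V s"
  show "\<phi> (mps_coeff f \<alpha>) * monom_eval V x \<alpha> \<in> E n"
  proof (cases "mdeg \<alpha> < n")
    case True
    then show ?thesis using f E_zero by (simp add: \<phi>_0)
  next
    case False
    then show ?thesis
      using E_mult_left[OF E_antimono[OF _ monom_eval_in_E[OF V _ x]], of n \<alpha>] \<alpha> by auto
  qed
qed

text \<open>Constant terms cancel in the difference, so only the coefficients in degrees from 1 to n
  - 1 have to vanish.\<close>

lemma ev_diff:
  assumes V: "finite V" and x: "\<forall>v\<in>V. x v \<in> E 1" and y: "\<forall>v\<in>V. y v \<in> E 1"
    and xy: "\<forall>v\<in>V. x v - y v \<in> E (Suc k)"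
    and f: "\<And>m. mdeg m < n \<Longrightarrow> m \<noteq> 0 \<Longrightarrow> mps_coeff f m = 0"
  shows "ev V s x f - ev V s y f \<in> E (n + k)"
  unfolding ev_def sum_subtractf[symmetric] right_diff_distrib[symmetric]
proof (rule E_sum)
  fix \<alpha> assume \<alpha>: "\<alpha> \<in> monoms_upto V s"
  consider "\<alpha> = 0" | "\<alpha> \<noteq> 0" "mdeg \<alpha> < n" | "mdeg \<alpha> \<ge> n" by linarith
  then show "\<phi> (mps_coeff f \<alpha>) * (monom_eval V x \<alpha> - monom_eval V y \<alpha>) \<in> E (n + k)"
  proof cases
    case 3
    then show ?thesis
      using E_mult_left[OF E_antimono[OF _ monom_eval_diff[OF V _ x y xy]], of "n + k" \<alpha>] \<alpha> by auto
  qed (use f E_zero in \<open>auto simp: \<phi>_0\<close>)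
qed

lemma ev_point_cong:
  assumes V: "finite V" and x: "\<forall>v\<in>V. x v \<in> E 1" and y: "\<forall>v\<in>V. y v \<in> E 1"
    and xy: "\<forall>v\<in>V. x v - y v \<in> E (Suc k)"
  shows "ev V s x f - ev V s y f \<in> E (Suc k)"
  using ev_diff[of V x y k 1 f s, OF V x y xy] by (simp add: mdeg_eq_0_iff)

lemma ev_truncate:
  assumes V: "finite V" and x: "\<forall>v\<in>V. x v \<in> E 1" and "s \<le> s'"
  shows "ev V s' x f - ev V s x f \<in> E (Suc s)"
proof -
  have "ev V s' x f - ev V s x f
      = (\<Sum>\<alpha>\<in>monoms_upto V s' - monoms_upto V s. \<phi> (mps_coeff f \<alpha>) * monom_eval V x \<alpha>)"
    unfolding ev_def using V assms(3) by (subst sum_diff) auto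
  also have "\<dots> \<in> E (Suc s)"
  proof (intro E_sum E_mult_left)
    fix \<alpha> assume \<alpha>: "\<alpha> \<in> monoms_upto V s' - monoms_upto V s"
    then have "Suc s \<le> mdeg \<alpha>" by auto
    then show "monom_eval V x \<alpha> \<in> E (Suc s)"
      using E_antimono monom_eval_in_E[OF V _ x] \<alpha> by blast
  qed
  finally show ?thesis .
qed

text \<open>The two sides differ by products of terms of degree at most \<open>s\<close> whose total
  degree exceeds \<open>s\<close>.\<close>

lemma ev_mult:
  fixes f g :: "('v, 'a) mps"
  assumes V: "finite V" and x: "\<forall>v\<in>V. x v \<in> E 1"
  shows "ev V s x (f * g) - ev V s x f * ev V s x g \<in> E (Suc s)"
proof -
  let ?t = "\<lambda>a b. \<phi> (mps_coeff f a) * monom_eval V x a * (\<phi> (mps_coeff g b) * monom_eval V x b)"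
  let ?M = "monoms_upto V s"
  let ?P = "{ab \<in> ?M \<times> ?M. mdeg (fst ab + snd ab) \<le> s}"
  have "ev V s x (f * g) = (\<Sum>m\<in>?M. \<Sum>ab\<in>{(a, b). a + b = m}. ?t (fst ab) (snd ab))"
    unfolding ev_def
  proof (rule sum.cong[OF refl])
    fix m :: "'v \<Rightarrow>\<^sub>0 nat"
    let ?S = "{(a, b). a + b = m}"
    have "\<phi> (mps_coeff (f * g) m) * monom_eval V x m
        = (\<Sum>ab\<in>?S. \<phi> (mps_coeff f (fst ab) * mps_coeff g (snd ab)) * monom_eval V x m)"
      unfolding times_mps.rep_eq by (simp add: \<phi>_sum sum_distrib_right case_prod_unfold)
    also have "\<dots> = (\<Sum>ab\<in>?S. ?t (fst ab) (snd ab))"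
      by (rule sum.cong) (auto simp: \<phi>_mult monom_eval_add mult_ac)
    finally show "\<phi> (mps_coeff (f * g) m) * monom_eval V x m = (\<Sum>ab\<in>?S. ?t (fst ab) (snd ab))" .
  qed
  also have "\<dots> = (\<Sum>(m, ab)\<in>Sigma ?M (\<lambda>m. {(a, b). a + b = m}). ?t (fst ab) (snd ab))"
    using V by (intro sum.Sigma) (auto simp: finite_monom_splits)
  also have "\<dots> = (\<Sum>ab\<in>?P. ?t (fst ab) (snd ab))"
    by (rule sum.reindex_bij_witness[of _ "\<lambda>ab. (fst ab + snd ab, ab)" snd])
      (auto simp: keys_add_nat mdeg_add)
  finally have e1: "ev V s x (f * g) = (\<Sum>ab\<in>?P. ?t (fst ab) (snd ab))" .
  have e2: "ev V s x f * ev V s x g = (\<Sum>ab\<in>?M \<times> ?M. ?t (fst ab) (snd ab))"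
    unfolding ev_def sum_product sum.cartesian_product by (simp add: case_prod_unfold)
  have "ev V s x f * ev V s x g - ev V s x (f * g) = (\<Sum>ab\<in>?M \<times> ?M - ?P. ?t (fst ab) (snd ab))"
    unfolding e1 e2 using V by (subst sum_diff) auto
  also have "\<dots> \<in> E (Suc s)"
  proof (rule E_sum)
    fix ab assume "ab \<in> ?M \<times> ?M - ?P"
    then obtain a b where ab: "ab = (a, b)" "a \<in> ?M" "b \<in> ?M" "Suc s \<le> mdeg a + mdeg b"
      by (cases ab) (auto simp: mdeg_add)
    have "monom_eval V x a * monom_eval V x b \<in> E (Suc s)"
      using ab monom_eval_in_E[OF V _ x] E_antimono[OF ab(4) E_mult] by blast
    then have "\<phi> (mps_coeff f a) * \<phi> (mps_coeff g b) * (monom_eval V x a * monom_eval V x b) \<in> E (Suc s)"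
      by (rule E_mult_left)
    then show "?t (fst ab) (snd ab) \<in> E (Suc s)" by (simp add: ab(1) mult_ac)
  qed
  finally show ?thesis by (rule E_diff_sym)
qed

lemma ev_power:
  assumes V: "finite V" and x: "\<forall>v\<in>V. x v \<in> E 1"
  shows "ev V s x (f ^ k) - ev V s x f ^ k \<in> E (Suc s)"
proof (induction k)
  case 0
  then show ?case using E_zero by (simp add: ev_1[OF V])
next
  case (Suc k)
  have "ev V s x f * ev V s x (f ^ k) - ev V s x f * ev V s x f ^ k \<in> E (Suc s)"
    using Suc E_zero by (intro E_diff_mult) auto
  then show ?case using E_diff_trans[OF ev_mult[OF V x, of s f "f ^ k"]] by simp
qed

lemma ev_prod:
  assumes V: "finite V" and x: "\<forall>v\<in>V. x v \<in> E 1"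
  shows "ev V s x (prod h A) - (\<Prod>i\<in>A. ev V s x (h i)) \<in> E (Suc s)"
proof (induction A rule: infinite_finite_induct)
  case (insert a A)
  have "ev V s x (h a) * ev V s x (prod h A) - ev V s x (h a) * (\<Prod>i\<in>A. ev V s x (h i)) \<in> E (Suc s)"
    using insert.IH E_zero by (intro E_diff_mult) auto
  then show ?case using E_diff_trans[OF ev_mult[OF V x, of s "h a" "prod h A"]] insert.hyps by simp
qed (use E_zero in \<open>auto simp: ev_1[OF V]\<close>)

lemma ev_monom_eval:
  assumes V: "finite V" and x: "\<forall>v\<in>V. x v \<in> E 1"
  shows "ev V s x (monom_eval U g \<alpha>) - monom_eval U (\<lambda>u. ev V s x (g u)) \<alpha> \<in> E (Suc s)"
  unfolding monom_eval_def
  by (rule E_diff_trans[OF ev_prod[OF V x] E_diff_prod]) (use ev_power[OF V x] in auto)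

end

subsection \<open>The filtration by order\<close>

definition order_ge :: "nat \<Rightarrow> ('v, 'a::comm_ring_1) mps set" where
  "order_ge n = {f. \<forall>m. mdeg m < n \<longrightarrow> mps_coeff f m = 0}"

definition mps_const :: "'a::comm_ring_1 \<Rightarrow> ('v, 'a) mps" where
  "mps_const c = Abs_mps (\<lambda>m. if m = 0 then c else 0)"

lemma mps_coeff_const: "mps_coeff (mps_const c) m = (if m = 0 then c else 0)"
  by (simp add: mps_const_def Abs_mps_inverse)

lemma mps_coeff_var: "mps_coeff (mps_var v) m = (if m = Poly_Mapping.single v 1 then 1 else 0)"
  by (simp add: mps_var_def Abs_mps_inverse)

lemma mps_coeff_const_mult:
  fixes f :: "('v, 'a::comm_ring_1) mps"
  shows "mps_coeff (mps_const c * f) m = c * mps_coeff f m"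
proof -
  have "mps_coeff (mps_const c * f) m = (\<Sum>(a, b)\<in>{(0 :: 'v \<Rightarrow>\<^sub>0 nat, m)}. mps_coeff (mps_const c) a * mps_coeff f b)"
    unfolding times_mps.rep_eq
    by (rule sum.mono_neutral_right[OF finite_monom_splits]) (auto simp: mps_coeff_const split: if_splits)
  then show ?thesis by (simp add: mps_coeff_const)
qed

lemma mps_coeff_sum: "mps_coeff (sum f A) m = (\<Sum>i\<in>A. mps_coeff (f i) m)"
  by (induction A rule: infinite_finite_induct) (auto simp: zero_mps.rep_eq plus_mps.rep_eq)

interpretation order: filtered_ring "order_ge :: nat \<Rightarrow> ('v, 'a::comm_ring_1) mps set"
proof
  fix f g :: "('v, 'a) mps" and m n
  show "f * g \<in> order_ge (m + n)" if "f \<in> order_ge m" "g \<in> order_ge n"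
    unfolding order_ge_def mem_Collect_eq times_mps.rep_eq
  proof (intro allI impI sum.neutral ballI)
    fix k :: "'v \<Rightarrow>\<^sub>0 nat" and ab assume k: "mdeg k < m + n" "ab \<in> {(a, b). a + b = k}"
    then obtain a b where ab: "ab = (a, b)" "a + b = k" by blast
    then have "mdeg a + mdeg b < m + n" using k(1) mdeg_add[of a b] by simp
    then have "mdeg a < m \<or> mdeg b < n" by linarith
    then show "(case ab of (a, b) \<Rightarrow> mps_coeff f a * mps_coeff g b) = 0"
      using that unfolding ab order_ge_def by auto
  qed
qed (auto simp: order_ge_def zero_mps.rep_eq plus_mps.rep_eq)

interpretation order: filtered_algebra "order_ge :: nat \<Rightarrow> ('v, 'a::comm_ring_1) mps set" mps_const
proof
  fix a b :: 'a
  show "mps_const (a * b) = mps_const a * mps_const b"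
    by (rule mps_eqI) (simp add: mps_coeff_const_mult mps_coeff_const)
qed (rule mps_eqI, simp add: mps_coeff_const plus_mps.rep_eq one_mps.rep_eq)+

lemma order_ge_eqI: "(\<And>s. f - g \<in> order_ge (Suc s)) \<Longrightarrow> f = g"
proof (rule mps_eqI)
  fix m assume "\<And>s. f - g \<in> order_ge (Suc s)"
  then have "mps_coeff (f - g) m = 0" unfolding order_ge_def by blast
  then show "mps_coeff f m = mps_coeff g m" by (simp add: minus_mps.rep_eq)
qed

text \<open>\<open>mps_subst\<close> truncates at a degree that depends on the coefficient. Any
  larger bound gives the same value, because monomials of higher degree yield series of higher
  order; with one bound for all coefficients the sum becomes \<open>order.ev\<close>.\<close>

lemma mps_subst_coeff:
  assumes V: "finite V" and g: "\<forall>v\<in>V. g v \<in> order_ge 1" and m: "mdeg m \<le> s"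
  shows "mps_coeff (mps_subst V g f) m = (\<Sum>\<alpha>\<in>monoms_upto V s. mps_coeff f \<alpha> * mps_coeff (monom_eval V g \<alpha>) m)"
proof -
  have "mps_coeff (mps_subst V g f) m
      = (\<Sum>\<alpha>\<in>monoms_upto V (mdeg m). mps_coeff f \<alpha> * mps_coeff (monom_eval V g \<alpha>) m)"
    unfolding mps_subst_def monom_eval_def by (simp add: Abs_mps_inverse)
  also have "\<dots> = (\<Sum>\<alpha>\<in>monoms_upto V s. mps_coeff f \<alpha> * mps_coeff (monom_eval V g \<alpha>) m)"
  proof (rule sum.mono_neutral_left)
    show "\<forall>\<alpha>\<in>monoms_upto V s - monoms_upto V (mdeg m). mps_coeff f \<alpha> * mps_coeff (monom_eval V g \<alpha>) m = 0"
    proof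
      fix \<alpha> assume "\<alpha> \<in> monoms_upto V s - monoms_upto V (mdeg m)"
      then have "mps_coeff (monom_eval V g \<alpha>) m = 0"
        using order.monom_eval_in_E[OF V _ g, of \<alpha>] unfolding order_ge_def by auto
      then show "mps_coeff f \<alpha> * mps_coeff (monom_eval V g \<alpha>) m = 0" by simp
    qed
  qed (use V m in auto)
  finally show ?thesis .
qed

text \<open>Formal substitution is approximated by truncated evaluation in the ring of series
  itself. Facts about \<open>ev\<close> thus become identities of series once they hold for every
  \<open>s\<close>.\<close>

lemma mps_subst_ev:
  assumes V: "finite V" and g: "\<forall>v\<in>V. g v \<in> order_ge 1"
  shows "mps_subst V g f - order.ev V s g f \<in> order_ge (Suc s)"
  unfolding order_ge_def order.ev_def
  using mps_subst_coeff[OF V g, of _ s f]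
  by (auto simp: minus_mps.rep_eq mps_coeff_sum mps_coeff_const_mult less_Suc_eq_le)

context filtered_algebra
begin

lemma ev_subst:
  assumes V: "finite V" and W: "finite W" and g: "\<forall>v\<in>V. g v \<in> order_ge 1"
    and x: "\<forall>w\<in>W. x w \<in> E 1"
  shows "ev W s x (mps_subst V g f) - ev V s (\<lambda>v. ev W s x (g v)) f \<in> E (Suc s)"
proof -
  let ?c = "\<lambda>\<alpha>. \<phi> (mps_coeff f \<alpha>)"
  have "ev W s x (mps_subst V g f)
      = (\<Sum>\<beta>\<in>monoms_upto W s. \<Sum>\<alpha>\<in>monoms_upto V s. ?c \<alpha> * (\<phi> (mps_coeff (monom_eval V g \<alpha>) \<beta>) * monom_eval W x \<beta>))"
    unfolding ev_def
    by (rule sum.cong[OF refl]) (simp add: mps_subst_coeff[OF V g, of _ s] \<phi>_sum \<phi>_mult sum_distrib_right mult.assoc)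
  also have "\<dots> = (\<Sum>\<alpha>\<in>monoms_upto V s. ?c \<alpha> * ev W s x (monom_eval V g \<alpha>))"
    unfolding ev_def sum_distrib_left by (rule sum.swap)
  finally have "ev W s x (mps_subst V g f) = (\<Sum>\<alpha>\<in>monoms_upto V s. ?c \<alpha> * ev W s x (monom_eval V g \<alpha>))" .
  moreover have "?c \<alpha> * ev W s x (monom_eval V g \<alpha>) - ?c \<alpha> * monom_eval V (\<lambda>v. ev W s x (g v)) \<alpha> \<in> E (Suc s)" for \<alpha>
    using E_diff_mult[OF _ ev_monom_eval[OF W x], of "?c \<alpha>" "?c \<alpha>"] E_zero by simp
  ultimately show ?thesis
    unfolding ev_def[of V] by (auto intro: E_diff_sum)
qed

end

section \<open>Calculus of formal substitution\<close>

lemma mps_subst_order: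
  assumes V: "finite V" and g: "\<forall>v\<in>V. g v \<in> order_ge 1" and f: "f \<in> order_ge n"
  shows "mps_subst V g f \<in> order_ge n"
proof -
  have "order.ev V n g f \<in> order_ge n"
    using f order.ev_order[OF V g, of n f n] unfolding order_ge_def by auto
  moreover have "mps_subst V g f - order.ev V n g f \<in> order_ge n"
    using mps_subst_ev[OF V g, of f n] order.E_antimono[of n "Suc n"] by auto
  ultimately show ?thesis using order.E_add by fastforce
qed

lemma mps_subst_subst:
  fixes g :: "'u \<Rightarrow> ('v, 'a::comm_ring_1) mps"
  assumes V: "finite V" and W: "finite W" and g: "\<forall>v\<in>V. g v \<in> order_ge 1"
    and h: "\<forall>w\<in>W. h w \<in> order_ge 1"
  shows "mps_subst W h (mps_subst V g f) = mps_subst V (\<lambda>v. mps_subst W h (g v)) f"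
proof (rule order_ge_eqI)
  fix s
  let ?x = "\<lambda>v. order.ev W s h (g v)" and ?y = "\<lambda>v. mps_subst W h (g v)"
  have y1: "\<forall>v\<in>V. ?y v \<in> order_ge 1" using mps_subst_order[OF W h] g by blast
  have x1: "\<forall>v\<in>V. ?x v \<in> order_ge 1"
  proof
    fix v assume "v \<in> V"
    then have "g v \<in> order_ge 1" using g by blast
    then show "?x v \<in> order_ge 1"
      unfolding order_ge_def[of 1, where 'v = 'v] by (intro order.ev_order[OF W h]) auto
  qed
  have "mps_subst W h (mps_subst V g f) - order.ev W s h (mps_subst V g f) \<in> order_ge (Suc s)"
    by (rule mps_subst_ev[OF W h])
  moreover have "order.ev W s h (mps_subst V g f) - order.ev V s ?x f \<in> order_ge (Suc s)"
    by (rule order.ev_subst[OF V W g h])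
  moreover have "order.ev V s ?x f - order.ev V s ?y f \<in> order_ge (Suc s)"
    using order.E_diff_sym[OF mps_subst_ev[OF W h]] by (intro order.ev_point_cong[OF V x1 y1]) auto
  moreover have "order.ev V s ?y f - mps_subst V ?y f \<in> order_ge (Suc s)"
    using mps_subst_ev[OF V y1] by (rule order.E_diff_sym)
  ultimately show "mps_subst W h (mps_subst V g f) - mps_subst V ?y f \<in> order_ge (Suc s)"
    using order.E_diff_trans by blast
qed

lemma mps_subst_add: "finite V \<Longrightarrow> mps_subst V g (f + f') = mps_subst V g f + mps_subst V g f'"
  by (rule mps_eqI) (simp add: mps_subst_def Abs_mps_inverse plus_mps.rep_eq distrib_right sum.distrib)

lemma mps_subst_minus: "finite V \<Longrightarrow> mps_subst V g (f - f') = mps_subst V g f - mps_subst V g f'"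
  by (rule mps_eqI) (simp add: mps_subst_def Abs_mps_inverse minus_mps.rep_eq left_diff_distrib sum_subtractf)

lemma mps_subst_const_mult: "mps_subst V g (mps_const c * f) = mps_const c * mps_subst V g f"
  by (rule mps_eqI)
    (simp add: mps_subst_def Abs_mps_inverse mps_coeff_const_mult sum_distrib_left mult.assoc)

lemma mps_subst_sum: "finite V \<Longrightarrow> mps_subst V g (sum f A) = (\<Sum>i\<in>A. mps_subst V g (f i))"
proof (induction A rule: infinite_finite_induct)
  case empty
  then show ?case using mps_subst_minus[of V g 0 0] by simp
next
  case (infinite A)
  then show ?case using mps_subst_minus[of V g 0 0] by simp
qed (auto simp: mps_subst_add)

lemma mps_subst_cong: "(\<And>v. v \<in> V \<Longrightarrow> g v = h v) \<Longrightarrow> mps_subst V g f = mps_subst V h f"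
  using monom_eval_cong[of V g h] unfolding mps_subst_def monom_eval_def[symmetric] by simp

lemma mps_subst_var:
  assumes "finite V" "v \<in> V" "\<forall>v\<in>V. g v \<in> order_ge 1"
  shows "mps_subst V g (mps_var v) = g v"
proof (rule order_ge_eqI)
  fix s
  have "order.ev V (Suc s) g (mps_var v) = g v" using order.ev_var[OF assms(1,2), of "Suc s" g] by simp
  then show "mps_subst V g (mps_var v) - g v \<in> order_ge (Suc s)"
    using mps_subst_ev[OF assms(1,3), of "mps_var v" "Suc s"] order.E_Suc[of "Suc s"] by auto
qed

text \<open>Points that agree to first order give the same part of degree n. This allows the group
  law to be replaced by addition in lowest degree.\<close>

lemma mps_subst_diff_order:
  assumes V: "finite V" and x: "\<forall>v\<in>V. x v \<in> order_ge 1" and y: "\<forall>v\<in>V. y v \<in> order_ge 1"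
    and xy: "\<forall>v\<in>V. x v - y v \<in> order_ge 2" and f: "f \<in> order_ge n"
  shows "mps_subst V x f - mps_subst V y f \<in> order_ge (Suc n)"
proof -
  have "order.ev V n x f - order.ev V n y f \<in> order_ge (n + 1)"
    using f xy unfolding order_ge_def
    by (intro order.ev_diff[OF V x y, unfolded order_ge_def]) (auto simp: numeral_2_eq_2)
  then show ?thesis
    using mps_subst_ev[OF V x, of f n] order.E_diff_sym[OF mps_subst_ev[OF V y, of f n]]
      order.E_diff_trans by (metis Suc_eq_plus1)
qed

lemma mps_var_order: "mps_var v \<in> order_ge 1"
  unfolding order_ge_def by (auto simp: mps_coeff_var)

section \<open>Formal group laws\<close>

definition mps_mono :: "('v \<Rightarrow>\<^sub>0 nat) \<Rightarrow> ('v, 'a::comm_ring_1) mps" where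
  "mps_mono k = Abs_mps (\<lambda>m. if m = k then 1 else 0)"

lemma mps_coeff_mono: "mps_coeff (mps_mono k) m = (if m = k then 1 else 0)"
  by (simp add: mps_mono_def Abs_mps_inverse)

lemma mps_mono_add: "mps_mono (a + b) = mps_mono a * mps_mono b"
proof (rule mps_eqI)
  fix m
  have "mps_coeff (mps_mono a * mps_mono b) m
      = (\<Sum>ab\<in>{(a, b). a + b = m}. if ab = (a, b) then 1 else 0)"
    unfolding times_mps.rep_eq by (rule sum.cong) (auto simp: mps_coeff_mono split: if_splits)
  also have "\<dots> = (if (a, b) \<in> {(a, b). a + b = m} then 1 else 0)"
    by (rule sum.delta[OF finite_monom_splits])
  finally show "mps_coeff (mps_mono (a + b)) m = mps_coeff (mps_mono a * mps_mono b) m"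
    by (auto simp: mps_coeff_mono)
qed

lemma mps_var_mono: "mps_var v = mps_mono (Poly_Mapping.single v 1)"
  by (rule mps_eqI) (simp add: mps_coeff_mono mps_coeff_var)

lemma monom_eval_restrict:
  assumes "finite V" "Poly_Mapping.keys \<alpha> \<subseteq> V"
  shows "monom_eval V (\<lambda>v. if v \<in> S then mps_var v else 0) \<alpha>
    = (if Poly_Mapping.keys \<alpha> \<subseteq> S then mps_mono \<alpha> else (0 :: ('v, 'a::comm_ring_1) mps))"
  using assms(2)
proof (induction rule: monom_induct)
  case zero
  have "(1 :: ('v, 'a) mps) = mps_mono 0" by (rule mps_eqI) (simp add: mps_coeff_mono one_mps.rep_eq)
  then show ?case by simp
next
  case (Suc v \<beta>)
  have "monom_eval V (\<lambda>v. if v \<in> S then mps_var v else (0 :: ('v, 'a) mps)) (Poly_Mapping.single v 1)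
      = (if v \<in> S then mps_var v else 0)"
    unfolding monom_eval_single[OF assms(1) Suc(1)] by simp
  then show ?case
    using Suc(3) by (auto simp: monom_eval_add keys_add_nat mps_mono_add mps_var_mono)
qed

text \<open>The variables outside \<open>S\<close> are set to zero. With \<open>range Inl\<close>
  and \<open>range Inr\<close> as \<open>S\<close>, the unit axioms of \<open>F\<close> become
  statements about coefficients.\<close>

lemma mps_subst_restrict_coeff:
  assumes V: "finite V"
  shows "mps_coeff (mps_subst V (\<lambda>v. if v \<in> S then mps_var v else 0) f) m
    = (if Poly_Mapping.keys m \<subseteq> V \<inter> S then mps_coeff f m else 0)"
proof -
  let ?z = "\<lambda>v. if v \<in> S then mps_var v else 0"
  have "mps_coeff (mps_subst V ?z f) m
      = (\<Sum>\<alpha>\<in>monoms_upto V (mdeg m). mps_coeff f \<alpha> * mps_coeff (monom_eval V ?z \<alpha>) m)"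
    using mps_var_order order.E_zero[of 1] by (intro mps_subst_coeff[OF V]) auto
  also have "\<dots> = (\<Sum>\<alpha>\<in>monoms_upto V (mdeg m). if \<alpha> = m then (if Poly_Mapping.keys m \<subseteq> S then mps_coeff f m else 0) else 0)"
    by (rule sum.cong) (auto simp: monom_eval_restrict[OF V] mps_coeff_mono zero_mps.rep_eq)
  also have "\<dots> = (if m \<in> monoms_upto V (mdeg m) then (if Poly_Mapping.keys m \<subseteq> S then mps_coeff f m else 0) else 0)"
    using V by (intro sum.delta) simp
  finally show ?thesis by auto
qed

lemma finite_xy_vars [simp]: "finite (xy_vars d)"
  by (simp add: xy_vars_def)

lemma xy_vars_iff [simp]: "Inl j \<in> xy_vars d \<longleftrightarrow> j < d" "Inr j \<in> xy_vars d \<longleftrightarrow> j < d"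
  by (auto simp: xy_vars_def)

lemma all_xy_vars: "(\<And>j. j < d \<Longrightarrow> P (Inl j)) \<Longrightarrow> (\<And>j. j < d \<Longrightarrow> P (Inr j)) \<Longrightarrow> v \<in> xy_vars d \<Longrightarrow> P v"
  by (auto simp: xy_vars_def)

text \<open>A point of the formal group with coordinates in a ring of power series.\<close>

abbreviation is_point :: "nat \<Rightarrow> (nat \<Rightarrow> ('w, 'a::comm_ring_1) mps) \<Rightarrow> bool" where
  "is_point d P \<equiv> \<forall>j<d. P j \<in> order_ge 1"

lemma is_point_case_sum:
  "is_point d P \<Longrightarrow> is_point d Q \<Longrightarrow> \<forall>v\<in>xy_vars d. case_sum P Q v \<in> order_ge 1"
  by (auto simp: xy_vars_def)

lemma fgl_subst_cong:
  "(\<And>j. j < d \<Longrightarrow> P j = P' j) \<Longrightarrow> (\<And>j. j < d \<Longrightarrow> Q j = Q' j) \<Longrightarrow> fgl_subst d f P Q = fgl_subst d f P' Q'"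
  unfolding fgl_subst_def by (rule mps_subst_cong) (auto simp: xy_vars_def)

lemma fgl_subst_order: "is_point d P \<Longrightarrow> is_point d Q \<Longrightarrow> f \<in> order_ge n \<Longrightarrow> fgl_subst d f P Q \<in> order_ge n"
  unfolding fgl_subst_def by (rule mps_subst_order[OF finite_xy_vars is_point_case_sum])

lemma mps_subst_fgl_subst:
  assumes "finite W" "is_point d P" "is_point d Q" "\<forall>w\<in>W. h w \<in> order_ge 1"
  shows "mps_subst W h (fgl_subst d f P Q) = fgl_subst d f (\<lambda>j. mps_subst W h (P j)) (\<lambda>j. mps_subst W h (Q j))"
proof -
  have "mps_subst W h (fgl_subst d f P Q) = mps_subst (xy_vars d) (\<lambda>v. mps_subst W h (case_sum P Q v)) f"
    unfolding fgl_subst_def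
    by (rule mps_subst_subst[OF finite_xy_vars assms(1) is_point_case_sum[OF assms(2,3)] assms(4)])
  also have "\<dots> = fgl_subst d f (\<lambda>j. mps_subst W h (P j)) (\<lambda>j. mps_subst W h (Q j))"
    unfolding fgl_subst_def by (rule mps_subst_cong) (auto simp: xy_vars_def)
  finally show ?thesis .
qed

abbreviation mix :: "nat \<Rightarrow> nat \<Rightarrow> (nat + nat \<Rightarrow>\<^sub>0 nat)" where
  "mix j k \<equiv> Poly_Mapping.single (Inl j) 1 + Poly_Mapping.single (Inr k) 1"

lemma mix_inj: "mix j k = mix j' k' \<Longrightarrow> j = j' \<and> k = k'"
proof -
  assume eq: "mix j k = mix j' k'"
  have "Poly_Mapping.lookup (mix j k) (Inl j) = Poly_Mapping.lookup (mix j' k') (Inl j)"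
    "Poly_Mapping.lookup (mix j k) (Inr k) = Poly_Mapping.lookup (mix j' k') (Inr k)"
    using eq by simp_all
  then show ?thesis by (simp add: lookup_add lookup_single when_def split: if_splits)
qed

lemma sum_mixed:
  fixes f :: "(nat + nat \<Rightarrow>\<^sub>0 nat) \<Rightarrow> 'a::comm_ring_1"
  assumes "finite A" "\<And>j k. j < d \<Longrightarrow> k < d \<Longrightarrow> mix j k \<in> A"
    and "\<And>\<alpha>. \<alpha> \<in> A \<Longrightarrow> f \<alpha> \<noteq> 0 \<Longrightarrow> \<exists>j<d. \<exists>k<d. \<alpha> = mix j k"
  shows "sum f A = (\<Sum>j<d. \<Sum>k<d. f (mix j k))"
proof -
  have "sum f A = sum f ((\<lambda>(j, k). mix j k) ` ({..<d} \<times> {..<d}))"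
    using assms by (intro sum.mono_neutral_right) fastforce+
  also have "\<dots> = (\<Sum>jk\<in>{..<d} \<times> {..<d}. f (mix (fst jk) (snd jk)))"
  proof -
    have "inj_on (\<lambda>(j, k). mix j k) ({..<d} \<times> {..<d})"
    proof (rule inj_onI)
      fix u v assume "(case u of (j, k) \<Rightarrow> mix j k) = (case v of (j, k) \<Rightarrow> mix j k)"
      then have "mix (fst u) (snd u) = mix (fst v) (snd v)" by (simp only: case_prod_unfold)
      from mix_inj[OF this] show "u = v" by (simp add: prod_eq_iff)
    qed
    then show ?thesis by (subst sum.reindex) (auto simp: case_prod_unfold)
  qed
  finally show ?thesis by (simp add: sum.cartesian_product case_prod_unfold)
qed

locale fgl =
  fixes d :: nat and F :: "nat \<Rightarrow> (nat + nat, 'a::comm_ring_1) mps"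
  assumes fgl: "formal_group_law d F"
begin

abbreviation FF :: "(nat \<Rightarrow> ('w, 'a) mps) \<Rightarrow> (nat \<Rightarrow> ('w, 'a) mps) \<Rightarrow> nat \<Rightarrow> ('w, 'a) mps" where
  "FF P Q \<equiv> \<lambda>i. fgl_subst d (F i) P Q"

abbreviation xvar :: "nat \<Rightarrow> (nat + nat, 'a) mps" where "xvar \<equiv> \<lambda>j. mps_var (Inl j)"
abbreviation yvar :: "nat \<Rightarrow> (nat + nat, 'a) mps" where "yvar \<equiv> \<lambda>j. mps_var (Inr j)"

text \<open>The axiom F(x, 0) = x is stated in variables of type \<open>nat\<close>. Substituting
  \<open>xvar\<close> carries it to the variables of \<open>F\<close>, where it fixes the
  coefficients of all monomials in the x_j alone.\<close>

lemma coeff_left: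
  assumes i: "i < d" and m: "Poly_Mapping.keys m \<subseteq> range Inl"
  shows "mps_coeff (F i) m = (if m = Poly_Mapping.single (Inl i) 1 then 1 else 0)"
proof (cases "Poly_Mapping.keys m \<subseteq> xy_vars d")
  case True
  have "mps_subst {..<d} xvar (fgl_subst d (F i) mps_var (\<lambda>_. 0)) = mps_subst {..<d} xvar (mps_var i :: (nat, 'a) mps)"
    using fgl i unfolding formal_group_law_def by simp
  also have "\<dots> = mps_var (Inl i)"
    using i mps_var_order by (intro mps_subst_var) auto
  also have "mps_subst {..<d} xvar (fgl_subst d (F i) mps_var (\<lambda>_. 0))
      = fgl_subst d (F i) (\<lambda>j. mps_subst {..<d} xvar (mps_var j)) (\<lambda>j. mps_subst {..<d} xvar 0)"
    by (intro mps_subst_fgl_subst ballI allI impI mps_var_order order.E_zero) simp_all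
  also have "\<dots> = mps_subst (xy_vars d) (\<lambda>v. if v \<in> range Inl then mps_var v else 0) (F i)"
    unfolding fgl_subst_def
  proof (rule mps_subst_cong, erule all_xy_vars[rotated -1])
    fix j assume "j < d"
    then have "mps_subst {..<d} xvar (mps_var j) = xvar j" using mps_var_order by (intro mps_subst_var) auto
    then show "case_sum (\<lambda>j. mps_subst {..<d} xvar (mps_var j)) (\<lambda>j. mps_subst {..<d} xvar 0) (Inl j)
        = (if Inl j \<in> range Inl then mps_var (Inl j) else 0)" by simp
  next
    fix j
    have "mps_subst {..<d} xvar 0 = 0" using mps_subst_minus[of "{..<d}" xvar 0 0] by simp
    then show "case_sum (\<lambda>j. mps_subst {..<d} xvar (mps_var j)) (\<lambda>j. mps_subst {..<d} xvar 0) (Inr j)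
        = (if Inr j \<in> range Inl then mps_var (Inr j) else 0)" by auto
  qed
  finally have "mps_coeff (mps_subst (xy_vars d) (\<lambda>v. if v \<in> range Inl then mps_var v else 0) (F i)) m
      = mps_coeff (mps_var (Inl i)) m" by simp
  then show ?thesis using True m by (simp add: mps_subst_restrict_coeff mps_coeff_var)
next
  case False
  then have "mps_coeff (F i) m = 0" using fgl i unfolding formal_group_law_def mps_vars_in_def by blast
  then show ?thesis using False i by auto
qed

lemma coeff_right:
  assumes i: "i < d" and m: "Poly_Mapping.keys m \<subseteq> range Inr"
  shows "mps_coeff (F i) m = (if m = Poly_Mapping.single (Inr i) 1 then 1 else 0)"
proof (cases "Poly_Mapping.keys m \<subseteq> xy_vars d")
  case True
  have "mps_subst {..<d} yvar (fgl_subst d (F i) (\<lambda>_. 0) mps_var) = mps_subst {..<d} yvar (mps_var i :: (nat, 'a) mps)"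
    using fgl i unfolding formal_group_law_def by simp
  also have "\<dots> = mps_var (Inr i)"
    using i mps_var_order by (intro mps_subst_var) auto
  also have "mps_subst {..<d} yvar (fgl_subst d (F i) (\<lambda>_. 0) mps_var)
      = fgl_subst d (F i) (\<lambda>j. mps_subst {..<d} yvar 0) (\<lambda>j. mps_subst {..<d} yvar (mps_var j))"
    by (intro mps_subst_fgl_subst ballI allI impI mps_var_order order.E_zero) simp_all
  also have "\<dots> = mps_subst (xy_vars d) (\<lambda>v. if v \<in> range Inr then mps_var v else 0) (F i)"
    unfolding fgl_subst_def
  proof (rule mps_subst_cong, erule all_xy_vars[rotated -1])
    fix j assume "j < d"
    then have "mps_subst {..<d} yvar (mps_var j) = yvar j" using mps_var_order by (intro mps_subst_var) auto
    then show "case_sum (\<lambda>j. mps_subst {..<d} yvar 0) (\<lambda>j. mps_subst {..<d} yvar (mps_var j)) (Inr j)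
        = (if Inr j \<in> range Inr then mps_var (Inr j) else 0)" by simp
  next
    fix j
    have "mps_subst {..<d} yvar 0 = 0" using mps_subst_minus[of "{..<d}" yvar 0 0] by simp
    then show "case_sum (\<lambda>j. mps_subst {..<d} yvar 0) (\<lambda>j. mps_subst {..<d} yvar (mps_var j)) (Inl j)
        = (if Inl j \<in> range Inr then mps_var (Inl j) else 0)" by auto
  qed
  finally have "mps_coeff (mps_subst (xy_vars d) (\<lambda>v. if v \<in> range Inr then mps_var v else 0) (F i)) m
      = mps_coeff (mps_var (Inr i)) m" by simp
  then show ?thesis using True m by (simp add: mps_subst_restrict_coeff mps_coeff_var)
next
  case False
  then have "mps_coeff (F i) m = 0" using fgl i unfolding formal_group_law_def mps_vars_in_def by blast
  then show ?thesis using False i by auto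
qed

text \<open>The unit axioms exclude the monomials x_j x_k and y_j y_k, so the quadratic part of
  \<open>F\<close> is bilinear.\<close>

lemma coeff_quadratic:
  assumes i: "i < d" and m: "mdeg m = 2" "mps_coeff (F i) m \<noteq> 0"
  shows "\<exists>j<d. \<exists>k<d. m = mix j k"
proof -
  have xy: "Poly_Mapping.keys m \<subseteq> xy_vars d"
    using fgl i m(2) unfolding formal_group_law_def mps_vars_in_def by blast
  have "mdeg m = Suc 1" using m(1) by simp
  from monom_decompose[OF xy this] obtain v \<beta> where v: "v \<in> xy_vars d" "Poly_Mapping.keys \<beta> \<subseteq> xy_vars d"
    "mdeg \<beta> = Suc 0" "m = Poly_Mapping.single v 1 + \<beta>" by auto
  from monom_decompose[OF v(2,3)] obtain w where w: "w \<in> xy_vars d" "\<beta> = Poly_Mapping.single w 1"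
    by (auto simp: mdeg_eq_0_iff)
  have m': "m = Poly_Mapping.single v 1 + Poly_Mapping.single w 1" using v w by simp
  have ne: "m \<noteq> Poly_Mapping.single u 1" for u using m(1) by auto
  show ?thesis
  proof (cases v; cases w)
    fix j k assume "v = Inl j" "w = Inl k"
    then have "Poly_Mapping.keys m \<subseteq> range Inl" by (simp add: m' keys_add_nat)
    then show ?thesis using coeff_left[OF i] m(2) ne by auto
  next
    fix j k assume "v = Inr j" "w = Inr k"
    then have "Poly_Mapping.keys m \<subseteq> range Inr" by (simp add: m' keys_add_nat)
    then show ?thesis using coeff_right[OF i] m(2) ne by auto
  next
    fix j k assume "v = Inl j" "w = Inr k"
    then show ?thesis using m' v(1) w(1) by auto
  next
    fix j k assume "v = Inr j" "w = Inl k"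
    then show ?thesis using m' v(1) w(1) by (auto simp: add.commute)
  qed
qed

definition F_high :: "nat \<Rightarrow> (nat + nat, 'a) mps" where
  "F_high i = F i - mps_var (Inl i) - mps_var (Inr i)"

lemma F_high_order:
  assumes i: "i < d"
  shows "F_high i \<in> order_ge 2"
  unfolding order_ge_def mem_Collect_eq
proof (intro allI impI)
  fix m :: "nat + nat \<Rightarrow>\<^sub>0 nat" assume "mdeg m < 2"
  then consider "mdeg m = 0" | "mdeg m = Suc 0" by linarith
  then show "mps_coeff (F_high i) m = 0"
  proof cases
    case 1
    then have m: "m = 0" using mdeg_eq_0_iff by blast
    have "Poly_Mapping.single v (1::nat) \<noteq> 0" for v :: "nat + nat" by (metis mdeg_0 mdeg_single zero_neq_one)
    then show ?thesis
      using coeff_left[OF i, of 0] by (simp add: m F_high_def minus_mps.rep_eq mps_coeff_var eq_commute[of 0])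
  next
    case 2
    from monom_decompose[OF subset_UNIV this] obtain v where m: "m = Poly_Mapping.single v 1"
      by (auto simp: mdeg_eq_0_iff)
    have "Poly_Mapping.single a (1::nat) = Poly_Mapping.single b 1 \<longleftrightarrow> a = b" for a b :: "nat + nat"
      by (metis lookup_single_eq lookup_single_not_eq zero_neq_one)
    note sg = this[unfolded One_nat_def]
    show ?thesis
      using coeff_left[OF i, of m] coeff_right[OF i, of m]
      by (cases v) (auto simp: m F_high_def minus_mps.rep_eq mps_coeff_var sg)
  qed
qed

lemma F_order: "i < d \<Longrightarrow> F i \<in> order_ge 1"
proof -
  assume i: "i < d"
  have "F_high i \<in> order_ge 1" using F_high_order[OF i] order.E_antimono[of 1 2] by simp
  then have "F_high i + (mps_var (Inl i) + mps_var (Inr i)) \<in> order_ge 1"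
    using mps_var_order by (intro order.E_add)
  then show ?thesis by (simp add: F_high_def)
qed

lemma FF_order: "is_point d P \<Longrightarrow> is_point d Q \<Longrightarrow> is_point d (FF P Q)"
  using fgl_subst_order F_order by blast

lemma FF_high:
  assumes "is_point d P" "is_point d Q" "i < d"
  shows "fgl_subst d (F_high i) P Q = FF P Q i - (P i + Q i)"
  unfolding F_high_def fgl_subst_def
  by (simp add: mps_subst_minus mps_subst_var[OF finite_xy_vars _ is_point_case_sum[OF assms(1,2)]] assms(3))

lemma FF_linear:
  assumes "is_point d P" "is_point d Q" "i < d"
  shows "FF P Q i - (P i + Q i) \<in> order_ge 2"
  using fgl_subst_order[OF assms(1,2) F_high_order[OF assms(3)]] FF_high[OF assms] by simp

lemma FF_assoc:
  assumes P: "is_point d P" and Q: "is_point d Q" and S: "is_point d S" and i: "i < d"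
  shows "FF (FF P Q) S i = FF P (FF Q S) i"
proof -
  let ?W = "{..<d} <+> ({..<d} <+> {..<d})"
  let ?h = "case_sum P (case_sum Q S)"
  let ?x = "\<lambda>j. mps_var (Inl j) :: (nat + nat + nat, 'a) mps"
  let ?y = "\<lambda>j. mps_var (Inr (Inl j)) :: (nat + nat + nat, 'a) mps"
  let ?z = "\<lambda>j. mps_var (Inr (Inr j)) :: (nat + nat + nat, 'a) mps"
  have h: "\<forall>w\<in>?W. ?h w \<in> order_ge 1" using P Q S by auto
  have W: "finite ?W" by simp
  have pt: "is_point d ?x" "is_point d ?y" "is_point d ?z" using mps_var_order by auto
  have sub: "mps_subst ?W ?h (?x j) = P j" "mps_subst ?W ?h (?y j) = Q j" "mps_subst ?W ?h (?z j) = S j"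
    if "j < d" for j
    using that by (subst mps_subst_var[OF W _ h]; auto)+
  have "FF (FF ?x ?y) ?z i = FF ?x (FF ?y ?z) i"
    using fgl i unfolding formal_group_law_def Let_def by blast
  then have "mps_subst ?W ?h (FF (FF ?x ?y) ?z i) = mps_subst ?W ?h (FF ?x (FF ?y ?z) i)" by simp
  moreover have "mps_subst ?W ?h (FF (FF ?x ?y) ?z i) = FF (FF P Q) S i"
    using mps_subst_fgl_subst[OF W FF_order[OF pt(1,2)] pt(3) h, of "F i"]
      mps_subst_fgl_subst[OF W pt(1,2) h]
    by (simp add: sub cong: fgl_subst_cong)
  moreover have "mps_subst ?W ?h (FF ?x (FF ?y ?z) i) = FF P (FF Q S) i"
    using mps_subst_fgl_subst[OF W pt(1) FF_order[OF pt(2,3)] h, of "F i"]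
      mps_subst_fgl_subst[OF W pt(2,3) h]
    by (simp add: sub cong: fgl_subst_cong)
  ultimately show ?thesis by simp
qed

text \<open>Evaluating the formal associative law at three points costs only the truncation error; s
  \<ge> 1 makes the evaluation of single variables exact. This serves both the group G and the power
  series argument for the Jacobi identity.\<close>

lemma ev_assoc:
  assumes alg: "filtered_algebra E \<phi>"
    and x: "\<forall>j<d. x j \<in> E 1" and y: "\<forall>j<d. y j \<in> E 1" and z: "\<forall>j<d. z j \<in> E 1"
    and s: "s \<ge> 1" and i: "i < d"
  defines "N \<equiv> \<lambda>x y i. filtered_algebra.ev \<phi> (xy_vars d) s (case_sum x y) (F i)"
  shows "N (N x y) z i - N x (N y z) i \<in> E (Suc s)"
proof -
  interpret f: filtered_algebra E \<phi> by (rule alg)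
  let ?W = "{..<d} <+> ({..<d} <+> {..<d})" and ?h = "case_sum x (case_sum y z)"
  let ?e = "\<lambda>P j. f.ev ?W s ?h (P j)"
  let ?x = "\<lambda>j. mps_var (Inl j) :: (nat + nat + nat, 'a) mps"
  let ?y = "\<lambda>j. mps_var (Inr (Inl j)) :: (nat + nat + nat, 'a) mps"
  let ?z = "\<lambda>j. mps_var (Inr (Inr j)) :: (nat + nat + nat, 'a) mps"
  have W: "finite ?W" and h: "\<forall>w\<in>?W. ?h w \<in> E 1" using x y z by auto
  have pt: "is_point d ?x" "is_point d ?y" "is_point d ?z" using mps_var_order by auto
  have var: "?e ?x j = x j" "?e ?y j = y j" "?e ?z j = z j" if "j < d" for j
    using that f.ev_var[OF W _ s, of "Inl j" ?h] f.ev_var[OF W _ s, of "Inr (Inl j)" ?h]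
      f.ev_var[OF W _ s, of "Inr (Inr j)" ?h] by auto
  have N_level: "\<forall>j<d. N x' y' j \<in> E 1" if "\<forall>j<d. x' j \<in> E 1" "\<forall>j<d. y' j \<in> E 1" for x' y'
  proof (intro allI impI)
    fix j assume "j < d"
    have "\<forall>v\<in>xy_vars d. case_sum x' y' v \<in> E 1" using that by (auto simp: xy_vars_def)
    then show "N x' y' j \<in> E 1"
      unfolding N_def using F_order[OF \<open>j < d\<close>]
      by (intro f.ev_order[OF finite_xy_vars]) (auto simp: order_ge_def)
  qed
  have main: "?e (FF P Q) j - N x' y' j \<in> E (Suc s)"
    if P: "is_point d P" and Q: "is_point d Q" and "\<forall>j<d. x' j \<in> E 1" "\<forall>j<d. y' j \<in> E 1"
      and "\<And>j. j < d \<Longrightarrow> ?e P j - x' j \<in> E (Suc s)" "\<And>j. j < d \<Longrightarrow> ?e Q j - y' j \<in> E (Suc s)"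
    for P Q :: "nat \<Rightarrow> (nat + nat + nat, 'a) mps" and x' y' j
  proof -
    let ?u = "\<lambda>v. f.ev ?W s ?h (case_sum P Q v)"
    have "?u v \<in> E 1" if "v \<in> xy_vars d" for v
      using is_point_case_sum[OF P Q] that unfolding order_ge_def by (intro f.ev_order[OF W h]) auto
    moreover have "\<forall>v\<in>xy_vars d. case_sum x' y' v \<in> E 1" using that(3,4) by (auto simp: xy_vars_def)
    moreover have "\<forall>v\<in>xy_vars d. ?u v - case_sum x' y' v \<in> E (Suc s)" using that(5,6) by (auto simp: xy_vars_def)
    ultimately have "f.ev (xy_vars d) s ?u (F j) - N x' y' j \<in> E (Suc s)"
      unfolding N_def by (intro f.ev_point_cong) auto
    moreover have "?e (FF P Q) j - f.ev (xy_vars d) s ?u (F j) \<in> E (Suc s)"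
      unfolding fgl_subst_def by (rule f.ev_subst[OF finite_xy_vars W is_point_case_sum[OF P Q] h])
    ultimately show ?thesis using f.E_diff_trans by blast
  qed
  have v0: "?e ?x j - x j \<in> E (Suc s)" "?e ?y j - y j \<in> E (Suc s)" "?e ?z j - z j \<in> E (Suc s)" if "j < d" for j
    using var[OF that] f.E_zero by simp_all
  have xy: "?e (FF ?x ?y) j - N x y j \<in> E (Suc s)" for j
    by (rule main[of ?x ?y x y, OF pt(1,2) x y v0(1,2)])
  have yz: "?e (FF ?y ?z) j - N y z j \<in> E (Suc s)" for j
    by (rule main[of ?y ?z y z, OF pt(2,3) y z v0(2,3)])
  have "?e (FF (FF ?x ?y) ?z) i - N (N x y) z i \<in> E (Suc s)"
    by (rule main[of "FF ?x ?y" ?z "N x y" z,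
        OF FF_order[OF pt(1,2)] pt(3) N_level[OF x y] z xy v0(3)])
  moreover have "?e (FF ?x (FF ?y ?z)) i - N x (N y z) i \<in> E (Suc s)"
    by (rule main[of ?x "FF ?y ?z" x "N y z",
        OF pt(1) FF_order[OF pt(2,3)] x N_level[OF y z] v0(1) yz])
  moreover have "?e (FF (FF ?x ?y) ?z) i = ?e (FF ?x (FF ?y ?z)) i"
    by (simp only: FF_assoc[OF pt i])
  ultimately have "?e (FF ?x (FF ?y ?z)) i - N (N x y) z i \<in> E (Suc s)"
    "?e (FF ?x (FF ?y ?z)) i - N x (N y z) i \<in> E (Suc s)" by simp_all
  then show ?thesis using f.E_diff_trans[OF f.E_diff_sym] by blast
qed

end

section \<open>Truncated logarithms\<close>

text \<open>A symmetric cocycle defines a commutative extension with (P, a)(Q, b) = (P + Q, a + b +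
  c(P, Q)), in which the n-th power of (P, 0) has second coordinate the sum of the c(i P, P) for 0 <
  i < n. The identity says that the n-th power map is a homomorphism there.\<close>

lemma symmetric_cocycle_multiple:
  fixes c :: "'g::comm_ring_1 \<Rightarrow> 'g \<Rightarrow> 'r::comm_ring_1"
  assumes T: "\<And>P Q. P \<in> T \<Longrightarrow> Q \<in> T \<Longrightarrow> P + Q \<in> T"
    and coc: "\<And>P Q S. P \<in> T \<Longrightarrow> Q \<in> T \<Longrightarrow> S \<in> T \<Longrightarrow> c P Q + c (P + Q) S = c P (Q + S) + c Q S"
    and sym: "\<And>P Q. P \<in> T \<Longrightarrow> Q \<in> T \<Longrightarrow> c P Q = c Q P"
    and P: "P \<in> T" and Q: "Q \<in> T" and "n \<ge> 1"
  shows "of_nat n * c P Q + (\<Sum>i=1..<n. c (of_nat i * (P + Q)) (P + Q))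
    = (\<Sum>i=1..<n. c (of_nat i * P) P) + (\<Sum>i=1..<n. c (of_nat i * Q) Q) + c (of_nat n * P) (of_nat n * Q)"
  using \<open>n \<ge> 1\<close>
proof (induction n rule: nat_induct_at_least)
  case base
  then show ?case by simp
next
  case (Suc n)
  have mT: "of_nat i * S \<in> T" if "S \<in> T" "i \<ge> 1" for i S
    using that(2) by (induction i rule: nat_induct_at_least) (use T that(1) in \<open>auto simp: distrib_right\<close>)
  define a b where "a = of_nat n * P" and "b = of_nat n * Q"
  have ab: "a \<in> T" "b \<in> T" unfolding a_def b_def using mT P Q Suc.hyps by auto
  have "c a b + c (a + b) (P + Q) + c P Q = c a (b + (P + Q)) + (c b P + c (b + P) Q)"
    unfolding coc[OF ab T[OF P Q]] coc[OF ab(2) P Q] by (simp only: add.assoc)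
  also have "\<dots> = c a (P + (b + Q)) + (c P b + c (P + b) Q)"
    by (simp only: sym[OF ab(2) P] add.commute[of b P] add.left_commute[of b P Q])
  also have "\<dots> = (c a (P + (b + Q)) + c P (b + Q)) + c b Q"
    unfolding coc[OF P ab(2) Q] by (simp only: add.assoc)
  also have "\<dots> = c a P + c (a + P) (b + Q) + c b Q"
    unfolding coc[OF ab(1) P T[OF ab(2) Q]] ..
  finally have "c a b + c (a + b) (P + Q) + c P Q = c a P + c b Q + c (a + P) (b + Q)"
    by (simp only: add_ac)
  moreover have "of_nat n * (P + Q) = a + b" "of_nat (Suc n) * P = a + P" "of_nat (Suc n) * Q = b + Q"
    unfolding a_def b_def by (simp_all add: algebra_simps)
  moreover have "{1..<Suc n} = insert n {1..<n}" using Suc.hyps by auto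
  ultimately show ?case using Suc.IH by (simp add: a_def[symmetric] b_def[symmetric] algebra_simps)
qed

text \<open>The difference c(P, Q) - c(Q, P) is the commutator pairing of the extension defined by
  \<open>c\<close>. It is biadditive, which gives the square.\<close>

lemma cocycle_antisymmetrization:
  fixes c :: "'g::comm_ring_1 \<Rightarrow> 'g \<Rightarrow> 'r::comm_ring_1"
  assumes T: "\<And>P Q. P \<in> T \<Longrightarrow> Q \<in> T \<Longrightarrow> P + Q \<in> T"
    and coc: "\<And>P Q S. P \<in> T \<Longrightarrow> Q \<in> T \<Longrightarrow> S \<in> T \<Longrightarrow> c P Q + c (P + Q) S = c P (Q + S) + c Q S"
    and P: "P \<in> T" and Q: "Q \<in> T" and n: "n \<ge> 1"
  shows "c (of_nat n * P) (of_nat n * Q) - c (of_nat n * Q) (of_nat n * P) = of_nat n ^ 2 * (c P Q - c Q P)"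
proof -
  define k where "k P Q = c P Q - c Q P" for P Q
  have mT: "of_nat i * S \<in> T" if "S \<in> T" "i \<ge> 1" for i S
    using that(2) by (induction i rule: nat_induct_at_least) (use T that(1) in \<open>auto simp: distrib_right\<close>)
  have add: "k P (Q + S) = k P Q + k P S" if "P \<in> T" "Q \<in> T" "S \<in> T" for P Q S
  proof -
    have "c P (Q + S) = c P Q + c (P + Q) S - c Q S"
      unfolding coc[OF that] by simp
    moreover have "c (Q + S) P = c Q (P + S) + c S P - c Q S"
      unfolding add.commute[of P S] coc[OF that(2,3,1), symmetric] by simp
    moreover have "c (P + Q) S = c Q (P + S) + c P S - c Q P"
      unfolding add.commute[of P Q] coc[OF that(2,1,3), symmetric] by simp
    ultimately show ?thesis unfolding k_def by simp
  qed
  have anti: "k P Q = - k Q P" for P Q unfolding k_def by simp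
  have right: "k P (of_nat n * Q) = of_nat n * k P Q" if "P \<in> T" "Q \<in> T" for P Q
    using n
  proof (induction n rule: nat_induct_at_least)
    case (Suc n)
    then show ?case using add[OF that(1) mT[OF that(2)] that(2), of n] by (simp add: algebra_simps)
  qed simp
  have "k (of_nat n * P) (of_nat n * Q) = of_nat n * (of_nat n * k P Q)"
    using right[OF mT[OF P n] Q] right[OF Q P] anti[of "of_nat n * P" Q] anti[of P Q] by simp
  then show ?thesis unfolding k_def by (simp add: power2_eq_square mult.assoc)
qed

lemma mps_const_of_nat: "mps_const (of_nat n) = of_nat n"
  by (induction n) (auto simp: order.\<phi>_0 order.\<phi>_add order.\<phi>_1)

lemma mps_const_order: "f \<in> order_ge n \<Longrightarrow> mps_const c * f \<in> order_ge n"
  by (rule order.E_mult_left)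

text \<open>Since \<open>f\<close> has order at least \<open>n\<close>, coefficients in degrees up
  to \<open>n\<close> come only from its homogeneous part of degree \<open>n\<close>.\<close>

lemma mps_subst_homogeneous:
  assumes V: "finite V" and z: "\<forall>v\<in>V. z v \<in> order_ge 1" and f: "f \<in> order_ge n" and m: "mdeg m \<le> n"
  shows "mps_coeff (mps_subst V (\<lambda>v. mps_const c * z v) f) m = c ^ n * mps_coeff (mps_subst V z f) m"
proof -
  have "mps_coeff f \<alpha> * mps_coeff (monom_eval V (\<lambda>v. mps_const c * z v) \<alpha>) m
      = c ^ n * (mps_coeff f \<alpha> * mps_coeff (monom_eval V z \<alpha>) m)" if \<alpha>: "\<alpha> \<in> monoms_upto V n" for \<alpha>
  proof (cases "mdeg \<alpha> = n")
    case True
    have "monom_eval V (\<lambda>v. mps_const c * z v) \<alpha> = mps_const (c ^ mdeg \<alpha>) * monom_eval V z \<alpha>"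
      if "Poly_Mapping.keys \<alpha> \<subseteq> V" for \<alpha>
      using that
    proof (induction rule: monom_induct)
      case zero
      then show ?case by (simp add: order.\<phi>_1)
    next
      case (Suc v \<beta>)
      then show ?case
        by (simp add: monom_eval_single[OF V Suc(1)] monom_eval_add mdeg_add order.\<phi>_mult algebra_simps)
    qed
    then show ?thesis using True \<alpha> by (simp add: mps_coeff_const_mult)
  next
    case False
    then have "mps_coeff f \<alpha> = 0" using \<alpha> f unfolding order_ge_def by simp
    then show ?thesis by simp
  qed
  moreover have "\<forall>v\<in>V. mps_const c * z v \<in> order_ge 1" using z by (auto intro: mps_const_order)
  ultimately show ?thesis
    unfolding sum_distrib_left mps_subst_coeff[OF V z m]
    by (subst mps_subst_coeff[OF V _ m]) (auto intro: sum.cong)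
qed

section \<open>The defect of a series as a cocycle\<close>

context fgl
begin

abbreviation subst1 :: "(nat \<Rightarrow> ('w, 'a) mps) \<Rightarrow> (nat, 'a) mps \<Rightarrow> ('w, 'a) mps" where
  "subst1 P g \<equiv> mps_subst {..<d} P g"

definition defect :: "(nat, 'a) mps \<Rightarrow> (nat + nat, 'a) mps" where
  "defect g = subst1 (FF xvar yvar) g - subst1 xvar g - subst1 yvar g"

lemma FF_XY:
  assumes i: "i < d"
  shows "FF xvar yvar i = F i"
proof (rule mps_eqI)
  fix m
  have "FF xvar yvar i = mps_subst (xy_vars d) (\<lambda>v. if v \<in> UNIV then mps_var v else 0) (F i)"
    unfolding fgl_subst_def by (rule mps_subst_cong) (auto simp: xy_vars_def)
  then have "mps_coeff (FF xvar yvar i) m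
      = (if Poly_Mapping.keys m \<subseteq> xy_vars d \<inter> UNIV then mps_coeff (F i) m else 0)"
    by (simp only: mps_subst_restrict_coeff[OF finite_xy_vars])
  then show "mps_coeff (FF xvar yvar i) m = mps_coeff (F i) m"
    using fgl i unfolding formal_group_law_def mps_vars_in_def by auto
qed

lemma is_point_XY: "is_point d xvar" "is_point d yvar"
  using mps_var_order by auto

lemma subst1_subst1:
  assumes "finite W" "is_point d P" "\<forall>w\<in>W. h w \<in> order_ge 1"
  shows "mps_subst W h (subst1 P g) = subst1 (\<lambda>j. mps_subst W h (P j)) g"
  using assms by (intro mps_subst_subst) auto

lemma defect_subst:
  assumes P: "is_point d P" and Q: "is_point d Q"
  shows "fgl_subst d (defect g) P Q = subst1 (FF P Q) g - subst1 P g - subst1 Q g"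
proof -
  let ?W = "xy_vars d" and ?h = "case_sum P Q"
  have h: "\<forall>w\<in>?W. ?h w \<in> order_ge 1" using is_point_case_sum[OF P Q] .
  have XY: "mps_subst ?W ?h (xvar j) = P j" "mps_subst ?W ?h (yvar j) = Q j" if "j < d" for j
    using that by (subst mps_subst_var[OF finite_xy_vars _ h]; simp)+
  have "mps_subst ?W ?h (subst1 (FF xvar yvar) g) = subst1 (FF P Q) g"
    using FF_order[OF is_point_XY] mps_subst_fgl_subst[OF finite_xy_vars is_point_XY h]
    by (subst subst1_subst1[OF finite_xy_vars _ h]) (auto intro!: mps_subst_cong fgl_subst_cong simp: XY)
  moreover have "mps_subst ?W ?h (subst1 xvar g) = subst1 P g" "mps_subst ?W ?h (subst1 yvar g) = subst1 Q g"
    by (subst subst1_subst1[OF finite_xy_vars _ h]; use is_point_XY in \<open>auto intro!: mps_subst_cong simp: XY\<close>)+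
  moreover have "fgl_subst d (defect g) P Q = mps_subst ?W ?h (defect g)" by (rule fgl_subst_def)
  ultimately show ?thesis by (simp only: defect_def mps_subst_minus[OF finite_xy_vars])
qed

lemma defect_XY: "fgl_subst d (defect g) xvar yvar = defect g"
  using defect_subst[OF is_point_XY] by (simp add: defect_def)

lemma defect_linear: "defect (mps_const a * g + mps_const b * h) = mps_const a * defect g + mps_const b * defect h"
  by (simp only: defect_def mps_subst_add[OF finite_lessThan] mps_subst_const_mult) (simp add: algebra_simps)

lemma is_point_add: "is_point d P \<Longrightarrow> is_point d Q \<Longrightarrow> is_point d (P + Q)"
  by (simp add: plus_fun_def order.E_add)

lemma is_point_of_nat: "is_point d P \<Longrightarrow> is_point d (of_nat i * P)"
  by (auto simp: times_fun_def of_nat_fun intro: order.E_mult_left)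

lemma defect_FF_approx:
  assumes P: "is_point d P" and Q: "is_point d Q" and S: "is_point d S" and D: "f \<in> order_ge n"
  shows "fgl_subst d f (FF P Q) S - fgl_subst d f (P + Q) S \<in> order_ge (Suc n)"
    "fgl_subst d f S (FF P Q) - fgl_subst d f S (P + Q) \<in> order_ge (Suc n)"
proof -
  have lin: "FF P Q j - (P + Q) j \<in> order_ge 2" if "j < d" for j
    using FF_linear[OF P Q that] by (simp add: plus_fun_def)
  note pts = is_point_case_sum[OF FF_order[OF P Q] S] is_point_case_sum[OF is_point_add[OF P Q] S]
    is_point_case_sum[OF S FF_order[OF P Q]] is_point_case_sum[OF S is_point_add[OF P Q]]
  show "fgl_subst d f (FF P Q) S - fgl_subst d f (P + Q) S \<in> order_ge (Suc n)"
    unfolding fgl_subst_def[of d f]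
    by (rule mps_subst_diff_order[OF finite_xy_vars pts(1,2) _ D])
      (use lin order.E_zero[of 2] in \<open>auto simp: xy_vars_def\<close>)
  show "fgl_subst d f S (FF P Q) - fgl_subst d f S (P + Q) \<in> order_ge (Suc n)"
    unfolding fgl_subst_def[of d f]
    by (rule mps_subst_diff_order[OF finite_xy_vars pts(3,4) _ D])
      (use lin order.E_zero[of 2] in \<open>auto simp: xy_vars_def\<close>)
qed

text \<open>A coboundary for F is a cocycle for F, by associativity. In degrees up to
  \<open>n\<close> only the lowest part of the defect counts, so F(P, Q) may be replaced by P +
  Q.\<close>

lemma defect_cocycle:
  fixes P Q S :: "nat \<Rightarrow> ('w, 'a) mps"
  assumes P: "is_point d P" and Q: "is_point d Q" and S: "is_point d S"
    and D: "defect g \<in> order_ge n" and m: "mdeg m \<le> n"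
  defines "c \<equiv> \<lambda>P Q. mps_coeff (fgl_subst d (defect g) P Q) m"
  shows "c P Q + c (P + Q) S = c P (Q + S) + c Q S"
proof -
  have eq: "mps_coeff f m = mps_coeff f' m" if "f - f' \<in> order_ge (Suc n)" for f f' :: "('w, 'a) mps"
  proof -
    have "mps_coeff (f - f') m = 0" using that m unfolding order_ge_def by auto
    then show ?thesis by (simp add: minus_mps.rep_eq)
  qed
  note PQ = FF_order[OF P Q] and QS = FF_order[OF Q S]
  have "subst1 (FF (FF P Q) S) g = subst1 (FF P (FF Q S)) g"
    using FF_assoc[OF P Q S] by (intro mps_subst_cong) auto
  then have "fgl_subst d (defect g) P Q + fgl_subst d (defect g) (FF P Q) S
      = fgl_subst d (defect g) P (FF Q S) + fgl_subst d (defect g) Q S"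
    using defect_subst[OF P Q] defect_subst[OF PQ S] defect_subst[OF P QS] defect_subst[OF Q S] by simp
  then have "c P Q + c (FF P Q) S = c P (FF Q S) + c Q S"
    unfolding c_def by (metis plus_mps.rep_eq)
  moreover have "c (FF P Q) S = c (P + Q) S" "c P (FF Q S) = c P (Q + S)"
    unfolding c_def using eq defect_FF_approx[OF P Q S D] defect_FF_approx[OF Q S P D] by blast+
  ultimately show ?thesis by simp
qed

lemma defect_homogeneous:
  assumes P: "is_point d P" and Q: "is_point d Q" and D: "f \<in> order_ge n" and m: "mdeg m \<le> n"
  shows "mps_coeff (fgl_subst d f (of_nat i * P) (of_nat i * Q)) m
    = of_nat i ^ n * mps_coeff (fgl_subst d f P Q) m"
proof -
  have "fgl_subst d f (of_nat i * P) (of_nat i * Q)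
      = mps_subst (xy_vars d) (\<lambda>v. mps_const (of_nat i) * case_sum P Q v) f"
    unfolding fgl_subst_def
    by (rule mps_subst_cong) (auto simp: xy_vars_def times_fun_def of_nat_fun mps_const_of_nat)
  then show ?thesis
    using mps_subst_homogeneous[OF finite_xy_vars is_point_case_sum[OF P Q] D m]
    unfolding fgl_subst_def by simp
qed

text \<open>If \<open>f\<close> is an additive cocycle to lowest order, then in the extension it
  defines the p-th power of (P, 0) is (p P, h(P)) to that order, where h is this series.\<close>

definition correction :: "nat \<Rightarrow> (nat + nat, 'a) mps \<Rightarrow> (nat, 'a) mps" where
  "correction p f = (\<Sum>i=1..<p. fgl_subst d f (of_nat i * mps_var) mps_var)"

lemma correction_order:
  assumes "f \<in> order_ge n"
  shows "correction p f \<in> order_ge n"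
proof -
  have v: "is_point d (mps_var :: nat \<Rightarrow> (nat, 'a) mps)" using mps_var_order by auto
  show ?thesis
    unfolding correction_def by (rule order.E_sum, rule fgl_subst_order[OF is_point_of_nat[OF v] v assms])
qed

lemma correction_subst:
  assumes W: "finite W" and P: "is_point d (P :: nat \<Rightarrow> ('w, 'a) mps)"
  shows "subst1 P (correction p f) = (\<Sum>i=1..<p. fgl_subst d f (of_nat i * P) P)"
proof -
  have v: "is_point d (mps_var :: nat \<Rightarrow> (nat, 'a) mps)" using mps_var_order by auto
  have "subst1 P (mps_var j) = P j" "subst1 P ((of_nat i * mps_var) j) = (of_nat i * P) j" if "j < d" for i j
    using that P mps_subst_const_mult[of "{..<d}" P "of_nat i" "mps_var j"]
    by (auto simp: mps_subst_var times_fun_def of_nat_fun mps_const_of_nat)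
  then have "subst1 P (fgl_subst d f (of_nat i * mps_var) mps_var) = fgl_subst d f (of_nat i * P) P" for i
    using P by (subst mps_subst_fgl_subst[OF _ is_point_of_nat[OF v] v]) (auto intro: fgl_subst_cong)
  then show ?thesis unfolding correction_def by (simp add: mps_subst_sum)
qed

text \<open>
  In degree \<open>n\<close> the defect is a 2-cocycle \<open>c\<close> of the additive group, and in the corresponding
  extension the \<open>p\<close>-th power map gives \<open>p c(P, Q) - c(p P, p Q) = h(P) + h(Q) - h(P + Q)\<close> for the
  correction \<open>h\<close>; by homogeneity the left-hand side is \<open>(p - p\<^sup>n) c(P, Q)\<close>.
\<close>

lemma defect_step:
  assumes D: "defect g \<in> order_ge n" and n: "n \<ge> 2" and p: "p \<ge> 1" and u: "u * (1 - of_nat p ^ (n - 1)) = 1"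
    and sym: "\<And>(P :: nat \<Rightarrow> (nat + nat, 'a) mps) Q m. is_point d P \<Longrightarrow> is_point d Q \<Longrightarrow> mdeg m \<le> n \<Longrightarrow>
      mps_coeff (fgl_subst d (defect g) P Q) m = mps_coeff (fgl_subst d (defect g) Q P) m"
  shows "defect (mps_const (of_nat p) * g + mps_const u * correction p (defect g)) \<in> order_ge (Suc n)"
  unfolding order_ge_def mem_Collect_eq
proof (intro allI impI)
  fix m :: "nat + nat \<Rightarrow>\<^sub>0 nat" assume "mdeg m < Suc n"
  then have m: "mdeg m \<le> n" by simp
  let ?h = "correction p (defect g)"
  define c where "c = (\<lambda>P Q :: nat \<Rightarrow> (nat + nat, 'a) mps. mps_coeff (fgl_subst d (defect g) P Q) m)"
  have XY: "is_point d (xvar + yvar)" using is_point_add[OF is_point_XY] .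
  have FFX: "is_point d (FF xvar yvar)" using FF_order[OF is_point_XY] .
  have cor: "mps_coeff (subst1 P ?h) m = (\<Sum>i=1..<p. c (of_nat i * P) P)" if "is_point d P" for P
    unfolding c_def correction_subst[OF finite_xy_vars that] by (simp add: mps_coeff_sum)
  \<comment> \<open>The correction has order at least \<open>n\<close> too, so in degree
    \<open>n\<close> its defect is its coboundary for addition.\<close>
  have "subst1 (FF xvar yvar) ?h - subst1 (xvar + yvar) ?h \<in> order_ge (Suc n)"
    using FF_linear[OF is_point_XY] FFX XY correction_order[OF D]
    by (intro mps_subst_diff_order) (auto simp: plus_fun_def)
  then have "mps_coeff (subst1 (FF xvar yvar) ?h - subst1 (xvar + yvar) ?h) m = 0" using m unfolding order_ge_def by auto
  then have e: "mps_coeff (subst1 (FF xvar yvar) ?h) m = mps_coeff (subst1 (xvar + yvar) ?h) m"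
    by (simp add: minus_mps.rep_eq)
  have dh: "mps_coeff (defect ?h) m = (\<Sum>i=1..<p. c (of_nat i * (xvar + yvar)) (xvar + yvar))
      - (\<Sum>i=1..<p. c (of_nat i * xvar) xvar) - (\<Sum>i=1..<p. c (of_nat i * yvar) yvar)"
    unfolding defect_def[of ?h] minus_mps.rep_eq e cor[OF XY] cor[OF is_point_XY(1)] cor[OF is_point_XY(2)] by (rule refl)
  have "of_nat p * c xvar yvar + (\<Sum>i=1..<p. c (of_nat i * (xvar + yvar)) (xvar + yvar))
    = (\<Sum>i=1..<p. c (of_nat i * xvar) xvar) + (\<Sum>i=1..<p. c (of_nat i * yvar) yvar) + c (of_nat p * xvar) (of_nat p * yvar)"
  proof (rule symmetric_cocycle_multiple[where T = "{P. is_point d P}"])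
    show "c P Q + c (P + Q) S = c P (Q + S) + c Q S"
      if "P \<in> {P. is_point d P}" "Q \<in> {P. is_point d P}" "S \<in> {P. is_point d P}" for P Q S
      unfolding c_def using that by (intro defect_cocycle[OF _ _ _ D m]) auto
    show "c P Q = c Q P" if "P \<in> {P. is_point d P}" "Q \<in> {P. is_point d P}" for P Q
      unfolding c_def using that m by (intro sym) auto
  qed (use is_point_XY is_point_add p in blast)+
  moreover have "c (of_nat p * xvar) (of_nat p * yvar) = of_nat p ^ n * c xvar yvar"
    unfolding c_def by (rule defect_homogeneous[OF is_point_XY D m])
  ultimately have dh': "mps_coeff (defect ?h) m = of_nat p ^ n * c xvar yvar - of_nat p * c xvar yvar"
    unfolding dh by (simp add: algebra_simps)
  \<comment> \<open>The defect of the correction is (p^n - p) c = - p (1 - p^(n-1)) c. The factor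
    \<open>u\<close> turns this into - p c, which cancels the defect of p g.\<close>
  have pn: "of_nat p ^ n = of_nat p * (of_nat p ^ (n - 1) :: 'a)" using n by (cases n) auto
  have "mps_coeff (defect (mps_const (of_nat p) * g + mps_const u * ?h)) m
      = of_nat p * mps_coeff (defect g) m + u * mps_coeff (defect ?h) m"
    unfolding defect_linear by (simp add: plus_mps.rep_eq mps_coeff_const_mult)
  also have "mps_coeff (defect g) m = c xvar yvar" unfolding c_def defect_XY ..
  also have "of_nat p * c xvar yvar + u * mps_coeff (defect ?h) m
      = of_nat p * c xvar yvar * (1 - u * (1 - of_nat p ^ (n - 1)))"
    unfolding dh' pn by (simp add: algebra_simps)
  finally show "mps_coeff (defect (mps_const (of_nat p) * g + mps_const u * ?h)) m = 0" using u by simp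
qed

end

section \<open>Truncated logarithms of a linear form\<close>

locale fgl_idom = fgl d F for d and F :: "nat \<Rightarrow> (nat + nat, 'a::idom) mps"
begin

text \<open>Multiplying both arguments by p multiplies the antisymmetric part by p^n, by
  homogeneity, and by p^2, by biadditivity. For n \<ge> 3 these factors differ by assumption
  \<open>u\<close>, so the antisymmetric part vanishes.\<close>

lemma defect_symmetric:
  assumes D: "defect g \<in> order_ge n" and n: "n \<ge> 3" and p: "of_nat p \<noteq> (0 :: 'a)"
    and u: "of_nat p ^ (n - 2) \<noteq> (1 :: 'a)"
    and P: "is_point d P" and Q: "is_point d Q" and m: "mdeg m \<le> n"
  shows "mps_coeff (fgl_subst d (defect g) P Q) m = mps_coeff (fgl_subst d (defect g) Q P) m"
proof -
  define c where "c = (\<lambda>P Q. mps_coeff (fgl_subst d (defect g) P Q) m)"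
  have p1: "p \<ge> 1" using p by (cases p) auto
  have "c (of_nat p * P) (of_nat p * Q) - c (of_nat p * Q) (of_nat p * P) = of_nat p ^ 2 * (c P Q - c Q P)"
  proof (rule cocycle_antisymmetrization[where T = "{P. is_point d P}"])
    show "c P Q + c (P + Q) S = c P (Q + S) + c Q S"
      if "P \<in> {P. is_point d P}" "Q \<in> {P. is_point d P}" "S \<in> {P. is_point d P}" for P Q S
      unfolding c_def using that by (intro defect_cocycle[OF _ _ _ D m]) auto
  qed (use P Q is_point_add p1 in blast)+
  moreover have "c (of_nat p * P) (of_nat p * Q) = of_nat p ^ n * c P Q"
    "c (of_nat p * Q) (of_nat p * P) = of_nat p ^ n * c Q P"
    unfolding c_def using defect_homogeneous[OF P Q D m] defect_homogeneous[OF Q P D m] by auto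
  moreover have "n = 2 + (n - 2)" using n by simp
  then have "of_nat p ^ n = of_nat p ^ 2 * (of_nat p ^ (n - 2) :: 'a)" by (metis power_add)
  ultimately have "of_nat p ^ 2 * ((of_nat p ^ (n - 2) - 1) * (c P Q - c Q P)) = 0"
    by (simp add: algebra_simps)
  then show ?thesis using p u unfolding c_def by simp
qed

text \<open>Assumption \<open>lam\<close> expresses that the linear form vanishes on the bracket of
  any two basis vectors.\<close>

context
  fixes p :: nat and lam :: "nat \<Rightarrow> 'a"
  assumes p: "of_nat p \<noteq> (0 :: 'a)" and units: "\<And>k. k \<ge> 1 \<Longrightarrow> \<exists>u. u * (1 - of_nat p ^ k) = (1 :: 'a)"
    and lam: "\<And>j k. j < d \<Longrightarrow> k < d \<Longrightarrow>
      (\<Sum>i<d. lam i * mps_coeff (F i) (mix j k)) = (\<Sum>i<d. lam i * mps_coeff (F i) (mix k j))"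
begin

definition log1 :: "(nat, 'a) mps" where
  "log1 = (\<Sum>i<d. mps_const (lam i) * mps_var i)"

lemma log1_subst: "is_point d P \<Longrightarrow> subst1 P log1 = (\<Sum>i<d. mps_const (lam i) * P i)"
  unfolding log1_def by (simp add: mps_subst_sum mps_subst_const_mult mps_subst_var)

lemma defect_log1_subst:
  assumes P: "is_point d P" and Q: "is_point d Q"
  shows "fgl_subst d (defect log1) P Q = (\<Sum>i<d. mps_const (lam i) * (FF P Q i - (P i + Q i)))"
  unfolding defect_subst[OF P Q] log1_subst[OF P] log1_subst[OF Q] log1_subst[OF FF_order[OF P Q]]
  by (simp add: sum_subtractf sum.distrib right_diff_distrib distrib_left)

lemma defect_log1: "defect log1 = (\<Sum>i<d. mps_const (lam i) * F_high i)"
proof -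
  have "FF xvar yvar i - (xvar i + yvar i) = F_high i" if "i < d" for i
    by (simp add: FF_XY[OF that] F_high_def)
  then show ?thesis using defect_log1_subst[OF is_point_XY] by (simp add: defect_XY)
qed

lemma defect_log1_order: "defect log1 \<in> order_ge 2"
  unfolding defect_log1 using F_high_order by (intro order.E_sum mps_const_order) auto

text \<open>In degree 2 the factor p^(n-2) - 1 used in \<open>defect_symmetric\<close> is zero. Here
  the defect is the bilinear form obtained by applying the linear form to the quadratic part of F,
  and \<open>lam\<close> is exactly its symmetry.\<close>

lemma defect_log1_symmetric:
  assumes P: "is_point d P" and Q: "is_point d Q" and m: "mdeg m \<le> 2"
  shows "mps_coeff (fgl_subst d (defect log1) P Q) m = mps_coeff (fgl_subst d (defect log1) Q P) m"
proof -
  let ?D = "defect log1"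
  have mixed: "\<exists>j<d. \<exists>k<d. \<alpha> = mix j k" if \<alpha>: "\<alpha> \<in> monoms_upto (xy_vars d) 2" "mps_coeff ?D \<alpha> \<noteq> 0" for \<alpha>
  proof -
    have "\<not> mdeg \<alpha> < 2" using \<alpha>(2) defect_log1_order unfolding order_ge_def by blast
    moreover have "mdeg \<alpha> \<le> 2" using \<alpha>(1) by simp
    ultimately have "mdeg \<alpha> = 2" by linarith
    moreover obtain i where "i < d" "mps_coeff (F_high i) \<alpha> \<noteq> 0"
      using \<alpha>(2) unfolding defect_log1 mps_coeff_sum mps_coeff_const_mult
      by (metis (no_types, lifting) lessThan_iff mult_zero_right sum.neutral)
    moreover have "\<alpha> \<noteq> Poly_Mapping.single v 1" for v using \<open>mdeg \<alpha> = 2\<close> by auto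
    ultimately show ?thesis
      using coeff_quadratic[of i \<alpha>] by (auto simp: F_high_def minus_mps.rep_eq mps_coeff_var)
  qed
  have coeff: "mps_coeff ?D (mix j k) = (\<Sum>i<d. lam i * mps_coeff (F i) (mix j k))" for j k
  proof -
    have "mix j k \<noteq> Poly_Mapping.single v 1" for v
    proof
      assume "mix j k = Poly_Mapping.single v 1"
      then have "mdeg (mix j k) = mdeg (Poly_Mapping.single v (1::nat))" by (rule arg_cong)
      then show False by (simp add: mdeg_add)
    qed
    then show ?thesis
      unfolding defect_log1
      by (simp add: mps_coeff_sum mps_coeff_const_mult F_high_def minus_mps.rep_eq mps_coeff_var)
  qed
  have ev: "mps_coeff (fgl_subst d ?D P Q) m
      = (\<Sum>j<d. \<Sum>k<d. mps_coeff ?D (mix j k) * mps_coeff (P j * Q k) m)"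
    if P: "is_point d P" and Q: "is_point d Q" for P Q
  proof -
    have me: "monom_eval (xy_vars d) (case_sum P Q) (mix j k) = P j * Q k" if "j < d" "k < d" for j k
      using that by (simp add: monom_eval_add monom_eval_single)
    have "mps_coeff (fgl_subst d ?D P Q) m
        = (\<Sum>\<alpha>\<in>monoms_upto (xy_vars d) 2. mps_coeff ?D \<alpha> * mps_coeff (monom_eval (xy_vars d) (case_sum P Q) \<alpha>) m)"
      unfolding fgl_subst_def by (rule mps_subst_coeff[OF finite_xy_vars is_point_case_sum[OF P Q] m])
    also have "\<dots> = (\<Sum>j<d. \<Sum>k<d. mps_coeff ?D (mix j k)
        * mps_coeff (monom_eval (xy_vars d) (case_sum P Q) (mix j k)) m)"
      using mixed by (intro sum_mixed) (auto simp: keys_add_nat mdeg_add)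
    finally show ?thesis by (simp add: me[unfolded One_nat_def])
  qed
  have swap: "mps_coeff ?D (mix j k) = mps_coeff ?D (mix k j)" if "j < d" "k < d" for j k
    using lam[OF that] by (simp only: coeff)
  have "(\<Sum>j<d. \<Sum>k<d. mps_coeff ?D (mix j k) * mps_coeff (P j * Q k) m)
      = (\<Sum>j<d. \<Sum>k<d. mps_coeff ?D (mix k j) * mps_coeff (P j * Q k) m)"
    by (intro sum.cong refl) (simp only: swap lessThan_iff)
  also have "\<dots> = (\<Sum>j<d. \<Sum>k<d. mps_coeff ?D (mix j k) * mps_coeff (Q j * P k) m)"
    by (subst sum.swap) (simp add: mult.commute)
  finally show ?thesis using ev[OF P Q] ev[OF Q P] by simp
qed

text \<open>Each step multiplies \<open>g\<close> by p and adds a series of order at least s + 1.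
  The divisibility clause is carried along for \<open>ev_axis_point\<close>. The last clause
  remembers \<open>g\<close> for the first step, where symmetry of the defect comes from
  \<open>lam\<close> instead of homogeneity.\<close>

theorem truncated_log_exists:
  assumes "s \<ge> 1"
  shows "\<exists>g. defect g \<in> order_ge (Suc s) \<and> mps_coeff g 0 = 0
    \<and> (\<forall>i<d. mps_coeff g (Poly_Mapping.single i 1) = of_nat p ^ (s - 1) * lam i)
    \<and> (\<forall>\<alpha>. mdeg \<alpha> \<le> s \<longrightarrow> of_nat p ^ (s - mdeg \<alpha>) dvd mps_coeff g \<alpha>)
    \<and> (s = 1 \<longrightarrow> g = log1)"
  using assms
proof (induction s rule: nat_induct_at_least)
  case base
  have sg: "Poly_Mapping.single a (1::nat) = Poly_Mapping.single b 1 \<longleftrightarrow> a = b" for a b :: nat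
    by (metis lookup_single_eq lookup_single_not_eq zero_neq_one)
  have ne: "0 \<noteq> Poly_Mapping.single v (1::nat)" for v :: nat by (metis mdeg_0 mdeg_single zero_neq_one)
  have co: "mps_coeff log1 m = (\<Sum>i<d. lam i * (if m = Poly_Mapping.single i 1 then 1 else 0))" for m
    unfolding log1_def by (simp add: mps_coeff_sum mps_coeff_const_mult mps_coeff_var)
  have c0: "mps_coeff log1 0 = 0" unfolding co using ne by (intro sum.neutral) auto
  have c1: "mps_coeff log1 (Poly_Mapping.single i 1) = lam i" if "i < d" for i
    unfolding co sg using that by (simp add: if_distrib[of "(*) _"] sum.delta' cong: if_cong)
  show ?case
  proof (intro exI[of _ log1] conjI allI impI)
    show "of_nat p ^ (1 - mdeg \<alpha>) dvd mps_coeff log1 \<alpha>" if "mdeg \<alpha> \<le> 1" for \<alpha> :: "nat \<Rightarrow>\<^sub>0 nat"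
      using that c0 mdeg_eq_0_iff[of \<alpha>] by (cases "mdeg \<alpha> = 0") auto
  qed (use defect_log1_order c0 c1 in \<open>auto simp: numeral_2_eq_2\<close>)
next
  case (Suc s)
  then obtain g where g: "defect g \<in> order_ge (Suc s)" "mps_coeff g 0 = 0"
    "\<forall>i<d. mps_coeff g (Poly_Mapping.single i 1) = of_nat p ^ (s - 1) * lam i"
    "\<forall>\<alpha>. mdeg \<alpha> \<le> s \<longrightarrow> of_nat p ^ (s - mdeg \<alpha>) dvd mps_coeff g \<alpha>" "s = 1 \<longrightarrow> g = log1"
    by blast
  obtain u where u: "u * (1 - of_nat p ^ s) = (1 :: 'a)" using units Suc.hyps by blast
  let ?h = "correction p (defect g)"
  let ?g = "mps_const (of_nat p) * g + mps_const u * ?h"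
  have p1: "p \<ge> 1" using p by (cases p) auto
  have low: "mps_coeff ?g \<alpha> = of_nat p * mps_coeff g \<alpha>" if "mdeg \<alpha> \<le> s" for \<alpha>
  proof -
    have "mps_coeff ?h \<alpha> = 0" using correction_order[OF g(1), of p] that unfolding order_ge_def by auto
    then show ?thesis by (simp add: plus_mps.rep_eq mps_coeff_const_mult)
  qed
  have "defect ?g \<in> order_ge (Suc (Suc s))"
  proof (rule defect_step[OF g(1) _ p1])
    fix P Q :: "nat \<Rightarrow> (nat + nat, 'a) mps" and m :: "nat + nat \<Rightarrow>\<^sub>0 nat"
    assume P: "is_point d P" and Q: "is_point d Q" and m: "mdeg m \<le> Suc s"
    show "mps_coeff (fgl_subst d (defect g) P Q) m = mps_coeff (fgl_subst d (defect g) Q P) m"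
    proof (cases "s = 1")
      case True
      then show ?thesis using g(5) defect_log1_symmetric[OF P Q] m by simp
    next
      case False
      have "s - 1 \<ge> 1" using False Suc.hyps by linarith
      from units[OF this] obtain v where "v * (1 - of_nat p ^ (s - 1)) = (1 :: 'a)" by blast
      then have "of_nat p ^ (Suc s - 2) \<noteq> (1 :: 'a)" by (auto simp: numeral_2_eq_2)
      then show ?thesis using False Suc.hyps by (intro defect_symmetric[OF g(1) _ p _ P Q m]) auto
    qed
  qed (use u Suc.hyps in auto)
  moreover have "of_nat p * (of_nat p ^ (s - 1) * lam i) = of_nat p ^ s * lam i" for i
    using Suc.hyps by (cases s) auto
  moreover have "of_nat p ^ (Suc s - mdeg \<alpha>) dvd mps_coeff ?g \<alpha>" if "mdeg \<alpha> \<le> Suc s" for \<alpha>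
  proof (cases "mdeg \<alpha> \<le> s")
    case True
    then show ?thesis using g(4) by (simp add: low Suc_diff_le)
  next
    case False
    then have "Suc s - mdeg \<alpha> = 0" by simp
    then show ?thesis by (simp only: power_0 one_dvd)
  qed
  ultimately show ?case
    using Suc.hyps g(2,3) low by (intro exI[of _ ?g]) (auto simp: mdeg_eq_0_iff)
qed

end

end

section \<open>Local pro-\<open>p\<close> domains\<close>

locale pro_p_domain =
  fixes p :: nat and M :: "'a::idom set"
  assumes local_ring: "noetherian_local_pro_p_domain p M" and char_0: "CHAR('a) = 0" and p_pos: "p > 0"
begin

abbreviation Mp :: "nat \<Rightarrow> 'a set" where "Mp n \<equiv> ideal_power M n"

lemma noeth: "noetherian_ring (tring :: 'a ring)" and max_M: "maximalideal M (tring :: 'a ring)"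
  and complete: "adic_complete M" and fin_res: "finite (carrier ((tring :: 'a ring) Quot M))"
  and ord_p: "group.ord (add_monoid ((tring :: 'a ring) Quot M)) \<one>\<^bsub>tring Quot M\<^esub> = p"
  using local_ring unfolding noetherian_local_pro_p_domain_def Let_def by blast+

lemma ideal_M: "ideal M (tring :: 'a ring)"
  using max_M unfolding maximalideal_def by blast

lemmas ideal_Mp = ideal_ideal_power[OF ideal_M]
lemmas Mp_closed = ideal_tring_closed[OF ideal_Mp]
lemmas Mp_mult = ideal_power_mult[OF ideal_M]
lemmas Mp_anti = subsetD[OF ideal_power_antimono[OF ideal_M]]
lemmas Mp_1 = ideal_power_1[OF ideal_M]

lemma M_maximal: "ideal J (tring :: 'a ring) \<Longrightarrow> M \<subseteq> J \<Longrightarrow> J = M \<or> J = UNIV"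
  using maximalideal.I_maximal[OF max_M, of J] by (simp add: ring_of_type_algebra_def)

section \<open>Convergence, units and finite quotients\<close>

lemma limitin_adic_iff:
  "limitin (adic_topology M) s l sequentially \<longleftrightarrow> (\<forall>n. \<exists>N. \<forall>i\<ge>N. s i - l \<in> Mp n)"
proof -
  have top: "topspace (adic_topology M) = UNIV"
    using openin_adic_topology[OF ideal_M, of UNIV] openin_subset by blast
  have ball: "openin (adic_topology M) {y. y - l \<in> Mp n}" for n
    unfolding openin_adic_topology[OF ideal_M]
  proof (intro ballI exI[of _ n] allI impI)
    fix x y assume "x \<in> {y. y - l \<in> Mp n}" "y - x \<in> Mp n"
    then show "y \<in> {y. y - l \<in> Mp n}" using Mp_closed(2)[of "y - x" n "x - l"] by simp
  qed
  show ?thesis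
  proof
    assume lim: "limitin (adic_topology M) s l sequentially"
    show "\<forall>n. \<exists>N. \<forall>i\<ge>N. s i - l \<in> Mp n"
    proof
      fix n
      have "l \<in> {y. y - l \<in> Mp n}" using Mp_closed(1) by simp
      then have "\<forall>\<^sub>F i in sequentially. s i \<in> {y. y - l \<in> Mp n}"
        using lim ball[of n] unfolding limitin_def by blast
      then show "\<exists>N. \<forall>i\<ge>N. s i - l \<in> Mp n" by (simp add: eventually_sequentially)
    qed
  next
    assume R: "\<forall>n. \<exists>N. \<forall>i\<ge>N. s i - l \<in> Mp n"
    show "limitin (adic_topology M) s l sequentially"
      unfolding limitin_def
    proof (intro conjI allI impI)
      show "l \<in> topspace (adic_topology M)" using top by simp
      fix U assume "openin (adic_topology M) U \<and> l \<in> U"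
      then obtain n where n: "\<And>y. y - l \<in> Mp n \<Longrightarrow> y \<in> U"
        unfolding openin_adic_topology[OF ideal_M] by blast
      obtain N where "\<forall>i\<ge>N. s i - l \<in> Mp n" using R by blast
      then show "\<forall>\<^sub>F i in sequentially. s i \<in> U" using n unfolding eventually_sequentially by blast
    qed
  qed
qed

text \<open>The constant sequence 0 converges to every element of the intersection of the powers of
  M, and \<open>adic_complete\<close> makes limits unique.\<close>

lemma Mp_separated: "(\<And>n. x \<in> Mp n) \<Longrightarrow> x = 0"
proof -
  assume x: "\<And>n. x \<in> Mp n"
  have "\<forall>n. \<exists>N. \<forall>i\<ge>N. \<forall>j\<ge>N. (0::'a) - 0 \<in> Mp n" using Mp_closed(1) by simp
  then have "\<exists>!l. limitin (adic_topology M) (\<lambda>_. 0) l sequentially"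
    using complete unfolding adic_complete_def by (metis (mono_tags, lifting))
  moreover have "limitin (adic_topology M) (\<lambda>_. 0) x sequentially"
    unfolding limitin_adic_iff using Mp_closed(5)[OF x] by simp
  moreover have "limitin (adic_topology M) (\<lambda>_. 0) 0 sequentially"
    unfolding limitin_adic_iff using Mp_closed(1) by simp
  ultimately show "x = 0" by blast
qed

lemma Mp_limit:
  assumes "\<And>n i j. n \<le> i \<Longrightarrow> n \<le> j \<Longrightarrow> s i - s j \<in> Mp n"
  shows "\<exists>l. (\<forall>n i. n \<le> i \<longrightarrow> s i - l \<in> Mp n) \<and> limitin (adic_topology M) s l sequentially
    \<and> (\<forall>l'. limitin (adic_topology M) s l' sequentially \<longrightarrow> l' = l)"
proof -
  have "\<exists>!l. limitin (adic_topology M) s l sequentially"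
    using complete assms unfolding adic_complete_def by blast
  then obtain l where l: "limitin (adic_topology M) s l sequentially"
    "\<And>l'. limitin (adic_topology M) s l' sequentially \<Longrightarrow> l' = l" by blast
  have "s i - l \<in> Mp n" if i: "n \<le> i" for n i
  proof -
    obtain N where N: "\<forall>i\<ge>N. s i - l \<in> Mp n" using l(1) unfolding limitin_adic_iff by blast
    have "s i - s (max N n) \<in> Mp n" using assms[OF i, of "max N n"] by simp
    moreover have "s (max N n) - l \<in> Mp n" using N by simp
    ultimately show ?thesis using Mp_closed(2) by fastforce
  qed
  then show ?thesis using l by blast
qed

text \<open>The inverse is the geometric series of \<open>m\<close>, which converges by
  completeness.\<close>

lemma one_minus_unit:
  assumes m: "m \<in> M"
  shows "\<exists>u. u * (1 - m) = 1"
proof -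
  have mn: "m ^ i \<in> Mp i" for i
    using ideal_power_power[OF ideal_M, of m 1 i] m by (simp add: Mp_1)
  define s where "s n = (\<Sum>i<n. m ^ i)" for n
  have ge: "s i - s n \<in> Mp n" if "n \<le> i" for n i
  proof -
    have "s i - s n = sum ((^) m) ({..<i} - {..<n})" unfolding s_def using that by (subst sum_diff) auto
    moreover have "m ^ k \<in> Mp n" if "k \<in> {..<i} - {..<n}" for k
      using mn[of k] Mp_anti[of n k] that by auto
    ultimately show ?thesis using ideal_tring_sum[OF ideal_Mp] by metis
  qed
  have "s i - s j \<in> Mp n" if "n \<le> i" "n \<le> j" for n i j
    using Mp_closed(6)[OF ge[OF that(1)] ge[OF that(2)]] by simp
  from Mp_limit[of s, OF this] obtain l where l: "\<And>n i. n \<le> i \<Longrightarrow> s i - l \<in> Mp n" by blast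
  have "l * (1 - m) - 1 \<in> Mp n" for n
  proof -
    have "s n * (1 - m) = 1 - m ^ n" using one_diff_power_eq[of m n] by (simp add: s_def mult.commute)
    then have "l * (1 - m) - 1 = - (m ^ n) - (s n - l) * (1 - m)" by (simp add: algebra_simps)
    then show ?thesis using Mp_closed(5)[OF mn] Mp_closed(4)[OF l[of n n]] Mp_closed(6) by simp
  qed
  then have "l * (1 - m) - 1 = 0" by (rule Mp_separated)
  then show ?thesis by auto
qed

lemma p_in_M: "of_nat p \<in> M"
proof -
  let ?k = "(tring :: 'a ring) Quot M"
  interpret I: ideal M "tring :: 'a ring" by (rule ideal_M)
  interpret k: ring ?k by (rule I.quotient_is_ring)
  have zero: "\<zero>\<^bsub>?k\<^esub> = M" and one: "\<one>\<^bsub>?k\<^esub> = M +>\<^bsub>tring\<^esub> 1"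
    by (simp_all add: FactRing_def ring_of_type_algebra_def)
  have pw: "\<one>\<^bsub>?k\<^esub> [^]\<^bsub>add_monoid ?k\<^esub> n = M +>\<^bsub>tring\<^esub> of_nat n" for n :: nat
  proof (induction n)
    case 0
    have "M +>\<^bsub>tring\<^esub> 0 = M" by (auto simp: a_r_coset_def' ring_of_type_algebra_def)
    then show ?case using zero by simp
  next
    case (Suc n)
    have "(M +>\<^bsub>tring\<^esub> of_nat n) <+>\<^bsub>tring\<^esub> (M +>\<^bsub>tring\<^esub> 1) = M +>\<^bsub>tring\<^esub> (of_nat n + (1::'a))"
      using I.a_rcos_sum[of "of_nat n" 1] by (simp add: ring_of_type_algebra_def)
    then show ?case
      using Suc one by (simp add: FactRing_def ring_of_type_algebra_def add.commute)
  qed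
  have "\<one>\<^bsub>?k\<^esub> [^]\<^bsub>add_monoid ?k\<^esub> p = \<zero>\<^bsub>?k\<^esub>"
    using group.pow_ord_eq_1[OF k.add.is_group, of "\<one>\<^bsub>?k\<^esub>"] ord_p by simp
  then have "M +>\<^bsub>tring\<^esub> of_nat p = M" using pw zero by simp
  moreover have "of_nat p \<in> M +>\<^bsub>tring\<^esub> of_nat p"
    using ideal_tring_closed(1)[OF ideal_M] by (auto simp: a_r_coset_def' ring_of_type_algebra_def)
  ultimately show ?thesis by simp
qed

lemma of_nat_p_nonzero: "of_nat p \<noteq> (0 :: 'a)"
  using char_0 p_pos by (simp add: of_nat_eq_0_iff_char_dvd)

lemma p_power_in: "of_nat p ^ k \<in> Mp k"
  using ideal_power_power[OF ideal_M, of "of_nat p" 1 k] p_in_M by (simp add: Mp_1)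

lemma p_units: "k \<ge> 1 \<Longrightarrow> \<exists>u. u * (1 - of_nat p ^ k) = (1 :: 'a)"
  using one_minus_unit[of "of_nat p ^ k"] p_power_in[of k] Mp_anti[of 1 k] by (simp add: Mp_1)

lemma finite_reps_M: "\<exists>T. finite T \<and> (\<forall>x. \<exists>t\<in>T. x - t \<in> M)"
proof -
  let ?k = "(tring :: 'a ring) Quot M"
  define r where "r C = (SOME x. x \<in> C)" for C :: "'a set"
  have "\<exists>t\<in>r ` carrier ?k. x - t \<in> M" for x
  proof -
    let ?C = "M +>\<^bsub>tring\<^esub> x"
    have C: "?C = {m + x |m. m \<in> M}" by (auto simp: a_r_coset_def' ring_of_type_algebra_def)
    have "?C \<in> carrier ?k"
      by (auto simp: FactRing_def A_RCOSETS_def' ring_of_type_algebra_def)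
    moreover have "x \<in> ?C" using C ideal_tring_closed(1)[OF ideal_M] by force
    then have "r ?C \<in> ?C" unfolding r_def by (rule someI)
    then obtain m where "m \<in> M" "r ?C = m + x" using C by blast
    then have "x - r ?C \<in> M" using ideal_tring_closed(5)[OF ideal_M] by simp
    ultimately show ?thesis by blast
  qed
  then show ?thesis using fin_res by (intro exI[of _ "r ` carrier ?k"]) auto
qed

text \<open>M^n is finitely generated, so M^n / M^(n+1) is a finite dimensional space over the
  finite residue field: modulo M^(n+1) the coefficients of the generators may be taken from
  representatives of R / M.\<close>

lemma finite_reps: "\<exists>T. finite T \<and> (\<forall>x. \<exists>t\<in>T. x - t \<in> Mp n)"
proof (induction n)
  case 0
  then show ?case by (intro exI[of _ "{0}"]) (simp add: ideal_power_0)
next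
  case (Suc n)
  then obtain T where T: "finite T" "\<forall>x. \<exists>t\<in>T. x - t \<in> Mp n" by blast
  obtain T1 where T1: "finite T1" "\<forall>x. \<exists>t\<in>T1. x - t \<in> M" using finite_reps_M by blast
  then obtain \<tau> where \<tau>: "\<And>x. \<tau> x \<in> T1" "\<And>x. x - \<tau> x \<in> M" by metis
  obtain as where as: "set as \<subseteq> Mp n" "Mp n = lin_span UNIV (set as)"
    using noetherian_tring_finite_generators[OF noeth ideal_Mp] by blast
  let ?T' = "(\<lambda>(t, f). t + (\<Sum>a\<in>set as. f a * a)) ` (T \<times> (set as \<rightarrow>\<^sub>E T1))"
  have "\<exists>t\<in>?T'. x - t \<in> Mp (Suc n)" for x
  proof -
    obtain t where t: "t \<in> T" "x - t \<in> Mp n" using T by blast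
    have "y \<in> lin_span UNIV (set as) \<Longrightarrow> \<exists>f. y = (\<Sum>a\<in>set as. f a * a)" for y
    proof (induction rule: lin_span.induct)
      case zero
      show ?case by (rule exI[of _ "\<lambda>_. 0"]) simp
    next
      case (add y b s)
      then obtain f where f: "y = (\<Sum>a\<in>set as. f a * a)" by blast
      have "(\<Sum>a\<in>set as. (f a + (if a = s then b else 0)) * a)
          = y + (\<Sum>a\<in>set as. if a = s then b * s else 0)"
        unfolding f sum.distrib[symmetric] by (rule sum.cong) (auto simp: algebra_simps)
      then show ?case
        using add.hyps(3) by (intro exI[of _ "\<lambda>a. f a + (if a = s then b else 0)"]) simp
    qed
    then obtain f where f: "x - t = (\<Sum>a\<in>set as. f a * a)" using t(2) as(2) by blast
    let ?g = "restrict (\<lambda>a. \<tau> (f a)) (set as)"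
    have "a * (f a - \<tau> (f a)) \<in> Mp (Suc n)" if "a \<in> set as" for a
      using Mp_mult[of a n "f a - \<tau> (f a)" 1] as(1) that \<tau>(2)[of "f a"] by (auto simp: Mp_1)
    then have "(\<Sum>a\<in>set as. a * (f a - \<tau> (f a))) \<in> Mp (Suc n)" by (intro ideal_tring_sum[OF ideal_Mp])
    moreover have "x - (t + (\<Sum>a\<in>set as. ?g a * a)) = (\<Sum>a\<in>set as. a * (f a - \<tau> (f a)))"
      using f by (simp add: algebra_simps sum_subtractf)
    ultimately have "x - (t + (\<Sum>a\<in>set as. ?g a * a)) \<in> Mp (Suc n)" by (simp only:)
    moreover have "(t, ?g) \<in> T \<times> (set as \<rightarrow>\<^sub>E T1)" using t \<tau>(1) by auto
    then have "t + (\<Sum>a\<in>set as. ?g a * a) \<in> ?T'" by (rule rev_image_eqI) simp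
    ultimately show ?thesis by blast
  qed
  moreover have "finite ?T'" using T T1 by (intro finite_imageI finite_cartesian_product finite_PiE) auto
  ultimately show ?case by blast
qed

section \<open>Consequences of the Artin-Rees lemma\<close>

lemma principal_ideal: "ideal (range ((*) x)) (tring :: 'a ring)"
  unfolding ideal_tring_iff
proof (intro conjI ballI allI)
  show "0 \<in> range ((*) x)" by (metis mult_zero_right rangeI)
  fix y z a assume y: "y \<in> range ((*) x)"
  show "y + z \<in> range ((*) x)" if "z \<in> range ((*) x)" using y that by (auto simp flip: distrib_left)
  show "a * y \<in> range ((*) x)" using y by (auto simp: mult.left_commute)
qed

text \<open>The intersection of x R with M^n lies in x M^(n-c), and x can be cancelled in a domain.
  So division by x loses a bounded number of powers of M.\<close>

lemma artin_rees_mult: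
  assumes "x \<noteq> 0"
  shows "\<exists>c. \<forall>n r. x * r \<in> Mp n \<longrightarrow> r \<in> Mp (n - c)"
proof -
  obtain c where c: "\<And>n y. y \<in> range ((*) x) \<inter> Mp n \<Longrightarrow> y \<in> ideal_prod tring (range ((*) x)) (Mp (n - c))"
    using artin_rees[OF noeth ideal_M principal_ideal] by blast
  have "r \<in> Mp (n - c)" if "x * r \<in> Mp n" for n r
  proof -
    have "x * r \<in> ideal_prod tring (range ((*) x)) (Mp (n - c))" using c that by blast
    moreover have "\<exists>z\<in>Mp (n - c). y = x * z" if "y \<in> ideal_prod tring (range ((*) x)) (Mp (n - c))" for y
      using that
    proof (induction rule: ideal_prod_tring_induct)
      case (prod i j)
      then show ?case using Mp_closed(3) by (auto simp: mult.assoc)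
    next
      case (sum y z)
      then show ?case using Mp_closed(2) by (metis distrib_left)
    qed
    ultimately show ?thesis using assms by fastforce
  qed
  then show ?thesis by blast
qed

text \<open>This is the case of the ideal a R + b R. The given coefficients \<open>u\<close> and
  \<open>w\<close> need not be small; only some other pair representing the same element is.\<close>

lemma artin_rees_two:
  "\<exists>c. \<forall>n u w. a * u + b * w \<in> Mp n \<longrightarrow>
    (\<exists>u'\<in>Mp (n - c). \<exists>w'\<in>Mp (n - c). a * u + b * w = a * u' + b * w')"
proof -
  define J where "J = {a * u + b * w |u w. True}"
  have J: "ideal J (tring :: 'a ring)"
    unfolding ideal_tring_iff
  proof (intro conjI ballI allI)
    show "0 \<in> J" unfolding J_def by (auto intro!: exI[of _ 0])
    fix x y z assume x: "x \<in> J"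
    then obtain u w where x: "x = a * u + b * w" unfolding J_def by blast
    show "x + y \<in> J" if w: "y \<in> J"
    proof -
      obtain u' w' where y: "y = a * u' + b * w'" using w unfolding J_def by blast
      have "x + y = a * (u + u') + b * (w + w')" unfolding x y by (simp add: algebra_simps)
      then show ?thesis unfolding J_def by blast
    qed
    have "z * x = a * (z * u) + b * (z * w)" unfolding x by (simp add: algebra_simps)
    then show "z * x \<in> J" unfolding J_def by blast
  qed
  obtain c where c: "\<And>n y. y \<in> J \<inter> Mp n \<Longrightarrow> y \<in> ideal_prod tring J (Mp (n - c))"
    using artin_rees[OF noeth ideal_M J] by blast
  have "\<exists>u'\<in>Mp k. \<exists>w'\<in>Mp k. y = a * u' + b * w'" if "y \<in> ideal_prod tring J (Mp k)" for y k
    using that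
  proof (induction rule: ideal_prod_tring_induct)
    case (prod i j)
    then obtain u w where "i = a * u + b * w" unfolding J_def by blast
    then have "i * j = a * (u * j) + b * (w * j)" by (simp add: algebra_simps)
    then show ?case using Mp_closed(3) prod(2) by blast
  next
    case (sum y z)
    then obtain u w u' w' where "u \<in> Mp k" "w \<in> Mp k" "u' \<in> Mp k" "w' \<in> Mp k"
      "y = a * u + b * w" "z = a * u' + b * w'" by blast
    moreover have "a * u + b * w + (a * u' + b * w') = a * (u + u') + b * (w + w')" by (simp add: algebra_simps)
    ultimately show ?case using Mp_closed(2) by metis
  qed
  then show ?thesis using c unfolding J_def by (intro exI[of _ c]) blast
qed

text \<open>Apply Artin-Rees to J + x R: an approximation x - y in M^(c+1) lies in (J + x R) M, so
  (1 - m) x lies in J for some \<open>m\<close> in M, and 1 - m is a unit.\<close>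

lemma ideal_closed:
  assumes J: "ideal J (tring :: 'a ring)" and x: "\<And>k. \<exists>y\<in>J. x - y \<in> Mp k"
  shows "x \<in> J"
proof -
  note Jc = ideal_tring_closed[OF J] and Mc = ideal_tring_closed[OF ideal_M]
  define J' where "J' = {y + r * x |y r. y \<in> J}"
  have J': "ideal J' (tring :: 'a ring)"
    unfolding ideal_tring_iff
  proof (intro conjI ballI allI)
    show "0 \<in> J'" unfolding J'_def using Jc(1) by (auto intro!: exI[of _ 0])
    fix v w z assume v: "v \<in> J'"
    then obtain y r where y: "y \<in> J" "v = y + r * x" unfolding J'_def by blast
    show "v + w \<in> J'" if w: "w \<in> J'"
    proof -
      obtain y' r' where y': "y' \<in> J" "w = y' + r' * x" using w unfolding J'_def by blast
      have "v + w = (y + y') + (r + r') * x" unfolding y y' by (simp add: algebra_simps)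
      then show ?thesis unfolding J'_def using Jc(2)[OF y(1) y'(1)] by blast
    qed
    have "z * v = z * y + (z * r) * x" unfolding y by (simp add: algebra_simps)
    then show "z * v \<in> J'" unfolding J'_def using Jc(3)[OF y(1)] by blast
  qed
  obtain c where c: "\<And>n y. y \<in> J' \<inter> Mp n \<Longrightarrow> y \<in> ideal_prod tring J' (Mp (n - c))"
    using artin_rees[OF noeth ideal_M J'] by blast
  obtain y where y: "y \<in> J" "x - y \<in> Mp (Suc c)" using x by blast
  have "x - y = - y + 1 * x" by simp
  then have "x - y \<in> J'" unfolding J'_def using Jc(5)[OF y(1)] by blast
  then have "x - y \<in> ideal_prod tring J' (Mp (Suc c - c))" using c y(2) by blast
  then have "x - y \<in> ideal_prod tring J' M" by (simp add: Mp_1)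
  then have "\<exists>y'\<in>J. \<exists>m\<in>M. x - y = y' + m * x"
  proof (induction rule: ideal_prod_tring_induct)
    case (prod i j)
    then obtain y r where y: "y \<in> J" "i = y + r * x" unfolding J'_def by blast
    have "i * j = j * y + (r * j) * x" unfolding y by (simp add: algebra_simps)
    then show ?case using Jc(3)[OF y(1)] Mc(3)[OF prod(2)] by blast
  next
    case (sum v w)
    then obtain y m y' m' where "y \<in> J" "m \<in> M" "v = y + m * x" "y' \<in> J" "m' \<in> M" "w = y' + m' * x" by blast
    moreover have "y + m * x + (y' + m' * x) = (y + y') + (m + m') * x" by (simp add: algebra_simps)
    ultimately show ?case using Jc(2) Mc(2) by metis
  qed
  then obtain y' m where y': "y' \<in> J" "m \<in> M" "x - y = y' + m * x" by blast
  obtain u where u: "u * (1 - m) = 1" using one_minus_unit[OF y'(2)] by blast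
  have "(1 - m) * x = y + y'" using y'(3) by (simp add: algebra_simps)
  then have "u * (1 - m) * x = u * (y + y')" by (simp only: mult.assoc)
  then have "x = u * (y + y')" using u by simp
  then show ?thesis using Jc(3)[OF Jc(2)[OF y(1) y'(1)]] by simp
qed

text \<open>The ideals (a R : p^n) form an ascending chain, constant from \<open>c\<close> on. For e
  > c the equation a x = p^e y therefore gives p^c y = a z, and cancelling a leaves x = p^(e-c)
  z.\<close>

lemma colon_p_power:
  fixes a :: 'a
  assumes "a \<noteq> 0"
  shows "\<exists>e0. \<forall>e\<ge>e0. \<forall>x y. a * x = of_nat p ^ e * y \<longrightarrow> (\<exists>z. x = of_nat p * z)"
proof -
  define I where "I n = {y. of_nat p ^ n * y \<in> range ((*) a)}" for n
  have "ideal (I n) (tring :: 'a ring)" for n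
    unfolding ideal_tring_iff
  proof (intro conjI ballI allI)
    note pc = ideal_tring_closed[OF principal_ideal[of a]]
    show "0 \<in> I n" unfolding I_def using pc(1) by simp
    fix x y z assume x: "x \<in> I n"
    show "x + y \<in> I n" if "y \<in> I n"
      using pc(2)[of "of_nat p ^ n * x" "of_nat p ^ n * y"] x that unfolding I_def by (simp add: distrib_left)
    show "z * x \<in> I n"
      using pc(3)[of "of_nat p ^ n * x" z] x unfolding I_def by (simp add: mult.left_commute)
  qed
  moreover have "I n \<subseteq> I (Suc n)" for n
  proof
    fix y assume "y \<in> I n"
    then have "of_nat p * (of_nat p ^ n * y) \<in> range ((*) a)"
      unfolding I_def using ideal_tring_closed(3)[OF principal_ideal[of a]] by blast
    then show "y \<in> I (Suc n)" unfolding I_def by (simp add: mult.assoc)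
  qed
  ultimately obtain c where c: "\<And>n. n \<ge> c \<Longrightarrow> I n = I c"
    using noetherian_tring_chain[OF noeth, of I] by blast
  have "\<exists>z. x = of_nat p * z" if e: "e \<ge> Suc c" and x: "a * x = of_nat p ^ e * y" for e x y
  proof -
    have "of_nat p ^ e * y \<in> range ((*) a)" by (metis x rangeI)
    then have "y \<in> I e" unfolding I_def by simp
    then have "y \<in> I c" using c[of e] e by simp
    then obtain z where z: "of_nat p ^ c * y = a * z" unfolding I_def by blast
    have "e = Suc (e - Suc c) + c" using e by simp
    then have "of_nat p ^ e = (of_nat p ^ (Suc (e - Suc c) + c) :: 'a)" by simp
    then have pe: "of_nat p ^ e = of_nat p * of_nat p ^ (e - Suc c) * (of_nat p ^ c :: 'a)"
      by (simp only: power_add power_Suc)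
    have "a * x = of_nat p * of_nat p ^ (e - Suc c) * (of_nat p ^ c * y)"
      unfolding x pe by (simp only: mult.assoc)
    also have "\<dots> = a * (of_nat p * (of_nat p ^ (e - Suc c) * z))"
      unfolding z by (simp only: mult_ac)
    finally have "x = of_nat p * (of_nat p ^ (e - Suc c) * z)" using assms by simp
    then show ?thesis by blast
  qed
  then show ?thesis by blast
qed

text \<open>
  Krull's principal ideal theorem for \<open>p\<close>: if \<open>M\<^sup>n \<subseteq> p R\<close>, then \<open>R / p R\<close> is finite, so the
  chain of the ideals \<open>A\<^sub>k = a\<^sup>k R\<^sub>P \<inter> R\<close> becomes stationary modulo \<open>p\<close>, hence becomes
  stationary, although \<open>a\<close> is not a unit of \<open>R\<^sub>P\<close>.
\<close>

lemma Mp_not_subset_p: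
  assumes dim: "krull_dim (tring :: 'a ring) > 1"
  shows "\<not> Mp n \<subseteq> range ((*) (of_nat p))"
proof
  assume sub: "Mp n \<subseteq> range ((*) (of_nat p))"
  let ?p = "of_nat p :: 'a"
  obtain k P where P: "k \<ge> 2" "\<And>i. i \<le> k \<Longrightarrow> primeideal (P i) (tring :: 'a ring)" "\<And>i. i < k \<Longrightarrow> P i \<subset> P (Suc i)"
  proof -
    have "\<exists>e\<in>{enat n |n. \<exists>P :: nat \<Rightarrow> 'a set. (\<forall>i\<le>n. primeideal (P i) tring) \<and> (\<forall>i<n. P i \<subset> P (Suc i))}. 1 < e"
      using dim unfolding krull_dim_def less_Sup_iff .
    then obtain k and P :: "nat \<Rightarrow> 'a set" where "1 < enat k" "\<forall>i\<le>k. primeideal (P i) tring"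
      "\<forall>i<k. P i \<subset> P (Suc i)" by blast
    then show ?thesis by (intro that[of k P]) (auto simp: one_enat_def)
  qed
  let ?P = "P 1"
  have pr: "primeideal ?P (tring :: 'a ring)" using P by simp
  then interpret primeideal ?P "tring :: 'a ring" .
  have idP: "ideal ?P (tring :: 'a ring)" by (rule is_ideal)
  note Pc = ideal_tring_closed[OF idP]
  have prime: "x \<in> ?P \<or> y \<in> ?P" if "x * y \<in> ?P" for x y
    using I_prime[of x y] that by (simp add: ring_of_type_algebra_def)
  have one: "1 \<notin> ?P"
  proof
    assume "1 \<in> ?P"
    then have "?P = UNIV" using Pc(3)[of 1] by auto
    then show False using I_notcarr by (simp add: ring_of_type_algebra_def)
  qed
  have power: "x \<in> ?P" if "x ^ j \<in> ?P" for x j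
    using that by (induction j) (use one prime in auto)
  obtain a where a: "a \<in> ?P" "a \<noteq> 0"
  proof -
    have "P 0 \<subset> ?P" using P(3)[of 0] P(1) by simp
    moreover have "0 \<in> P 0" using P(2)[of 0] ideal_tring_closed(1) unfolding primeideal_def by auto
    ultimately show ?thesis using that by blast
  qed
  have MP: "\<not> M \<subseteq> ?P"
  proof
    assume "M \<subseteq> ?P"
    then have "?P = M" using M_maximal[OF idP] one by blast
    moreover have "?P \<subset> P 2" "ideal (P 2) (tring :: 'a ring)"
      using P(3)[of 1] P(2)[of 2] P(1) unfolding primeideal_def by (auto simp: numeral_2_eq_2)
    ultimately have "P 2 = UNIV" using M_maximal[of "P 2"] by blast
    then show False using primeideal.I_notcarr[OF P(2)[of 2]] P(1) by (simp add: ring_of_type_algebra_def)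
  qed
  \<comment> \<open>Otherwise M^n would lie in p R and hence in the prime ideal \<open>?P\<close>,
    which would then contain M.\<close>
  have pP: "?p \<notin> ?P"
  proof
    assume "?p \<in> ?P"
    then have "range ((*) ?p) \<subseteq> ?P" using Pc(4) by auto
    then have "x ^ n \<in> ?P" if "x \<in> M" for x
      using ideal_power_power[OF ideal_M, of x 1 n] that sub by (auto simp: Mp_1)
    then show False using MP power by blast
  qed
  define A where "A k = {x. \<exists>t. t \<notin> ?P \<and> t * x \<in> range ((*) (a ^ k))}" for k
  note ak = ideal_tring_closed[OF principal_ideal]
  have idA: "ideal (A k) (tring :: 'a ring)" for k
    unfolding ideal_tring_iff
  proof (intro conjI ballI allI)
    show "0 \<in> A k" unfolding A_def using one ak(1) by (auto intro!: exI[of _ 1])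
    fix x y z assume "x \<in> A k"
    then obtain t where t: "t \<notin> ?P" "t * x \<in> range ((*) (a ^ k))" unfolding A_def by blast
    show "x + y \<in> A k" if w: "y \<in> A k"
    proof -
      obtain t' where t': "t' \<notin> ?P" "t' * y \<in> range ((*) (a ^ k))" using w unfolding A_def by blast
      have "t * t' * (x + y) = t' * (t * x) + t * (t' * y)" by (simp add: algebra_simps)
      then have "t * t' * (x + y) \<in> range ((*) (a ^ k))"
        using ak(2)[OF ak(3)[OF t(2)] ak(3)[OF t'(2)]] by simp
      then show ?thesis unfolding A_def using prime t t' by blast
    qed
    have "t * (z * x) \<in> range ((*) (a ^ k))" using ak(3)[OF t(2), of z] by (simp add: mult.left_commute)
    then show "z * x \<in> A k" unfolding A_def using t by blast
  qed
  note Ac = ideal_tring_closed[OF idA]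
  have Adec: "A (Suc k) \<subseteq> A k" for k
    unfolding A_def by (auto simp: mult.assoc mult.left_commute[of a])
  define B where "B k = {x. \<exists>y\<in>A k. \<exists>r. x = y + ?p * r}" for k
  have Bdec: "B (Suc k) \<subseteq> B k" for k unfolding B_def using Adec by blast
  \<comment> \<open>Each \<open>B k\<close> contains p R and hence M^n, so it is determined by its
    intersection with the finite set \<open>T\<close>. An index with the fewest such elements ends
    the descent.\<close>
  obtain T where T: "finite T" "\<forall>x. \<exists>t\<in>T. x - t \<in> Mp n" using finite_reps by blast
  obtain k where k: "\<And>j. card (B k \<inter> T) \<le> card (B j \<inter> T)"
    using ex_has_least_nat[of "\<lambda>_. True" 0 "\<lambda>k. card (B k \<inter> T)"] by blast
  have "B k \<inter> T = B (Suc k) \<inter> T"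
    using card_seteq[of "B k \<inter> T" "B (Suc k) \<inter> T"] k[of "Suc k"] Bdec T(1) by blast
  have Bk: "B k \<subseteq> B (Suc k)"
  proof
    fix x assume x: "x \<in> B k"
    obtain t where t: "t \<in> T" "x - t \<in> Mp n" using T by blast
    then obtain r where r: "x - t = ?p * r" using sub by auto
    obtain y r' where y: "y \<in> A k" "x = y + ?p * r'" using x unfolding B_def by blast
    have "t = y + ?p * (r' - r)" using y r by (simp add: algebra_simps)
    then have "t \<in> B (Suc k)" using y(1) t(1) \<open>B k \<inter> T = B (Suc k) \<inter> T\<close> unfolding B_def by blast
    then obtain y' r'' where y': "y' \<in> A (Suc k)" "t = y' + ?p * r''" unfolding B_def by blast
    have "x = y' + ?p * (r'' + r)" using y' r by (simp add: algebra_simps)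
    then show "x \<in> B (Suc k)" unfolding B_def using y'(1) by blast
  qed
  \<comment> \<open>As p is invertible in the localization at \<open>?P\<close>, p^j r in
    \<open>A k\<close> implies r in \<open>A k\<close>. So the inclusion of \<open>A k\<close> in
    \<open>A (Suc k)\<close> modulo p can be iterated to hold modulo every p^j.\<close>
  have Aj: "\<exists>y\<in>A (Suc k). \<exists>r. x = y + ?p ^ j * r" if "x \<in> A k" for x j
  proof (induction j)
    case 0
    then show ?case using Ac(1) by (intro bexI[of _ 0] exI[of _ x]) auto
  next
    case (Suc j)
    then obtain y r where y: "y \<in> A (Suc k)" "x = y + ?p ^ j * r" by blast
    have "?p ^ j * r = x - y" using y by simp
    then have "?p ^ j * r \<in> A k" using Ac(6)[OF that] y(1) Adec by auto
    then obtain t where t: "t \<notin> ?P" "t * (?p ^ j * r) \<in> range ((*) (a ^ k))" unfolding A_def by blast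
    have "t * ?p ^ j \<notin> ?P" using prime t(1) power pP by blast
    then have "r \<in> A k" unfolding A_def using t(2) by (auto simp: mult.assoc intro!: exI[of _ "t * ?p ^ j"])
    then have "r \<in> B k" unfolding B_def by (auto intro!: bexI[of _ r] exI[of _ 0])
    then obtain y' r' where y': "y' \<in> A (Suc k)" "r = y' + ?p * r'" using Bk unfolding B_def by blast
    have "x = (y + ?p ^ j * y') + ?p ^ Suc j * r'" unfolding y(2) y'(2) by (simp add: algebra_simps)
    then show ?case using Ac(2)[OF y(1) Ac(3)[OF y'(1)]] by blast
  qed
  have "a ^ k \<in> A k" unfolding A_def using one by (auto intro!: exI[of _ 1] image_eqI[of _ _ 1])
  \<comment> \<open>Ideals are closed, so approximation modulo all p^j suffices. Membership makes a
    divide an element \<open>t\<close> outside \<open>?P\<close>, which is absurd since a lies in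
    \<open>?P\<close>.\<close>
  then have "a ^ k \<in> A (Suc k)"
  proof (intro ideal_closed[OF idA])
    fix j
    obtain y r where "y \<in> A (Suc k)" "a ^ k = y + ?p ^ j * r" using Aj[OF \<open>a ^ k \<in> A k\<close>] by blast
    moreover have "?p ^ j * r \<in> Mp j" using p_power_in Mp_closed(4) by blast
    ultimately show "\<exists>y\<in>A (Suc k). a ^ k - y \<in> Mp j" by (intro bexI[of _ y]) auto
  qed
  then obtain t r where t: "t \<notin> ?P" "t * a ^ k = a ^ Suc k * r" unfolding A_def by auto
  then have "a ^ k * t = a ^ k * (a * r)" by (simp add: algebra_simps)
  then have "t = a * r" using a(2) by simp
  then show False using t(1) Pc(4)[OF a(1)] by simp
qed

end

section \<open>Subgroups of finite index and of finitely generated abelian groups\<close>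

text \<open>Schreier's lemma: the products of an element generated by \<open>Y\<close> with an
  element of \<open>T'\<close> include the unit and are stable under right multiplication by
  \<open>S'\<close>, so they exhaust the subgroup generated by \<open>S\<close>. Only the part of
  \<open>H\<close> inside that subgroup is reached, since \<open>S\<close> will generate G only
  topologically.\<close>

lemma (in group) schreier_generators:
  assumes S: "S \<subseteq> carrier G" "finite S" and H: "subgroup H G" and T: "T \<subseteq> carrier G" "finite T"
    and reps: "\<And>x. x \<in> carrier G \<Longrightarrow> \<exists>t\<in>T. x \<otimes> inv t \<in> H"
  shows "\<exists>Y. finite Y \<and> Y \<subseteq> H \<and> generate G S \<inter> H \<subseteq> generate G Y"
proof -
  define T' where "T' = insert \<one> T"
  define S' where "S' = S \<union> (\<lambda>s. inv s) ` S"
  \<comment> \<open>\<open>T'\<close> is no transversal: it may contain several elements of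
    \<open>H\<close>. Adding these to \<open>Y\<close> absorbs a last factor that lies in
    \<open>H\<close> without being the unit.\<close>
  define Y where "Y = ((\<lambda>(t, s, t'). t \<otimes> s \<otimes> inv t') ` (T' \<times> S' \<times> T') \<union> T') \<inter> H"
  have T': "T' \<subseteq> carrier G" "finite T'" "\<one> \<in> T'" unfolding T'_def using T by auto
  have S': "S' \<subseteq> carrier G" "finite S'" unfolding S'_def using S by auto
  have Y: "finite Y" "Y \<subseteq> H" unfolding Y_def using T' S' by auto
  have HC: "H \<subseteq> carrier G" using H subgroup.subset by blast
  have genY: "generate G Y \<subseteq> H" using generate_subgroup_incl[OF Y(2) H] .
  define Z where "Z = {y \<otimes> t |y t. y \<in> generate G Y \<and> t \<in> T'}"
  have ZC: "Z \<subseteq> carrier G" unfolding Z_def using genY HC T' by auto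
  have step: "w \<otimes> s \<in> Z" if "w \<in> Z" "s \<in> S'" for w s
  proof -
    obtain y t where w: "w = y \<otimes> t" "y \<in> generate G Y" "t \<in> T'" using \<open>w \<in> Z\<close> unfolding Z_def by blast
    have c: "y \<in> carrier G" "t \<in> carrier G" "s \<in> carrier G" using w genY HC T' S' that by auto
    obtain t' where t': "t' \<in> T" "t \<otimes> s \<otimes> inv t' \<in> H" using reps[of "t \<otimes> s"] c by auto
    have t'c: "t' \<in> carrier G" "t' \<in> T'" using t' T unfolding T'_def by auto
    have "t \<otimes> s \<otimes> inv t' \<in> Y" unfolding Y_def using w(3) that t' t'c by force
    then have "y \<otimes> (t \<otimes> s \<otimes> inv t') \<in> generate G Y"
      by (intro generate.eng[OF w(2)] generate.incl)
    moreover have "w \<otimes> s = y \<otimes> (t \<otimes> s \<otimes> inv t') \<otimes> t'" unfolding w(1) using c t'c by (simp add: m_assoc)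
    ultimately show ?thesis unfolding Z_def using t'c by blast
  qed
  have "\<forall>w\<in>Z. w \<otimes> g \<in> Z" if "g \<in> generate G S" for g
    using that
  proof induction
    case one
    then show ?case using ZC by auto
  next
    case (incl h)
    then show ?case using step unfolding S'_def by blast
  next
    case (inv h)
    then show ?case using step unfolding S'_def by blast
  next
    case (eng h1 h2)
    have "h1 \<in> carrier G" "h2 \<in> carrier G" using eng generate_in_carrier[OF S(1)] by auto
    then show ?case using eng ZC by (metis m_assoc subsetD)
  qed
  moreover have "\<one> \<otimes> \<one> \<in> Z" unfolding Z_def using T' generate.one by blast
  ultimately have genZ: "g \<in> Z" if "g \<in> generate G S" for g
    using that generate_in_carrier[OF S(1) that] by fastforce
  have "g \<in> generate G Y" if g: "g \<in> generate G S" "g \<in> H" for g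
  proof -
    obtain y t where w: "g = y \<otimes> t" "y \<in> generate G Y" "t \<in> T'" using genZ[OF g(1)] unfolding Z_def by blast
    have c: "y \<in> H" "y \<in> carrier G" "t \<in> carrier G" using w genY HC T' by auto
    have "inv y \<otimes> g \<in> H" using subgroup.m_closed[OF H subgroup.m_inv_closed[OF H c(1)] g(2)] .
    then have "t \<in> H" using w(1) c by (simp add: m_assoc[symmetric])
    then have "t \<in> Y" unfolding Y_def using w(3) by blast
    then show ?thesis unfolding w(1) by (intro generate.eng[OF w(2)] generate.incl)
  qed
  then show ?thesis using Y by blast
qed

section \<open>Subgroups of finitely generated abelian groups\<close>

lemma int_subgroup_principal:
  fixes I :: "int set"
  assumes zero: "0 \<in> I" and diff: "\<And>x y. x \<in> I \<Longrightarrow> y \<in> I \<Longrightarrow> x - y \<in> I"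
  shows "\<exists>m\<in>I. \<forall>x\<in>I. m dvd x"
proof (cases "I = {0}")
  case False
  have neg: "- x \<in> I" if "x \<in> I" for x using diff[OF zero that] by simp
  obtain y where y: "y \<in> I" "y \<noteq> 0" using False zero by blast
  have "\<bar>y\<bar> \<in> I" "\<bar>y\<bar> > 0" using neg[OF y(1)] y by (simp_all add: abs_if)
  then have ex: "\<exists>n. n > 0 \<and> int n \<in> I" by (intro exI[of _ "nat \<bar>y\<bar>"]) auto
  define n where "n = (LEAST n. n > 0 \<and> int n \<in> I)"
  have n: "n > 0" "int n \<in> I" using LeastI_ex[OF ex] unfolding n_def by auto
  have mult: "int n * int k \<in> I" for k
  proof (induction k)
    case (Suc k)
    have "int n * int k - (- int n) \<in> I" using diff[OF Suc neg[OF n(2)]] .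
    then show ?case by (simp add: algebra_simps)
  qed (use zero in simp)
  have multi: "int n * k \<in> I" for k
  proof (cases "k \<ge> 0")
    case True
    then show ?thesis using mult[of "nat k"] by simp
  next
    case False
    then show ?thesis using neg[OF mult[of "nat (- k)"]] by simp
  qed
  have "int n dvd x" if "x \<in> I" for x
  proof -
    have r: "x mod int n \<in> I" unfolding minus_mult_div_eq_mod[symmetric] by (rule diff[OF that multi])
    have "x mod int n = 0"
    proof (rule ccontr)
      assume "x mod int n \<noteq> 0"
      then have pos: "x mod int n > 0" using pos_mod_sign[of "int n" x] n(1) by linarith
      have "nat (x mod int n) > 0 \<and> int (nat (x mod int n)) \<in> I" using pos r by simp
      then have "n \<le> nat (x mod int n)" unfolding n_def by (rule Least_le)
      then show False using pos_mod_bound[of "int n" x] n(1) by linarith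
    qed
    then show ?thesis by auto
  qed
  then show ?thesis using n by blast
qed auto

text \<open>The \<open>b k\<close> need not lie in T; T / A is only contained in the group they
  generate modulo A. As for subgroups of Z^r, induction on \<open>r\<close> replaces them by as many
  elements of T itself.\<close>

lemma subgroup_generators:
  fixes b :: "nat \<Rightarrow> 'a::comm_ring_1"
  assumes "0 \<in> A" "\<And>x y. x \<in> A \<Longrightarrow> y \<in> A \<Longrightarrow> x - y \<in> A"
    and "A \<subseteq> T" "\<And>x y. x \<in> T \<Longrightarrow> y \<in> T \<Longrightarrow> x - y \<in> T"
    and "\<And>t. t \<in> T \<Longrightarrow> \<exists>n. t - (\<Sum>k<r. of_int (n k) * b k) \<in> A"
  shows "\<exists>c. (\<forall>k<r. c k \<in> T) \<and> (\<forall>t\<in>T. \<exists>n. t - (\<Sum>k<r. of_int (n k) * c k) \<in> A)"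
  using assms(3-)
proof (induction r arbitrary: T)
  case 0
  then show ?case by auto
next
  case (Suc r)
  let ?s = "\<lambda>n. \<Sum>k<r. of_int (n k) * b k"
  \<comment> \<open>The possible last coefficients form a subgroup of the integers. An element
    \<open>c0\<close> of T realizes its generator \<open>m\<close>, and the elements with last
    coefficient 0 form \<open>T'\<close>, to which the induction applies.\<close>
  define I where "I = {m. \<exists>t\<in>T. \<exists>n. t - (?s n + of_int m * b r) \<in> A}"
  have A0: "- x \<in> A" if "x \<in> A" for x using assms(2)[OF assms(1) that] by simp
  have Aadd: "x + y \<in> A" if "x \<in> A" "y \<in> A" for x y using assms(2)[OF that(1) A0[OF that(2)]] by simp
  have T0: "0 \<in> T" using Suc.prems(1) assms(1) by blast
  have Tneg: "- x \<in> T" if "x \<in> T" for x using Suc.prems(2)[OF T0 that] by simp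
  have Tadd: "x + y \<in> T" if "x \<in> T" "y \<in> T" for x y using Suc.prems(2)[OF that(1) Tneg[OF that(2)]] by simp
  have Tmult: "of_int m * x \<in> T" if "x \<in> T" for m x
  proof -
    have n: "of_nat k * x \<in> T" for k by (induction k) (use T0 Tadd that in \<open>auto simp: algebra_simps\<close>)
    show ?thesis
    proof (cases "m \<ge> 0")
      case True
      then show ?thesis using n[of "nat m"] by simp
    next
      case False
      then show ?thesis using Tneg[OF n[of "nat (- m)"]] by simp
    qed
  qed
  have sdiff: "?s (\<lambda>k. n k - n' k) = ?s n - ?s n'" for n n' by (simp add: algebra_simps sum_subtractf)
  have smult: "?s (\<lambda>k. q * n k) = of_int q * ?s n" for n q by (simp add: sum_distrib_left mult.assoc)
  have "\<exists>m\<in>I. \<forall>x\<in>I. m dvd x"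
  proof (rule int_subgroup_principal)
    show "0 \<in> I" unfolding I_def using T0 assms(1) by (auto intro!: bexI[of _ 0] exI[of _ "\<lambda>_. 0"])
    fix x y assume "x \<in> I" "y \<in> I"
    then obtain t n t' n' where t: "t \<in> T" "t - (?s n + of_int x * b r) \<in> A"
      "t' \<in> T" "t' - (?s n' + of_int y * b r) \<in> A" unfolding I_def by blast
    have "(t - t') - (?s (\<lambda>k. n k - n' k) + of_int (x - y) * b r) \<in> A"
      using assms(2)[OF t(2,4)] unfolding sdiff by (simp add: algebra_simps)
    then show "x - y \<in> I"
      unfolding I_def
      by (intro CollectI bexI[OF _ Suc.prems(2)[OF t(1,3)]]) (rule exI[of _ "\<lambda>k. n k - n' k"])
  qed
  then obtain m where m: "m \<in> I" "\<And>x. x \<in> I \<Longrightarrow> m dvd x" by blast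
  then obtain c0 n0 where c0: "c0 \<in> T" "c0 - (?s n0 + of_int m * b r) \<in> A" unfolding I_def by blast
  define T' where "T' = {t \<in> T. \<exists>n. t - ?s n \<in> A}"
  have "\<exists>c. (\<forall>k<r. c k \<in> T') \<and> (\<forall>t\<in>T'. \<exists>n. t - (\<Sum>k<r. of_int (n k) * c k) \<in> A)"
  proof (rule Suc.IH)
    show "A \<subseteq> T'" unfolding T'_def using Suc.prems(1) by (auto intro!: exI[of _ "\<lambda>_. 0"])
    fix x y assume "x \<in> T'" "y \<in> T'"
    then obtain n n' where t: "x \<in> T" "x - ?s n \<in> A" "y \<in> T" "y - ?s n' \<in> A" unfolding T'_def by blast
    have "(x - y) - ?s (\<lambda>k. n k - n' k) \<in> A"
      using assms(2)[OF t(2,4)] unfolding sdiff by (simp add: algebra_simps)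
    then show "x - y \<in> T'"
      unfolding T'_def by (intro CollectI conjI Suc.prems(2)[OF t(1,3)]) (rule exI[of _ "\<lambda>k. n k - n' k"])
  qed (auto simp: T'_def)
  then obtain c where c: "\<And>k. k < r \<Longrightarrow> c k \<in> T'" "\<And>t. t \<in> T' \<Longrightarrow> \<exists>n. t - (\<Sum>k<r. of_int (n k) * c k) \<in> A"
    by blast
  have "\<exists>n. t - (\<Sum>k<Suc r. of_int (n k) * (c(r := c0)) k) \<in> A" if t: "t \<in> T" for t
  proof -
    obtain n where n: "t - (\<Sum>k<Suc r. of_int (n k) * b k) \<in> A" using Suc.prems(3)[OF t] by blast
    then have tn: "t - (?s n + of_int (n r) * b r) \<in> A" by simp
    then have "n r \<in> I" unfolding I_def using t by blast
    then obtain q where q: "n r = m * q" using m(2) by blast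
    have Amult: "of_int q * x \<in> A" if "x \<in> A" for x
    proof -
      have n: "of_nat k * x \<in> A" for k by (induction k) (use assms(1) Aadd that in \<open>auto simp: algebra_simps\<close>)
      show ?thesis
      proof (cases "q \<ge> 0")
        case True
        then show ?thesis using n[of "nat q"] by simp
      next
        case False
        then show ?thesis using A0[OF n[of "nat (- q)"]] by simp
      qed
    qed
    have "t - of_int q * c0 - ?s (\<lambda>k. n k - q * n0 k)
        = t - (?s n + of_int (n r) * b r) - of_int q * (c0 - (?s n0 + of_int m * b r))"
      unfolding sdiff[of n "\<lambda>k. q * n0 k"] smult q by (simp add: algebra_simps)
    also have "\<dots> \<in> A" using assms(2)[OF tn Amult[OF c0(2)]] .
    finally have "t - of_int q * c0 \<in> T'"
      unfolding T'_def
      by (intro CollectI conjI Suc.prems(2)[OF t Tmult[OF c0(1)]]) (rule exI[of _ "\<lambda>k. n k - q * n0 k"])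
    then obtain n' where "t - of_int q * c0 - (\<Sum>k<r. of_int (n' k) * c k) \<in> A" using c(2) by blast
    moreover have "(\<Sum>k<Suc r. of_int ((n'(r := q)) k) * (c(r := c0)) k)
        = (\<Sum>k<r. of_int (n' k) * c k) + of_int q * c0" by simp
    ultimately show ?thesis by (intro exI[of _ "n'(r := q)"]) (simp only: diff_diff_eq add.commute)
  qed
  moreover have "\<forall>k<Suc r. (c(r := c0)) k \<in> T" using c(1) c0(1) unfolding T'_def by (auto simp: less_Suc_eq)
  ultimately show ?case by blast
qed

text \<open>T / A has r generators, so T modulo A + p T has at most p^r elements, and two among p^r
  + 1 given ones coincide there.\<close>

lemma congruent_mod_p:
  fixes b t :: "nat \<Rightarrow> 'a::comm_ring_1" and p :: nat
  assumes p: "p > 0" and A: "0 \<in> A" "\<And>x y. x \<in> A \<Longrightarrow> y \<in> A \<Longrightarrow> x - y \<in> A"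
    and T: "A \<subseteq> T" "\<And>x y. x \<in> T \<Longrightarrow> y \<in> T \<Longrightarrow> x - y \<in> T"
    and gen: "\<And>t. t \<in> T \<Longrightarrow> \<exists>n. t - (\<Sum>k<r. of_int (n k) * b k) \<in> A"
    and t: "\<And>i. i \<le> p ^ r \<Longrightarrow> t i \<in> T"
  shows "\<exists>i j. i < j \<and> j \<le> p ^ r \<and> (\<exists>u\<in>T. t i - t j - of_nat p * u \<in> A)"
proof -
  obtain c where c: "\<And>k. k < r \<Longrightarrow> c k \<in> T" "\<And>t. t \<in> T \<Longrightarrow> \<exists>n. t - (\<Sum>k<r. of_int (n k) * c k) \<in> A"
    using subgroup_generators[OF A T gen] by blast
  have "\<forall>i. \<exists>n. i \<le> p ^ r \<longrightarrow> t i - (\<Sum>k<r. of_int (n k) * c k) \<in> A" using c(2) t by blast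
  then obtain n where n: "\<And>i. i \<le> p ^ r \<Longrightarrow> t i - (\<Sum>k<r. of_int (n i k) * c k) \<in> A" by metis
  define f where "f i = restrict (\<lambda>k. n i k mod int p) {..<r}" for i
  have "f ` {..p ^ r} \<subseteq> {..<r} \<rightarrow>\<^sub>E {0..<int p}" unfolding f_def using p by (auto split: if_splits)
  then have "card (f ` {..p ^ r}) \<le> card ({..<r} \<rightarrow>\<^sub>E {0..<int p})"
    by (intro card_mono finite_PiE) auto
  also have "\<dots> = p ^ r" by (simp add: card_PiE)
  finally have "card (f ` {..p ^ r}) < card {..p ^ r}" by simp
  then have "\<not> inj_on f {..p ^ r}" using pigeonhole by blast
  then obtain i j where ij: "i \<le> p ^ r" "j \<le> p ^ r" "i < j" "f i = f j"
    unfolding inj_on_def by (metis atMost_iff linorder_neqE_nat)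
  define q where "q k = (n i k - n j k) div int p" for k
  have q: "n i k = n j k + int p * q k" if "k < r" for k
  proof -
    have "n i k mod int p = n j k mod int p" using fun_cong[OF ij(4), of k] that unfolding f_def by simp
    then have "int p dvd n i k - n j k" by (simp add: mod_eq_dvd_iff)
    then show ?thesis unfolding q_def by simp
  qed
  have T0: "0 \<in> T" using T(1) A(1) by blast
  have Tneg: "- x \<in> T" if "x \<in> T" for x using T(2)[OF T0 that] by simp
  have Tadd: "x + y \<in> T" if "x \<in> T" "y \<in> T" for x y using T(2)[OF that(1) Tneg[OF that(2)]] by simp
  have Tmult: "of_int m * x \<in> T" if "x \<in> T" for m x
  proof -
    have n: "of_nat k * x \<in> T" for k by (induction k) (use T0 Tadd that in \<open>auto simp: algebra_simps\<close>)
    show ?thesis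
    proof (cases "m \<ge> 0")
      case True
      then show ?thesis using n[of "nat m"] by simp
    next
      case False
      then show ?thesis using Tneg[OF n[of "nat (- m)"]] by simp
    qed
  qed
  let ?u = "\<Sum>k<r. of_int (q k) * c k"
  have "(\<Sum>k<m. of_int (q k) * c k) \<in> T" if "m \<le> r" for m
    using that by (induction m) (use T0 Tadd Tmult c(1) in auto)
  then have "?u \<in> T" by blast
  moreover have "(\<Sum>k<r. of_int (n i k) * c k) = (\<Sum>k<r. of_int (n j k) * c k) + of_nat p * ?u"
    unfolding sum_distrib_left sum.distrib[symmetric] by (rule sum.cong) (auto simp: q algebra_simps)
  then have "t i - t j - of_nat p * ?u
      = (t i - (\<Sum>k<r. of_int (n i k) * c k)) - (t j - (\<Sum>k<r. of_int (n j k) * c k))" by simp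
  then have "t i - t j - of_nat p * ?u \<in> A" using A(2)[OF n[OF ij(1)] n[OF ij(2)]] by (simp only:)
  ultimately show ?thesis using ij by blast
qed

section \<open>Standard groups\<close>

locale standard_group_setting = pro_p_domain p M + fgl_idom d F
  for p :: nat and M :: "'a::idom set" and d :: nat and F :: "nat \<Rightarrow> (nat + nat, 'a) mps"
begin

abbreviation G :: "(nat \<Rightarrow> 'a) monoid" where "G \<equiv> standard_group M d F"

text \<open>The value of \<open>ev\<close> does not involve the filtration, so the same truncated
  evaluation can be estimated with M^K for every K.\<close>

abbreviation pe :: "'v set \<Rightarrow> nat \<Rightarrow> ('v \<Rightarrow> 'a) \<Rightarrow> ('v, 'a) mps \<Rightarrow> 'a" where
  "pe \<equiv> filtered_algebra.ev (\<lambda>x. x)"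

abbreviation xy :: "(nat \<Rightarrow> 'a) \<Rightarrow> (nat \<Rightarrow> 'a) \<Rightarrow> nat + nat \<Rightarrow> 'a" where "xy \<equiv> case_sum"

text \<open>Coordinates in M^K count as degree one here, so cutting off at degree s leaves an error
  in M^(K (s + 1)).\<close>

lemma filtered_Mp: "filtered_algebra (\<lambda>n. Mp (K * n)) (\<lambda>x. x)"
proof unfold_locales
  show "x * y \<in> Mp (K * (m + n))" if "x \<in> Mp (K * m)" "y \<in> Mp (K * n)" for x y m n
    using Mp_mult[OF that] by (simp add: distrib_left)
  show "Mp (K * Suc n) \<subseteq> Mp (K * n)" for n
    using ideal_power_antimono[OF ideal_M] by simp
qed (auto simp: ideal_power_0 Mp_closed)

lemma filtered_Mp1: "filtered_algebra Mp (\<lambda>x. x)"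
  using filtered_Mp[of 1] by simp

lemma mps_eval_limit:
  assumes V: "finite V" and x: "\<forall>v\<in>V. x v \<in> M"
  shows "n \<le> i \<Longrightarrow> pe V i x f - mps_eval M V f x \<in> Mp n"
proof -
  interpret f: filtered_algebra Mp "\<lambda>x. x" by (rule filtered_Mp1)
  have x1: "\<forall>v\<in>V. x v \<in> Mp 1" using x by (simp add: Mp_1)
  have cauchy: "pe V i x f - pe V j x f \<in> Mp n" if "n \<le> i" "n \<le> j" for n i j
  proof -
    have "pe V i x f - pe V n x f \<in> Mp n" "pe V j x f - pe V n x f \<in> Mp n"
      using f.ev_truncate[OF V x1] that f.E_Suc by blast+
    then show ?thesis using f.E_diff_trans f.E_diff_sym by blast
  qed
  obtain l where l: "\<forall>n i. n \<le> i \<longrightarrow> pe V i x f - l \<in> Mp n"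
    "limitin (adic_topology M) (\<lambda>i. pe V i x f) l sequentially"
    "\<forall>l'. limitin (adic_topology M) (\<lambda>i. pe V i x f) l' sequentially \<longrightarrow> l' = l"
  proof -
    have "\<exists>l. (\<forall>n i. n \<le> i \<longrightarrow> pe V i x f - l \<in> Mp n)
        \<and> limitin (adic_topology M) (\<lambda>i. pe V i x f) l sequentially
        \<and> (\<forall>l'. limitin (adic_topology M) (\<lambda>i. pe V i x f) l' sequentially \<longrightarrow> l' = l)"
      by (rule Mp_limit) (rule cauchy)
    then show thesis by (elim exE conjE) (rule that)
  qed
  have "mps_eval M V f x = (THE l. limitin (adic_topology M) (\<lambda>i. pe V i x f) l sequentially)"
    unfolding mps_eval_def f.ev_def ..
  also have "\<dots> = l" using l(2) by (rule the_equality) (rule l(3)[rule_format])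
  finally have "mps_eval M V f x = l" .
  then show "n \<le> i \<Longrightarrow> pe V i x f - mps_eval M V f x \<in> Mp n" using l(1) by simp
qed

lemma mps_eval_approx:
  assumes V: "finite V" and x: "\<forall>v\<in>V. x v \<in> Mp K" and K: "K \<ge> 1"
  shows "mps_eval M V f x - pe V s x f \<in> Mp (K * Suc s)"
proof -
  interpret f: filtered_algebra "\<lambda>n. Mp (K * n)" "\<lambda>x. x" by (rule filtered_Mp)
  have xM: "\<forall>v\<in>V. x v \<in> M" using x Mp_anti[OF K] by (auto simp: Mp_1)
  have x1: "\<forall>v\<in>V. x v \<in> Mp (K * 1)" using x by simp
  let ?i = "K * Suc s"
  have "s \<le> ?i" using K by (cases K) auto
  have "pe V ?i x f - mps_eval M V f x \<in> Mp (K * Suc s)" by (rule mps_eval_limit[OF V xM]) simp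
  moreover have "pe V ?i x f - pe V s x f \<in> Mp (K * Suc s)" by (rule f.ev_truncate[OF V x1 \<open>s \<le> ?i\<close>])
  ultimately show ?thesis using f.E_diff_trans[OF f.E_diff_sym] by blast
qed

text \<open>The product of G without the restriction to the index set \<open>{..<d}\<close>, so that
  intermediate tuples need not be extensional.\<close>

definition mul :: "(nat \<Rightarrow> 'a) \<Rightarrow> (nat \<Rightarrow> 'a) \<Rightarrow> nat \<Rightarrow> 'a" where
  "mul x y i = mps_eval M (xy_vars d) (F i) (xy x y)"

abbreviation in_level :: "nat \<Rightarrow> (nat \<Rightarrow> 'a) \<Rightarrow> bool" where
  "in_level K x \<equiv> \<forall>j<d. x j \<in> Mp K"

lemma in_level_xy: "in_level K x \<Longrightarrow> in_level K y \<Longrightarrow> \<forall>v\<in>xy_vars d. xy x y v \<in> Mp K"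
  by (auto simp: xy_vars_def)

lemma in_level_anti: "K \<ge> 1 \<Longrightarrow> in_level K x \<Longrightarrow> in_level 1 x"
  using Mp_anti by blast

lemma mul_approx:
  "K \<ge> 1 \<Longrightarrow> in_level K x \<Longrightarrow> in_level K y \<Longrightarrow> mul x y i - pe (xy_vars d) s (xy x y) (F i) \<in> Mp (K * Suc s)"
  unfolding mul_def by (rule mps_eval_approx[OF finite_xy_vars in_level_xy])

lemma mul_level:
  assumes K: "K \<ge> 1" and x: "in_level K x" and y: "in_level K y"
  shows "in_level K (mul x y)"
proof (intro allI impI)
  fix i assume i: "i < d"
  interpret f: filtered_algebra "\<lambda>n. Mp (K * n)" "\<lambda>x. x" by (rule filtered_Mp)
  have "pe (xy_vars d) 0 (xy x y) (F i) \<in> Mp (K * 1)"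
    using F_order[OF i] in_level_xy[OF x y] unfolding order_ge_def
    by (intro f.ev_order[OF finite_xy_vars]) auto
  moreover have "mul x y i - pe (xy_vars d) 0 (xy x y) (F i) \<in> Mp (K * 1)"
    using mul_approx[OF K x y, of i 0] by simp
  ultimately show "mul x y i \<in> Mp K" using f.E_add by fastforce
qed

lemma mul_cong:
  assumes x: "in_level 1 x" "in_level 1 x'" and y: "in_level 1 y" "in_level 1 y'"
    and n: "\<And>j. j < d \<Longrightarrow> x j - x' j \<in> Mp n" "\<And>j. j < d \<Longrightarrow> y j - y' j \<in> Mp n"
  shows "mul x y i - mul x' y' i \<in> Mp n"
proof (cases n)
  case 0
  then show ?thesis by (simp add: ideal_power_0)
next
  case (Suc k)
  interpret f: filtered_algebra Mp "\<lambda>x. x" by (rule filtered_Mp1)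
  have "mul x y i - pe (xy_vars d) k (xy x y) (F i) \<in> Mp n"
    "mul x' y' i - pe (xy_vars d) k (xy x' y') (F i) \<in> Mp n"
    using mul_approx[OF _ x(1) y(1), of i k] mul_approx[OF _ x(2) y(2), of i k] Suc by simp_all
  moreover have "pe (xy_vars d) k (xy x y) (F i) - pe (xy_vars d) k (xy x' y') (F i) \<in> Mp n"
    unfolding Suc using n
    by (intro f.ev_point_cong[OF finite_xy_vars in_level_xy[OF x(1) y(1)] in_level_xy[OF x(2) y(2)]])
      (auto simp: xy_vars_def Suc)
  ultimately show ?thesis using f.E_diff_trans f.E_diff_sym by blast
qed

lemma mul_assoc:
  assumes x: "in_level 1 x" and y: "in_level 1 y" and z: "in_level 1 z" and i: "i < d"
  shows "mul (mul x y) z i = mul x (mul y z) i"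
proof -
  interpret f: filtered_algebra Mp "\<lambda>x. x" by (rule filtered_Mp1)
  have "mul (mul x y) z i - mul x (mul y z) i \<in> Mp n" for n
  proof -
    let ?s = "Suc n"
    let ?N = "\<lambda>x y i. pe (xy_vars d) ?s (xy x y) (F i)"
    have approx: "mul x' y' j - ?N x' y' j \<in> Mp (Suc ?s)" if "in_level 1 x'" "in_level 1 y'" for x' y' j
      using mul_approx[OF _ that, of j ?s] by simp
    have N_level: "in_level 1 (?N x' y')" if "in_level 1 x'" "in_level 1 y'" for x' y'
      using F_order in_level_xy[OF that] unfolding order_ge_def
      by (intro allI impI f.ev_order[OF finite_xy_vars]) auto
    have a1: "mul (mul x y) z i - mul (?N x y) z i \<in> Mp (Suc ?s)"
      using approx[OF x y] f.E_zero by (intro mul_cong[OF mul_level[OF _ x y] N_level[OF x y] z z]) auto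
    have a2: "mul x (mul y z) i - mul x (?N y z) i \<in> Mp (Suc ?s)"
      using approx[OF y z] f.E_zero by (intro mul_cong[OF x x mul_level[OF _ y z] N_level[OF y z]]) auto
    note a3 = approx[OF N_level[OF x y] z, of i] and a4 = approx[OF x N_level[OF y z], of i]
    have a5: "?N (?N x y) z i - ?N x (?N y z) i \<in> Mp (Suc ?s)"
      by (rule ev_assoc[OF filtered_Mp1 x y z _ i]) simp
    have "mul (mul x y) z i - mul x (mul y z) i \<in> Mp (Suc ?s)"
      by (rule f.E_diff_trans[OF a1 f.E_diff_trans[OF a3 f.E_diff_trans[OF a5
            f.E_diff_trans[OF f.E_diff_sym[OF a4] f.E_diff_sym[OF a2]]]]])
    then show ?thesis using Mp_anti[of n "Suc ?s"] by simp
  qed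
  then show ?thesis using Mp_separated by fastforce
qed

lemma mul_zero_left:
  assumes x: "in_level 1 x" and i: "i < d"
  shows "mul (\<lambda>_. 0) x i = x i"
proof -
  interpret f: filtered_algebra Mp "\<lambda>x. x" by (rule filtered_Mp1)
  let ?s = "Poly_Mapping.single (Inr i) (1::nat) :: nat + nat \<Rightarrow>\<^sub>0 nat"
  have z: "in_level 1 (\<lambda>_. 0)" using f.E_zero by simp
  have "mul (\<lambda>_. 0) x i - x i \<in> Mp n" for n
  proof -
    have "pe (xy_vars d) (Suc n) (xy (\<lambda>_. 0) x) (F i)
        = (\<Sum>\<alpha>\<in>{?s}. mps_coeff (F i) \<alpha> * monom_eval (xy_vars d) (xy (\<lambda>_. 0) x) \<alpha>)"
      unfolding f.ev_def
    proof (rule sum.mono_neutral_right)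
      show "\<forall>\<alpha>\<in>monoms_upto (xy_vars d) (Suc n) - {?s}. mps_coeff (F i) \<alpha> * monom_eval (xy_vars d) (xy (\<lambda>_. 0) x) \<alpha> = 0"
      proof
        fix \<alpha> assume \<alpha>: "\<alpha> \<in> monoms_upto (xy_vars d) (Suc n) - {?s}"
        show "mps_coeff (F i) \<alpha> * monom_eval (xy_vars d) (xy (\<lambda>_. 0) x) \<alpha> = 0"
        proof (cases "Poly_Mapping.keys \<alpha> \<subseteq> range Inr")
          case True
          then show ?thesis using coeff_right[OF i True] \<alpha> by auto
        next
          case False
          then obtain j where j: "Inl j \<in> Poly_Mapping.keys \<alpha>"
            by (metis obj_sumE rangeI subsetI)
          moreover have "Inl j \<in> xy_vars d" using j \<alpha> by blast
          ultimately have "monom_eval (xy_vars d) (xy (\<lambda>_. 0) x) \<alpha> = 0"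
            unfolding monom_eval_def
            by (intro prod_zero bexI[of _ "Inl j"]) (auto simp: in_keys_iff)
          then show ?thesis by simp
        qed
      qed
    qed (use i in auto)
    also have "\<dots> = x i"
      using coeff_right[OF i, of ?s] i by (simp add: monom_eval_single)
    finally have "pe (xy_vars d) (Suc n) (xy (\<lambda>_. 0) x) (F i) = x i" .
    then have "mul (\<lambda>_. 0) x i - x i \<in> Mp (Suc (Suc n))" using mul_approx[OF _ z x, of i "Suc n"] by simp
    then show ?thesis using Mp_anti[of n "Suc (Suc n)"] by simp
  qed
  then show ?thesis using Mp_separated by fastforce
qed

text \<open>Up to the linear terms the product comes from \<open>F_high\<close>, which has order at
  least 2; so a change of \<open>x\<close> gets multiplied by a further element of M.\<close>

lemma mul_contraction:
  assumes x: "in_level 1 x" "in_level 1 x'" and y: "in_level 1 y"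
    and k: "\<And>j. j < d \<Longrightarrow> x j - x' j \<in> Mp (Suc k)" and i: "i < d"
  shows "(mul x y i - x i) - (mul x' y i - x' i) \<in> Mp (Suc (Suc k))"
proof -
  interpret f: filtered_algebra Mp "\<lambda>x. x" by (rule filtered_Mp1)
  let ?V = "xy_vars d" and ?s = "Suc k"
  have F: "pe ?V ?s (xy u y) (F i) = pe ?V ?s (xy u y) (F_high i) + (u i + y i)" for u
  proof -
    have "F i = F_high i + (mps_var (Inl i) + mps_var (Inr i))" unfolding F_high_def by simp
    then show ?thesis
      using i f.ev_var[of ?V "Inl i" ?s "xy u y"] f.ev_var[of ?V "Inr i" ?s "xy u y"] by (simp add: f.ev_add)
  qed
  have high: "pe ?V ?s (xy x y) (F_high i) - pe ?V ?s (xy x' y) (F_high i) \<in> Mp (2 + k)"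
  proof (rule f.ev_diff[OF finite_xy_vars in_level_xy[OF x(1) y] in_level_xy[OF x(2) y]])
    show "\<forall>v\<in>?V. xy x y v - xy x' y v \<in> Mp (Suc k)"
      using k f.E_zero by (auto simp: xy_vars_def)
  qed (use F_high_order[OF i] in \<open>auto simp: order_ge_def\<close>)
  have approx: "mul x y i - pe ?V ?s (xy x y) (F i) \<in> Mp (2 + k)"
    "mul x' y i - pe ?V ?s (xy x' y) (F i) \<in> Mp (2 + k)"
    using mul_approx[OF _ x(1) y, of i ?s] mul_approx[OF _ x(2) y, of i ?s] by simp_all
  have "(mul x y i - pe ?V ?s (xy x y) (F i)) - (mul x' y i - pe ?V ?s (xy x' y) (F i))
      + (pe ?V ?s (xy x y) (F_high i) - pe ?V ?s (xy x' y) (F_high i)) \<in> Mp (2 + k)"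
    by (rule f.E_add[OF f.E_diff[OF approx] high])
  then show ?thesis unfolding F by (simp add: algebra_simps)
qed

text \<open>By \<open>mul_contraction\<close> the map sending y to y - y x is a contraction, where y
  x is the group product. The iterates converge by completeness, and at a fixed point the product is
  0, the unit of G.\<close>

lemma mul_left_inverse:
  assumes x: "in_level 1 x"
  shows "\<exists>y. in_level 1 y \<and> (\<forall>i<d. mul y x i = 0)"
proof -
  interpret f: filtered_algebra Mp "\<lambda>x. x" by (rule filtered_Mp1)
  define y where "y = rec_nat (\<lambda>_. 0) (\<lambda>_ y i. y i - mul y x i)"
  have y0: "y 0 = (\<lambda>_. 0)" and ySuc: "y (Suc n) = (\<lambda>i. y n i - mul (y n) x i)" for n
    unfolding y_def by simp_all
  have lev: "in_level 1 (y n)" for n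
  proof (induction n)
    case 0
    then show ?case using f.E_zero by (simp add: y0)
  next
    case (Suc n)
    then show ?case using mul_level[OF _ Suc x] f.E_diff unfolding ySuc by auto
  qed
  have ystep: "\<forall>i<d. y (Suc n) i - y n i \<in> Mp (Suc n)" for n
  proof (induction n)
    case 0
    then show ?case using x f.E_minus unfolding ySuc y0 by (simp add: mul_zero_left[OF x])
  next
    case (Suc n)
    show ?case
    proof (intro allI impI)
      fix i assume i: "i < d"
      have "(mul (y (Suc n)) x i - y (Suc n) i) - (mul (y n) x i - y n i) \<in> Mp (Suc (Suc n))"
        using Suc by (intro mul_contraction[OF lev lev x _ i]) auto
      then have "- ((mul (y (Suc n)) x i - y (Suc n) i) - (mul (y n) x i - y n i)) \<in> Mp (Suc (Suc n))"
        by (rule f.E_minus)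
      then show "y (Suc (Suc n)) i - y (Suc n) i \<in> Mp (Suc (Suc n))"
        unfolding ySuc[of "Suc n"] by (simp add: ySuc[of n])
    qed
  qed
  have tele: "y m i - y n i \<in> Mp n" if "n \<le> m" "i < d" for m n i
    using that(1)
  proof (induction m rule: dec_induct)
    case base
    then show ?case using f.E_zero by simp
  next
    case (step m)
    have "y (Suc m) i - y m i \<in> Mp n" using ystep[of m] that(2) f.E_antimono[of n "Suc m"] step.hyps by simp
    then show ?case using f.E_diff_trans step.IH by blast
  qed
  have "\<exists>l. \<forall>n. y n i - l \<in> Mp n" if "i < d" for i
  proof -
    have cauchy: "y m i - y m' i \<in> Mp n" if "n \<le> m" "n \<le> m'" for n m m'
      using tele[OF that(1) \<open>i < d\<close>] tele[OF that(2) \<open>i < d\<close>] f.E_diff_trans f.E_diff_sym by blast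
    have "\<exists>l. (\<forall>n m. n \<le> m \<longrightarrow> y m i - l \<in> Mp n)
        \<and> limitin (adic_topology M) (\<lambda>m. y m i) l sequentially
        \<and> (\<forall>l'. limitin (adic_topology M) (\<lambda>m. y m i) l' sequentially \<longrightarrow> l' = l)"
      by (rule Mp_limit) (rule cauchy)
    then obtain l where "\<forall>n m. n \<le> m \<longrightarrow> y m i - l \<in> Mp n" by (elim exE conjE) (rule that)
    then show ?thesis by (intro exI[of _ l]) simp
  qed
  then obtain l where l: "\<And>i n. i < d \<Longrightarrow> y n i - l i \<in> Mp n" by metis
  have ll: "in_level 1 l"
  proof (intro allI impI)
    fix i assume "i < d"
    then have "y 1 i \<in> Mp 1" "y 1 i - l i \<in> Mp 1" using lev l by blast+
    then have "y 1 i - (y 1 i - l i) \<in> Mp 1" by (rule f.E_diff)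
    then show "l i \<in> Mp 1" by simp
  qed
  have "mul l x i = 0" if i: "i < d" for i
  proof (rule Mp_separated)
    fix n
    have "mul (y n) x i - mul l x i \<in> Mp n"
      using l f.E_zero by (intro mul_cong[OF lev ll x x]) auto
    moreover have "y (Suc n) i - y n i \<in> Mp n"
      using ystep[of n] i Mp_anti[of n "Suc n"] by auto
    then have "- (y (Suc n) i - y n i) \<in> Mp n" by (rule f.E_minus)
    then have "mul (y n) x i \<in> Mp n" by (simp add: ySuc)
    ultimately show "mul l x i \<in> Mp n" using f.E_diff[of "mul (y n) x i" n "mul (y n) x i - mul l x i"] by simp
  qed
  then show ?thesis using ll by blast
qed

section \<open>The group axioms\<close>

lemma carrier_G: "x \<in> carrier G \<longleftrightarrow> in_level 1 x \<and> x \<in> extensional {..<d}"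
  by (auto simp: standard_group_def Mp_1 PiE_iff)

lemma mult_G: "x \<otimes>\<^bsub>G\<^esub> y = restrict (mul x y) {..<d}"
  by (simp add: standard_group_def mul_def restrict_def fun_eq_iff)

lemma one_G: "\<one>\<^bsub>G\<^esub> = restrict (\<lambda>_. 0) {..<d}"
  by (simp add: standard_group_def)

lemma mul_restrict: "mul (restrict x {..<d}) y = mul x y" "mul x (restrict y {..<d}) = mul x y"
proof -
  have e: "monom_eval (xy_vars d) (xy (restrict x {..<d}) y) = monom_eval (xy_vars d) (xy x y)"
    "monom_eval (xy_vars d) (xy x (restrict y {..<d})) = monom_eval (xy_vars d) (xy x y)"
    unfolding monom_eval_def fun_eq_iff by (auto simp: xy_vars_def intro!: prod.cong)
  show "mul (restrict x {..<d}) y = mul x y" "mul x (restrict y {..<d}) = mul x y"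
    unfolding mul_def fun_eq_iff mps_eval_def e by simp_all
qed

lemma group_G: "group G"
proof (rule groupI)
  fix x y z assume x: "x \<in> carrier G" and y: "y \<in> carrier G" and z: "z \<in> carrier G"
  show "x \<otimes>\<^bsub>G\<^esub> y \<in> carrier G"
    using x y mul_level[of 1 x y] unfolding carrier_G mult_G by auto
  show "x \<otimes>\<^bsub>G\<^esub> y \<otimes>\<^bsub>G\<^esub> z = x \<otimes>\<^bsub>G\<^esub> (y \<otimes>\<^bsub>G\<^esub> z)"
    using x y z mul_assoc[of x y z] unfolding carrier_G mult_G mul_restrict by (auto simp: restrict_def)
next
  show "\<one>\<^bsub>G\<^esub> \<in> carrier G" unfolding carrier_G one_G using Mp_closed(1) by auto
  fix x assume x: "x \<in> carrier G"
  show "\<one>\<^bsub>G\<^esub> \<otimes>\<^bsub>G\<^esub> x = x"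
    using x mul_zero_left[of x] unfolding carrier_G mult_G one_G mul_restrict
    by (auto simp: restrict_def extensional_def fun_eq_iff)
  obtain y where y: "in_level 1 y" "\<forall>i<d. mul y x i = 0" using mul_left_inverse x unfolding carrier_G by blast
  have "restrict (mul y x) {..<d} = restrict (\<lambda>_. 0) {..<d}" using y(2) by (intro restrict_ext) auto
  moreover have "restrict y {..<d} \<in> carrier G" using y(1) unfolding carrier_G by simp
  ultimately show "\<exists>y\<in>carrier G. y \<otimes>\<^bsub>G\<^esub> x = \<one>\<^bsub>G\<^esub>"
    unfolding mult_G one_G by (intro bexI[of _ "restrict y {..<d}"]) (simp_all only: mul_restrict)
qed

end

section \<open>The truncated logarithm on congruence subgroups\<close>

lemma power_dvd_monom_eval:
  fixes x :: "'v \<Rightarrow> 'a::comm_ring_1"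
  assumes "finite V" "Poly_Mapping.keys \<alpha> \<subseteq> V" "\<And>v. v \<in> V \<Longrightarrow> q dvd x v"
  shows "q ^ mdeg \<alpha> dvd monom_eval V x \<alpha>"
  using assms(2)
proof (induction rule: monom_induct)
  case (Suc v \<beta>)
  then show ?case
    using assms(3)[OF Suc(1)]
    by (simp add: monom_eval_single[OF assms(1) Suc(1)] monom_eval_add mdeg_add mult_dvd_mono)
qed simp

lemma (in filtered_algebra) ev_minus: "ev V s x (f - g) = ev V s x f - ev V s x g"
  using ev_add[of V s x "f - g" g] by simp

context standard_group_setting
begin

text \<open>At points of level K the defect, of order at least s + 1, takes values in M^(K (s + 1)),
  and so do all truncation errors.\<close>

lemma ev_mul_defect:
  assumes K: "K \<ge> 1" and x: "in_level K x" and y: "in_level K y" and s: "s \<ge> 1"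
    and g: "defect g \<in> order_ge (Suc s)"
  shows "pe {..<d} s (mul x y) g - (pe {..<d} s x g + pe {..<d} s y g) \<in> Mp (K * Suc s)"
proof -
  interpret f: filtered_algebra "\<lambda>n. Mp (K * n)" "\<lambda>x. x" by (rule filtered_Mp)
  let ?V = "xy_vars d" and ?z = "xy x y"
  have z: "\<forall>v\<in>?V. ?z v \<in> Mp (K * 1)" using in_level_xy[OF x y] by simp
  have pt: "\<forall>v\<in>{..<d}. P v \<in> order_ge 1" if "is_point d P" for P :: "nat \<Rightarrow> (nat + nat, 'a) mps"
    using that by auto
  have sub: "pe ?V s ?z (subst1 P g) - pe {..<d} s (\<lambda>j. pe ?V s ?z (P j)) g \<in> Mp (K * Suc s)"
    if "is_point d P" for P
    by (rule f.ev_subst[OF finite_lessThan finite_xy_vars pt[OF that] z])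
  have evX: "pe {..<d} s (\<lambda>j. pe ?V s ?z (xvar j)) g = pe {..<d} s x g"
    using f.ev_var[of ?V _ s ?z] s by (intro f.ev_cong) auto
  have evY: "pe {..<d} s (\<lambda>j. pe ?V s ?z (yvar j)) g = pe {..<d} s y g"
    using f.ev_var[of ?V _ s ?z] s by (intro f.ev_cong) auto
  have "pe {..<d} s (\<lambda>j. pe ?V s ?z (FF xvar yvar j)) g - pe {..<d} s (mul x y) g \<in> Mp (K * Suc s)"
  proof (rule f.ev_point_cong[OF finite_lessThan])
    show "\<forall>v\<in>{..<d}. pe ?V s ?z (FF xvar yvar v) \<in> Mp (K * 1)"
      using FF_order[OF is_point_XY] unfolding order_ge_def
      by (auto intro!: f.ev_order[OF finite_xy_vars z, of 1, simplified])
    show "\<forall>v\<in>{..<d}. mul x y v \<in> Mp (K * 1)" using mul_level[OF K x y] by simp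
    show "\<forall>v\<in>{..<d}. pe ?V s ?z (FF xvar yvar v) - mul x y v \<in> Mp (K * Suc s)"
      using f.E_diff_sym[OF mul_approx[OF K x y]] by (simp add: FF_XY)
  qed
  then have m: "pe ?V s ?z (subst1 (FF xvar yvar) g) - pe {..<d} s (mul x y) g \<in> Mp (K * Suc s)"
    using sub[OF FF_order[OF is_point_XY]] f.E_diff_trans by blast
  have "pe ?V s ?z (defect g) \<in> Mp (K * Suc s)"
    using g unfolding order_ge_def by (intro f.ev_order[OF finite_xy_vars z]) auto
  then have "pe ?V s ?z (subst1 (FF xvar yvar) g) - pe ?V s ?z (subst1 xvar g) - pe ?V s ?z (subst1 yvar g) \<in> Mp (K * Suc s)"
    unfolding defect_def f.ev_minus .
  from f.E_add[OF f.E_diff[OF this m] f.E_add[OF sub[OF is_point_XY(1)] sub[OF is_point_XY(2)]]]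
  show ?thesis unfolding evX evY by (simp add: algebra_simps)
qed

text \<open>If M^i were contained in M^(i+1) + p R, multiplying by M and iterating would give M^i in
  M^(i+k) + p R for all k. As p R is closed, M^i would lie in p R, contrary to
  \<open>Mp_not_subset_p\<close>.\<close>

lemma Mp_strict_mod_p:
  assumes dim: "krull_dim (tring :: 'a ring) > 1"
  shows "\<exists>z\<in>Mp i. \<forall>y\<in>Mp (Suc i). \<forall>r. z \<noteq> y + of_nat p * r"
proof (rule ccontr)
  assume neg: "\<not> ?thesis"
  have step: "\<exists>y'\<in>Mp (Suc (i + k)). \<exists>r. y = y' + of_nat p * r" if "y \<in> Mp (i + k)" for k y
    using that
  proof (induction k arbitrary: y)
    case 0
    then show ?case using neg by auto
  next
    case (Suc k)
    then have "y \<in> ideal_prod tring (Mp (i + k)) M" by (simp add: ideal_power_Suc)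
    then show ?case
    proof (induction rule: ideal_prod_tring_induct)
      case (prod u m)
      then obtain u' r where u: "u' \<in> Mp (Suc (i + k))" "u = u' + of_nat p * r" using Suc.IH by blast
      have "u' * m \<in> Mp (Suc (i + k) + 1)" using Mp_mult[OF u(1), of m 1] prod(2) by (simp add: Mp_1)
      moreover have "u * m = u' * m + of_nat p * (r * m)" unfolding u(2) by (simp add: algebra_simps)
      ultimately show ?case by (metis Suc_eq_plus1 add_Suc_right)
    next
      case (sum x y)
      then obtain x' r y' r' where "x' \<in> Mp (Suc (i + Suc k))" "x = x' + of_nat p * r"
        "y' \<in> Mp (Suc (i + Suc k))" "y = y' + of_nat p * r'" by blast
      moreover have "x' + of_nat p * r + (y' + of_nat p * r') = (x' + y') + of_nat p * (r + r')"
        by (simp add: algebra_simps)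
      ultimately show ?case using Mp_closed(2) by metis
    qed
  qed
  have all: "\<exists>y\<in>Mp (i + k). \<exists>r. z = y + of_nat p * r" if "z \<in> Mp i" for z k
  proof (induction k)
    case 0
    then show ?case using that by (intro bexI[of _ z] exI[of _ 0]) auto
  next
    case (Suc k)
    then obtain y r where "y \<in> Mp (i + k)" "z = y + of_nat p * r" by blast
    moreover then obtain y' r' where "y' \<in> Mp (Suc (i + k))" "y = y' + of_nat p * r'" using step by blast
    ultimately have "z = y' + of_nat p * (r' + r)" "y' \<in> Mp (i + Suc k)" by (simp_all add: algebra_simps)
    then show ?case by blast
  qed
  have "Mp i \<subseteq> range ((*) (of_nat p))"
  proof
    fix z assume z: "z \<in> Mp i"
    show "z \<in> range ((*) (of_nat p))"
    proof (rule ideal_closed[OF principal_ideal])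
      fix k
      obtain y r where y: "y \<in> Mp (i + k)" "z = y + of_nat p * r" using all[OF z] by blast
      then have "z - of_nat p * r \<in> Mp k" using Mp_anti[of k "i + k"] by simp
      then show "\<exists>y\<in>range ((*) (of_nat p)). z - y \<in> Mp k" by blast
    qed
  qed
  then show False using Mp_not_subset_p[OF dim] by blast
qed

lemma dense_generators:
  assumes tfg: "(standard_group_topology M d) closure_of (generate G S) = carrier G"
    and x: "x \<in> carrier G"
  shows "\<exists>\<gamma>\<in>generate G S. \<forall>j<d. \<gamma> j - x j \<in> Mp n"
proof -
  let ?U = "PiE {..<d} (\<lambda>j. {y. y - x j \<in> Mp n} \<inter> M)"
  have open1: "openin (adic_topology M) {y. y - l \<in> Mp n}" for l
    unfolding openin_adic_topology[OF ideal_M]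
  proof (intro ballI exI[of _ n] allI impI)
    fix u y assume "u \<in> {y. y - l \<in> Mp n}" "y - u \<in> Mp n"
    then show "y \<in> {y. y - l \<in> Mp n}" using Mp_closed(2)[of "y - u" n "u - l"] by simp
  qed
  have "openin (standard_group_topology M d) ?U"
    unfolding standard_group_topology_def
    using open1 by (simp add: openin_PiE openin_subtopology_Int)
  moreover have "x \<in> ?U" using x Mp_closed(1)[of n] unfolding carrier_G by (auto simp: PiE_iff Mp_1)
  moreover have "x \<in> (standard_group_topology M d) closure_of (generate G S)" using x by (simp only: tfg)
  ultimately obtain \<gamma> where "\<gamma> \<in> generate G S" "\<gamma> \<in> ?U"
    unfolding in_closure_of by (elim conjE allE[of _ ?U]) (erule impE, erule (1) conjI, erule exE, erule conjE, rule that)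
  then show ?thesis by (intro bexI[of _ \<gamma>]) auto
qed

definition level_subgroup :: "nat \<Rightarrow> (nat \<Rightarrow> 'a) set" where
  "level_subgroup K = {x \<in> carrier G. in_level K x}"

lemma mult_cong_G:
  assumes "x \<in> carrier G" "x' \<in> carrier G" "y \<in> carrier G" "y' \<in> carrier G"
    and "\<And>j. j < d \<Longrightarrow> x j - x' j \<in> Mp n" "\<And>j. j < d \<Longrightarrow> y j - y' j \<in> Mp n" and "i < d"
  shows "(x \<otimes>\<^bsub>G\<^esub> y) i - (x' \<otimes>\<^bsub>G\<^esub> y') i \<in> Mp n"
  using assms mul_cong[of x x' y y' n i] by (simp add: mult_G carrier_G)

lemma level_quotient:
  assumes x: "x \<in> carrier G" and t: "t \<in> carrier G" and xt: "\<And>j. j < d \<Longrightarrow> x j - t j \<in> Mp K"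
  shows "x \<otimes>\<^bsub>G\<^esub> inv\<^bsub>G\<^esub> t \<in> level_subgroup K"
proof -
  interpret group G by (rule group_G)
  have "(x \<otimes>\<^bsub>G\<^esub> inv\<^bsub>G\<^esub> t) i - (t \<otimes>\<^bsub>G\<^esub> inv\<^bsub>G\<^esub> t) i \<in> Mp K" if "i < d" for i
    using x t xt that Mp_closed(1) by (intro mult_cong_G) auto
  moreover have "(t \<otimes>\<^bsub>G\<^esub> inv\<^bsub>G\<^esub> t) i = 0" if "i < d" for i
    using t that by (simp add: one_G)
  ultimately show ?thesis unfolding level_subgroup_def using x t by auto
qed

lemma subgroup_level:
  assumes K: "K \<ge> 1"
  shows "subgroup (level_subgroup K) G"
proof -
  interpret group G by (rule group_G)
  show ?thesis
  proof (rule subgroupI)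
    show "level_subgroup K \<subseteq> carrier G" unfolding level_subgroup_def by blast
    have "\<one>\<^bsub>G\<^esub> \<in> level_subgroup K" unfolding level_subgroup_def using Mp_closed(1) by (simp add: one_G[symmetric]) (simp add: one_G)
    then show "level_subgroup K \<noteq> {}" by blast
    fix x assume x: "x \<in> level_subgroup K"
    then have xG: "x \<in> carrier G" and xK: "in_level K x" unfolding level_subgroup_def by auto
    have "\<one>\<^bsub>G\<^esub> j - x j \<in> Mp K" if "j < d" for j
      using xK that Mp_closed(5) by (simp add: one_G)
    from level_quotient[OF one_closed xG this]
    have "\<one>\<^bsub>G\<^esub> \<otimes>\<^bsub>G\<^esub> inv\<^bsub>G\<^esub> x \<in> level_subgroup K" .
    then show "inv\<^bsub>G\<^esub> x \<in> level_subgroup K" using xG by simp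
    fix y assume y: "y \<in> level_subgroup K"
    then have "in_level K (mul x y)" using mul_level[OF K xK] unfolding level_subgroup_def by auto
    then show "x \<otimes>\<^bsub>G\<^esub> y \<in> level_subgroup K"
      using xG y m_closed[of x y] unfolding level_subgroup_def by (simp add: mult_G)
  qed
qed

text \<open>The coordinates take finitely many values modulo M^K. The chosen residues need not lie
  in M, so \<open>rep\<close> picks an element of the group in each class that occurs.\<close>

lemma level_reps: "\<exists>T\<subseteq>carrier G. finite T \<and> (\<forall>x\<in>carrier G. \<exists>t\<in>T. x \<otimes>\<^bsub>G\<^esub> inv\<^bsub>G\<^esub> t \<in> level_subgroup K)"
proof -
  obtain T0 where T0: "finite T0" "\<forall>x. \<exists>t\<in>T0. x - t \<in> Mp K" using finite_reps by blast
  then obtain \<rho> where \<rho>: "\<And>x. \<rho> x \<in> T0" "\<And>x. x - \<rho> x \<in> Mp K" by metis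
  define q where "q x = restrict (\<lambda>j. \<rho> (x j)) {..<d}" for x
  define rep where "rep c = (SOME t. t \<in> carrier G \<and> q t = c)" for c
  let ?T = "rep ` q ` carrier G"
  have rep: "rep (q x) \<in> carrier G \<and> q (rep (q x)) = q x" if "x \<in> carrier G" for x
    unfolding rep_def by (rule someI[of _ x]) (use that in simp)
  have "q ` carrier G \<subseteq> {..<d} \<rightarrow>\<^sub>E T0" unfolding q_def using \<rho> by (auto split: if_splits)
  then have "finite ?T" using T0(1) finite_PiE[of "{..<d}" "\<lambda>_. T0"] finite_subset by blast
  moreover have "?T \<subseteq> carrier G" using rep by blast
  moreover have "\<exists>t\<in>?T. x \<otimes>\<^bsub>G\<^esub> inv\<^bsub>G\<^esub> t \<in> level_subgroup K" if x: "x \<in> carrier G" for x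
  proof -
    let ?t = "rep (q x)"
    have "x j - ?t j \<in> Mp K" if "j < d" for j
    proof -
      have "\<rho> (?t j) = \<rho> (x j)" using fun_cong[OF conjunct2[OF rep[OF x]], of j] that unfolding q_def by simp
      then have "x j - ?t j = (x j - \<rho> (x j)) - (?t j - \<rho> (?t j))" by simp
      then show ?thesis using Mp_closed(6)[OF \<rho>(2) \<rho>(2)] by metis
    qed
    then have "x \<otimes>\<^bsub>G\<^esub> inv\<^bsub>G\<^esub> ?t \<in> level_subgroup K" using rep[OF x] x by (intro level_quotient) auto
    then show ?thesis using x by blast
  qed
  ultimately show ?thesis by blast
qed

text \<open>Up to M^(K (s + 1)) the series \<open>g\<close> is a homomorphism, so its values on the
  group generated by the \<open>yy k\<close> are integral combinations. An arbitrary
  \<open>h\<close> need not lie in that group, but by density it is congruent to some \<gamma> that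
  does, with the same value modulo the error.\<close>

lemma ev_level_combination:
  assumes K: "K \<ge> 1" and s: "s \<ge> 1" and g: "defect g \<in> order_ge (Suc s)"
    and tfg: "(standard_group_topology M d) closure_of (generate G S) = carrier G" and S: "S \<subseteq> carrier G"
    and Y: "yy ` {..<r::nat} \<subseteq> level_subgroup K" "generate G S \<inter> level_subgroup K \<subseteq> generate G (yy ` {..<r})"
    and h: "h \<in> level_subgroup K"
  shows "\<exists>n. pe {..<d} s h g - (\<Sum>k<r. of_int (n k) * pe {..<d} s (yy k) g) \<in> Mp (K * Suc s)"
proof -
  interpret group G by (rule group_G)
  interpret f: filtered_algebra "\<lambda>n. Mp (K * n)" "\<lambda>x. x" by (rule filtered_Mp)
  let ?A = "Mp (K * Suc s)"
  define \<psi> where "\<psi> x = pe {..<d} s x g" for x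
  have H: "subgroup (level_subgroup K) G" by (rule subgroup_level[OF K])
  have \<psi>_restrict: "\<psi> (restrict x {..<d}) = \<psi> x" for x
    unfolding \<psi>_def by (rule f.ev_cong) simp
  have hom: "\<psi> (x \<otimes>\<^bsub>G\<^esub> y) - (\<psi> x + \<psi> y) \<in> ?A" if "x \<in> level_subgroup K" "y \<in> level_subgroup K" for x y
    using ev_mul_defect[OF K _ _ s g, of x y] that unfolding mult_G \<psi>_restrict
    unfolding \<psi>_def level_subgroup_def by auto
  have oneH: "\<one>\<^bsub>G\<^esub> \<in> level_subgroup K" using subgroup.one_closed[OF H] .
  have one: "\<psi> \<one>\<^bsub>G\<^esub> \<in> ?A" using f.E_minus[OF hom[OF oneH oneH]] by simp
  have delta: "(\<Sum>i<r. of_int (if i = k then q else 0) * \<psi> (yy i)) = of_int q * \<psi> (yy k)" if "k < r" for k q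
  proof -
    have "(\<Sum>i<r. of_int (if i = k then q else 0) * \<psi> (yy i)) = (\<Sum>i<r. if i = k then of_int q * \<psi> (yy i) else 0)"
      by (intro sum.cong refl) auto
    also have "\<dots> = of_int q * \<psi> (yy k)" using that by simp
    finally show ?thesis .
  qed
  have gen: "x \<in> level_subgroup K \<and> (\<exists>n. \<psi> x - (\<Sum>k<r. of_int (n k) * \<psi> (yy k)) \<in> ?A)"
    if "x \<in> generate G (yy ` {..<r})" for x
    using that
  proof induction
    case one
    then show ?case using oneH \<open>\<psi> \<one>\<^bsub>G\<^esub> \<in> ?A\<close> by (auto intro!: exI[of _ "\<lambda>_. 0"])
  next
    case (incl h)
    then obtain k where k: "k < r" "h = yy k" by blast
    have "\<psi> h - (\<Sum>i<r. of_int (if i = k then 1 else 0) * \<psi> (yy i)) = 0"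
      unfolding delta[OF k(1)] k(2) by simp
    then have "\<psi> h - (\<Sum>i<r. of_int (if i = k then 1 else 0) * \<psi> (yy i)) \<in> ?A"
      using f.E_zero[of "Suc s"] by (simp only:)
    moreover have "h \<in> level_subgroup K" using incl Y(1) by blast
    ultimately show ?case by (intro conjI exI[of _ "\<lambda>i. if i = k then 1 else 0"])
  next
    case (inv h)
    then obtain k where k: "k < r" "h = yy k" by blast
    have hH: "h \<in> level_subgroup K" using inv Y(1) by blast
    then have iH: "inv\<^bsub>G\<^esub> h \<in> level_subgroup K" using subgroup.m_inv_closed[OF H] by blast
    have "h \<in> carrier G" using hH unfolding level_subgroup_def by blast
    then have "\<psi> \<one>\<^bsub>G\<^esub> - (\<psi> h + \<psi> (inv\<^bsub>G\<^esub> h)) \<in> ?A" using hom[OF hH iH] by simp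
    from f.E_diff[OF one this] have "\<psi> (inv\<^bsub>G\<^esub> h) + \<psi> h \<in> ?A" by (simp add: add.commute)
    moreover have "\<psi> (inv\<^bsub>G\<^esub> h) - (\<Sum>i<r. of_int (if i = k then - 1 else 0) * \<psi> (yy i)) = \<psi> (inv\<^bsub>G\<^esub> h) + \<psi> h"
      unfolding delta[OF k(1)] k(2) by simp
    ultimately have "\<psi> (inv\<^bsub>G\<^esub> h) - (\<Sum>i<r. of_int (if i = k then - 1 else 0) * \<psi> (yy i)) \<in> ?A"
      by (simp only:)
    then show ?case using iH by (intro conjI exI[of _ "\<lambda>i. if i = k then - 1 else 0"])
  next
    case (eng h1 h2)
    then obtain n1 n2 where n: "\<psi> h1 - (\<Sum>k<r. of_int (n1 k) * \<psi> (yy k)) \<in> ?A"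
      "\<psi> h2 - (\<Sum>k<r. of_int (n2 k) * \<psi> (yy k)) \<in> ?A" and hH: "h1 \<in> level_subgroup K" "h2 \<in> level_subgroup K"
      by blast
    have "\<psi> (h1 \<otimes>\<^bsub>G\<^esub> h2) - (\<Sum>k<r. of_int (n1 k + n2 k) * \<psi> (yy k)) \<in> ?A"
      using f.E_add[OF hom[OF hH] f.E_add[OF n]] by (simp add: algebra_simps sum.distrib)
    then show ?case
      using subgroup.m_closed[OF H hH] by (intro conjI exI[of _ "\<lambda>k. n1 k + n2 k"])
  qed
  have hG: "h \<in> carrier G" "in_level K h" using h unfolding level_subgroup_def by auto
  obtain \<gamma> where \<gamma>: "\<gamma> \<in> generate G S" "\<forall>j<d. \<gamma> j - h j \<in> ?A" using dense_generators[OF tfg hG(1)] by blast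
  have "\<gamma> \<in> carrier G" using generate_in_carrier[OF S \<gamma>(1)] .
  moreover have lev: "in_level K \<gamma>"
  proof (intro allI impI)
    fix j assume "j < d"
    then have "(\<gamma> j - h j) + h j \<in> Mp K" using \<gamma>(2) hG(2) Mp_anti[of K "K * Suc s"] by (intro Mp_closed(2)) auto
    then show "\<gamma> j \<in> Mp K" by simp
  qed
  ultimately have "\<gamma> \<in> level_subgroup K" unfolding level_subgroup_def by blast
  then obtain n where n: "\<psi> \<gamma> - (\<Sum>k<r. of_int (n k) * \<psi> (yy k)) \<in> ?A" using gen Y(2) \<gamma>(1) by blast
  have "\<psi> \<gamma> - \<psi> h \<in> ?A"
    unfolding \<psi>_def using lev hG(2) \<gamma>(2) by (intro f.ev_point_cong) auto
  then have "\<psi> h - (\<Sum>k<r. of_int (n k) * \<psi> (yy k)) \<in> ?A" using n f.E_diff_trans f.E_diff_sym by blast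
  then show ?thesis unfolding \<psi>_def by blast
qed

text \<open>The linear term contributes q^(s-1+e) a z. A term of degree n \<ge> 2 is divisible by
  q^(s-n) through its coefficient and by q^(e n) through the point; as s - n + e n = s + n e1 \<ge>
  (s - 1 + e) + e1, it goes into the term with w.\<close>

lemma ev_axis_point:
  assumes e: "e = Suc e1" and s: "s \<ge> 1" and i0: "i0 < d"
    and g0: "mps_coeff g 0 = 0" and g1: "mps_coeff g (Poly_Mapping.single i0 1) = q ^ (s - 1) * a"
    and gd: "\<And>\<alpha>. mdeg \<alpha> \<le> s \<Longrightarrow> q ^ (s - mdeg \<alpha>) dvd mps_coeff g \<alpha>"
  shows "\<exists>w. pe {..<d} s (\<lambda>j\<in>{..<d}. if j = i0 then q ^ e * z else 0) g = q ^ (s - 1 + e) * (a * z + q ^ e1 * w)"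
proof -
  interpret f: filtered_algebra Mp "\<lambda>x. x" by (rule filtered_Mp1)
  let ?x = "\<lambda>j\<in>{..<d}. if j = i0 then q ^ e * z else 0"
  let ?s = "Poly_Mapping.single i0 (1::nat)" and ?B = "monoms_upto {..<d} s"
  let ?t = "\<lambda>\<alpha>. mps_coeff g \<alpha> * monom_eval {..<d} ?x \<alpha>"
  have sB: "?s \<in> ?B" using s i0 by simp
  have "q ^ (s - 1 + e + e1) dvd ?t \<alpha>" if \<alpha>: "\<alpha> \<in> ?B - {?s}" for \<alpha>
  proof -
    consider "mdeg \<alpha> = 0" | "mdeg \<alpha> = Suc 0" | "mdeg \<alpha> \<ge> 2" by linarith
    then show ?thesis
    proof cases
      case 1
      then have "\<alpha> = 0" using mdeg_eq_0_iff by blast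
      then show ?thesis using g0 by simp
    next
      case 2
      have "Poly_Mapping.keys \<alpha> \<subseteq> {..<d}" using \<alpha> by simp
      from monom_decompose[OF this 2] obtain j where j: "j < d" "\<alpha> = Poly_Mapping.single j 1"
        by (auto simp: mdeg_eq_0_iff)
      then have "j \<noteq> i0" using \<alpha> by auto
      then have "monom_eval {..<d} ?x \<alpha> = 0" using j by (simp add: monom_eval_single)
      then show ?thesis by simp
    next
      case 3
      let ?n = "mdeg \<alpha>"
      have "(q ^ e) ^ ?n dvd monom_eval {..<d} ?x \<alpha>"
        using \<alpha> by (intro power_dvd_monom_eval) auto
      then have "q ^ (s - ?n) * (q ^ e) ^ ?n dvd ?t \<alpha>" using gd[of \<alpha>] \<alpha> by (intro mult_dvd_mono) auto
      moreover have "q ^ (s - ?n) * (q ^ e) ^ ?n = q ^ (s - ?n + e * ?n)" by (simp add: power_add power_mult)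
      moreover have "s - 1 + e + e1 \<le> s - ?n + e * ?n"
      proof -
        have "2 * e1 \<le> e1 * ?n" using 3 by simp
        moreover have "?n \<le> s" using \<alpha> by simp
        moreover have "e * ?n = ?n + e1 * ?n" unfolding e by simp
        ultimately show ?thesis using s e by linarith
      qed
      ultimately show ?thesis by (metis dvd_trans le_imp_power_dvd)
    qed
  qed
  then have "q ^ (s - 1 + e + e1) dvd (\<Sum>\<alpha>\<in>?B - {?s}. ?t \<alpha>)" by (rule dvd_sum)
  then obtain w where w: "(\<Sum>\<alpha>\<in>?B - {?s}. ?t \<alpha>) = q ^ (s - 1 + e + e1) * w" by auto
  have "pe {..<d} s ?x g = ?t ?s + (\<Sum>\<alpha>\<in>?B - {?s}. ?t \<alpha>)"
    unfolding f.ev_def using sB by (intro sum.remove) auto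
  also have "?t ?s = q ^ (s - 1) * a * (q ^ e * z)" using g1 i0 by (simp add: monom_eval_single)
  also have "q ^ (s - 1) * a * (q ^ e * z) + (\<Sum>\<alpha>\<in>?B - {?s}. ?t \<alpha>) = q ^ (s - 1 + e) * (a * z + q ^ e1 * w)"
    unfolding w by (simp add: power_add algebra_simps)
  finally show ?thesis by (rule exI)
qed

text \<open>
  On the level \<open>K\<close> subgroup \<open>H\<close> the series \<open>g\<close> is a homomorphism \<open>\<psi>\<close> modulo \<open>M\<^sup>K\<^sup>(\<^sup>s\<^sup>+\<^sup>1\<^sup>)\<close>, and its
  image has \<open>r\<close> generators, where \<open>r\<close> does not depend on \<open>s\<close>. So two of the \<open>p\<^sup>r + 1\<close> values of
  \<open>\<psi>\<close> at multiples of \<open>z\<^sub>i \<in> M\<^sup>i - (M\<^sup>i\<^sup>+\<^sup>1 + p R)\<close> are congruent modulo \<open>p\<close> times the subgroup \<open>T\<close>. For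
  large \<open>s\<close> the Artin-Rees lemma allows one to divide this congruence by \<open>p\<^sup>N\<close> and by \<open>a\<close>, which
  contradicts the choice of the \<open>z\<^sub>i\<close>.
\<close>

theorem linear_form_zero:
  assumes dim: "krull_dim (tring :: 'a ring) > 1"
    and tfg: "topologically_finitely_generated G (standard_group_topology M d)"
    and lam: "\<And>j k. j < d \<Longrightarrow> k < d \<Longrightarrow>
      (\<Sum>i<d. lam i * mps_coeff (F i) (mix j k)) = (\<Sum>i<d. lam i * mps_coeff (F i) (mix k j))"
    and i0: "i0 < d"
  shows "lam i0 = 0"
proof (rule ccontr)
  let ?p = "of_nat p :: 'a"
  define a where "a = lam i0"
  assume "lam i0 \<noteq> 0"
  then have a: "a \<noteq> 0" unfolding a_def .
  interpret group G by (rule group_G)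
  obtain c where c: "\<And>n r. ?p * r \<in> Mp n \<Longrightarrow> r \<in> Mp (n - c)"
    using artin_rees_mult[OF of_nat_p_nonzero] by blast
  have cN: "r \<in> Mp (n - c * N)" if "?p ^ N * r \<in> Mp n" for n N r
    using that
  proof (induction N arbitrary: r)
    case (Suc N)
    then have "?p ^ N * (?p * r) \<in> Mp n" by (simp add: mult_ac)
    from c[OF Suc.IH[OF this]] show ?case by (simp add: diff_diff_left add.commute)
  qed simp
  \<comment> \<open>Each cancellation of p costs \<open>c\<close> powers of M, while raising s by
    one improves the precision by K; K must exceed c.\<close>
  define K where "K = Suc c"
  obtain e0 where e0: "\<And>e x y. e \<ge> e0 \<Longrightarrow> a * x = ?p ^ e * y \<Longrightarrow> \<exists>z. x = ?p * z"
    using colon_p_power[OF a] by blast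
  \<comment> \<open>At least \<open>e0\<close>, so that a can be cancelled modulo p at the end, and
    at least \<open>K\<close>, so that the points \<open>xs i\<close> have level K.\<close>
  define e1 where "e1 = max e0 K"
  define e where "e = Suc e1"
  obtain c2 where c2: "\<And>n u w. a * u + ?p ^ e1 * w \<in> Mp n \<Longrightarrow>
      \<exists>u'\<in>Mp (n - c2). \<exists>w'\<in>Mp (n - c2). a * u + ?p ^ e1 * w = a * u' + ?p ^ e1 * w'"
    using artin_rees_two[of a "?p ^ e1"] by blast
  obtain S where S: "S \<subseteq> carrier G" "finite S" "(standard_group_topology M d) closure_of (generate G S) = carrier G"
    using tfg unfolding topologically_finitely_generated_def by blast
  let ?H = "level_subgroup K"
  have K1: "K \<ge> 1" unfolding K_def by simp
  have H: "subgroup ?H G" by (rule subgroup_level[OF K1])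
  obtain T0 where T0: "T0 \<subseteq> carrier G" "finite T0" "\<forall>x\<in>carrier G. \<exists>t\<in>T0. x \<otimes>\<^bsub>G\<^esub> inv\<^bsub>G\<^esub> t \<in> ?H"
    using level_reps[of K] by (elim exE conjE) (rule that)
  have "\<exists>YY. finite YY \<and> YY \<subseteq> ?H \<and> generate G S \<inter> ?H \<subseteq> generate G YY"
    by (rule schreier_generators[OF S(1,2) H T0(1,2)]) (rule T0(3)[rule_format])
  then obtain YY where YY: "finite YY" "YY \<subseteq> ?H" "generate G S \<inter> ?H \<subseteq> generate G YY"
    by (elim exE conjE) (rule that)
  obtain r yy where yy: "YY = yy ` {..<r::nat}"
    using finite_imp_nat_seg_image_inj_on[OF YY(1)] by (auto simp: lessThan_def)
  define n0 where "n0 = p ^ r"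
  \<comment> \<open>With this choice K (s + 1) - c N - c2 = n0 + 2 c + 2, which exceeds every index
    i < n0.\<close>
  define s where "s = Suc (n0 + c * e + c2)"
  define N where "N = s - 1 + e"
  have s1: "s \<ge> 1" unfolding s_def by simp
  obtain g where g: "defect g \<in> order_ge (Suc s)" "mps_coeff g 0 = 0"
    "\<forall>i<d. mps_coeff g (Poly_Mapping.single i 1) = ?p ^ (s - 1) * lam i"
    "\<forall>\<alpha>. mdeg \<alpha> \<le> s \<longrightarrow> ?p ^ (s - mdeg \<alpha>) dvd mps_coeff g \<alpha>"
    using truncated_log_exists[OF of_nat_p_nonzero p_units lam s1] by blast
  define A where "A = Mp (K * Suc s)"
  define \<psi> where "\<psi> x = pe {..<d} s x g" for x
  interpret f: filtered_algebra "\<lambda>n. Mp (K * n)" "\<lambda>x. x" by (rule filtered_Mp)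
  note Ac = ideal_tring_closed[OF ideal_Mp[of "K * Suc s"], folded A_def]
  have \<psi>_restrict: "\<psi> (restrict x {..<d}) = \<psi> x" for x
    unfolding \<psi>_def by (rule f.ev_cong) simp
  have hom: "\<psi> (x \<otimes>\<^bsub>G\<^esub> y) - (\<psi> x + \<psi> y) \<in> A" if "x \<in> ?H" "y \<in> ?H" for x y
    using ev_mul_defect[OF K1 _ _ s1 g(1), of x y] that unfolding mult_G \<psi>_restrict
    unfolding \<psi>_def level_subgroup_def A_def by auto
  have oneH: "\<one>\<^bsub>G\<^esub> \<in> ?H" using subgroup.one_closed[OF H] .
  have one: "\<psi> \<one>\<^bsub>G\<^esub> \<in> A" using Ac(5)[OF hom[OF oneH oneH]] by simp
  \<comment> \<open>The image of \<psi>, cut down to values of the form p^N (a z + p^e1 w) modulo A.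
    The element \<open>u\<close> of the later congruence then has this form too, so p^N can be
    cancelled from the whole congruence. As T / A is a subgroup of a group with r generators, the
    bound r persists.\<close>
  define T where "T = {t. (\<exists>h\<in>?H. t - \<psi> h \<in> A) \<and> (\<exists>z w. t - ?p ^ N * (a * z + ?p ^ e1 * w) \<in> A)}"
  have AT: "A \<subseteq> T"
  proof
    fix t assume t: "t \<in> A"
    have "t - \<psi> \<one>\<^bsub>G\<^esub> \<in> A" using Ac(6)[OF t one] .
    moreover have "t - ?p ^ N * (a * 0 + ?p ^ e1 * 0) \<in> A" using t by simp
    ultimately show "t \<in> T" unfolding T_def using oneH by blast
  qed
  have Tdiff: "t - t' \<in> T" if tT: "t \<in> T" "t' \<in> T" for t t'
  proof -
    obtain h z w where h: "h \<in> ?H" "t - \<psi> h \<in> A" "t - ?p ^ N * (a * z + ?p ^ e1 * w) \<in> A"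
      using tT(1) unfolding T_def by blast
    obtain h' z' w' where h': "h' \<in> ?H" "t' - \<psi> h' \<in> A" "t' - ?p ^ N * (a * z' + ?p ^ e1 * w') \<in> A"
      using tT(2) unfolding T_def by blast
    have "(t - t') - ?p ^ N * (a * (z - z') + ?p ^ e1 * (w - w')) \<in> A"
      using Ac(6)[OF h(3) h'(3)] by (simp add: algebra_simps)
    moreover
    let ?k = "h \<otimes>\<^bsub>G\<^esub> inv\<^bsub>G\<^esub> h'"
    have k: "?k \<in> ?H" using subgroup.m_closed[OF H h(1) subgroup.m_inv_closed[OF H h'(1)]] .
    have "h \<in> carrier G" "h' \<in> carrier G" using h h' unfolding level_subgroup_def by auto
    then have "?k \<otimes>\<^bsub>G\<^esub> h' = h" by (simp add: m_assoc)
    then have "\<psi> h - (\<psi> ?k + \<psi> h') \<in> A" using hom[OF k h'(1)] by simp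
    from Ac(2)[OF this Ac(6)[OF h(2) h'(2)]] have "(t - t') - \<psi> ?k \<in> A" by (simp add: algebra_simps)
    ultimately show ?thesis unfolding T_def using k by blast
  qed
  have gen: "\<exists>n. t - (\<Sum>k<r. of_int (n k) * \<psi> (yy k)) \<in> A" if tT: "t \<in> T" for t
  proof -
    obtain h where h: "h \<in> ?H" "t - \<psi> h \<in> A" using tT unfolding T_def by blast
    obtain n where "\<psi> h - (\<Sum>k<r. of_int (n k) * \<psi> (yy k)) \<in> A"
      using ev_level_combination[OF K1 s1 g(1) S(3,1) _ _ h(1), of yy r] YY(2,3) yy unfolding \<psi>_def A_def by blast
    from Ac(2)[OF h(2) this] show ?thesis by auto
  qed
  obtain zs where zs: "\<And>i. zs i \<in> Mp i" "\<And>i y r. y \<in> Mp (Suc i) \<Longrightarrow> zs i \<noteq> y + ?p * r"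
    using Mp_strict_mod_p[OF dim] by metis
  define xs where "xs i = (\<lambda>j\<in>{..<d}. if j = i0 then ?p ^ e * zs i else 0)" for i :: nat
  have "\<exists>w. \<psi> (xs i) = ?p ^ N * (a * zs i + ?p ^ e1 * w)" for i
    unfolding \<psi>_def xs_def N_def
    by (rule ev_axis_point[OF e_def s1 i0 g(2)]) (use g(3,4) i0 in \<open>auto simp: a_def\<close>)
  then obtain ws where ws: "\<And>i. \<psi> (xs i) = ?p ^ N * (a * zs i + ?p ^ e1 * ws i)" by metis
  have xsH: "xs i \<in> ?H" for i
  proof -
    have "?p ^ e \<in> Mp K" using Mp_anti[of K e] p_power_in[of e] unfolding e_def e1_def by simp
    then have lev: "in_level K (xs i)" unfolding xs_def using Mp_closed(1,4) by auto
    have "xs i \<in> extensional {..<d}" unfolding xs_def by simp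
    with in_level_anti[OF K1 lev] lev show ?thesis unfolding level_subgroup_def carrier_G by blast
  qed
  have tT: "\<psi> (xs i) \<in> T" for i
  proof -
    have "\<psi> (xs i) - \<psi> (xs i) \<in> A" "\<psi> (xs i) - ?p ^ N * (a * zs i + ?p ^ e1 * ws i) \<in> A"
      using Ac(1) ws[of i] by simp_all
    then show ?thesis unfolding T_def using xsH by blast
  qed
  have "\<exists>i j. i < j \<and> j \<le> n0 \<and> (\<exists>u\<in>T. \<psi> (xs i) - \<psi> (xs j) - ?p * u \<in> A)"
    unfolding n0_def
    by (rule congruent_mod_p[where t = "\<lambda>i. \<psi> (xs i)" and T = T and b = "\<lambda>k. \<psi> (yy k)", OF p_pos Ac(1)])
      (erule (1) Ac(6), rule AT, erule (1) Tdiff, erule gen, rule tT)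
  then obtain i j u where ij: "i < j" "j \<le> n0" "u \<in> T" "\<psi> (xs i) - \<psi> (xs j) - ?p * u \<in> A"
    by (elim exE conjE bexE) (rule that)
  obtain z w where zw: "u - ?p ^ N * (a * z + ?p ^ e1 * w) \<in> A" using ij(3) unfolding T_def by blast
  let ?U = "zs i - zs j - ?p * z" and ?W = "ws i - ws j - ?p * w"
  have "?p ^ N * (a * ?U + ?p ^ e1 * ?W)
      = (\<psi> (xs i) - \<psi> (xs j) - ?p * u) + ?p * (u - ?p ^ N * (a * z + ?p ^ e1 * w))"
    unfolding ws by (simp add: algebra_simps)
  then have "?p ^ N * (a * ?U + ?p ^ e1 * ?W) \<in> Mp (K * Suc s)"
    using Ac(2)[OF ij(4) Ac(3)[OF zw]] unfolding A_def by metis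
  then obtain U' W' where U': "U' \<in> Mp (K * Suc s - c * N - c2)" "a * ?U + ?p ^ e1 * ?W = a * U' + ?p ^ e1 * W'"
    using c2[OF cN] by blast
  \<comment> \<open>Here a times the difference is divisible by p^e1, and e1 \<ge> e0 makes the
    difference itself divisible by p.\<close>
  have "a * (?U - U') = ?p ^ e1 * (W' - ?W)" using U'(2) by (simp add: algebra_simps)
  then obtain v where v: "?U - U' = ?p * v" using e0[of e1] unfolding e1_def by auto
  have "Suc i \<le> K * Suc s - c * N - c2"
  proof -
    have "K * Suc s = c * Suc s + Suc s" unfolding K_def by simp
    moreover have "c * N + c = c * s + c * e" unfolding N_def s_def by (simp add: algebra_simps)
    moreover have "c * Suc s = c * s + c" by simp
    ultimately show ?thesis using ij unfolding s_def by linarith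
  qed
  then have "U' \<in> Mp (Suc i)" using U'(1) Mp_anti by blast
  moreover have "zs j \<in> Mp (Suc i)" using zs(1)[of j] Mp_anti[of "Suc i" j] ij(1) by simp
  ultimately have "zs j + U' \<in> Mp (Suc i)" using Mp_closed(2) by blast
  moreover have "zs i = (zs j + U') + ?p * (z + v)" using v by (simp add: algebra_simps)
  ultimately show False using zs(2) by blast
qed

end

section \<open>The Lie algebra of a formal group law\<close>

definition fps_order_ge :: "nat \<Rightarrow> 'a::comm_ring_1 fps set" where
  "fps_order_ge n = {f. \<forall>k<n. fps_nth f k = 0}"

lemma filtered_fps: "filtered_algebra fps_order_ge (fps_const :: 'a::comm_ring_1 \<Rightarrow> 'a fps)"
proof
  fix x y :: "'a fps" and m n
  assume xy: "x \<in> fps_order_ge m" "y \<in> fps_order_ge n"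
  show "x * y \<in> fps_order_ge (m + n)"
    unfolding fps_order_ge_def mem_Collect_eq fps_mult_nth
  proof (intro allI impI sum.neutral ballI)
    fix k i assume "k < m + n" "i \<in> {0..k}"
    then have "i < m \<or> k - i < n" by auto
    then show "fps_nth x i * fps_nth y (k - i) = 0" using xy unfolding fps_order_ge_def by auto
  qed
qed (auto simp: fps_order_ge_def)

context fgl
begin

text \<open>The quadratic part of F as a bilinear map, with \<phi> sending its coefficients to the
  ring of the arguments: the identity over R, \<open>fps_const\<close> over series in one
  variable.\<close>

definition bil :: "(nat \<Rightarrow> 'e) \<Rightarrow> (nat \<Rightarrow> 'e) \<Rightarrow> ('a \<Rightarrow> 'e) \<Rightarrow> nat \<Rightarrow> 'e::comm_ring_1" where
  "bil x y \<phi> i = (\<Sum>j<d. \<Sum>k<d. \<phi> (mps_coeff (F i) (mix j k)) * (x j * y k))"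

text \<open>Despite the name, for i < d this collects all terms of degree at least 3; only the cubic
  ones will matter.\<close>

definition cubic :: "nat \<Rightarrow> (nat + nat, 'a) mps" where
  "cubic i = Abs_mps (\<lambda>m. if mdeg m = 2 then 0 else mps_coeff (F_high i) m)"

lemma coeff_F_high_quadratic: "mdeg m = 2 \<Longrightarrow> mps_coeff (F_high i) m = mps_coeff (F i) m"
  by (auto simp: F_high_def minus_mps.rep_eq mps_coeff_var)

lemma coeff_cubic: "mps_coeff (cubic i) m = (if mdeg m = 2 then 0 else mps_coeff (F_high i) m)"
  by (simp add: cubic_def Abs_mps_inverse)

lemma cubic_order: "i < d \<Longrightarrow> mdeg m < 3 \<Longrightarrow> mps_coeff (cubic i) m = 0"
  using F_high_order[of i] unfolding order_ge_def coeff_cubic by auto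

lemma monom_eval_mix:
  "j < d \<Longrightarrow> k < d \<Longrightarrow> monom_eval (xy_vars d) (case_sum x y) (mix j k) = x j * y k"
  by (simp add: monom_eval_add monom_eval_single)

lemma sum_quadratic_monoms:
  fixes \<phi> :: "'a \<Rightarrow> 'e::comm_ring_1"
  assumes i: "i < d" and \<phi>: "\<phi> 0 = 0"
  shows "(\<Sum>\<alpha> | Poly_Mapping.keys \<alpha> \<subseteq> xy_vars d \<and> mdeg \<alpha> = 2.
    \<phi> (mps_coeff (F i) \<alpha>) * monom_eval (xy_vars d) (case_sum x y) \<alpha>) = bil x y \<phi> i"
proof -
  let ?A = "{\<alpha>. Poly_Mapping.keys \<alpha> \<subseteq> xy_vars d \<and> mdeg \<alpha> = 2}"
  have "?A \<subseteq> monoms_upto (xy_vars d) 2" by auto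
  then have "finite ?A" using finite_monoms_upto[OF finite_xy_vars] finite_subset by blast
  moreover have "mix j k \<in> ?A" if "j < d" "k < d" for j k
    using that by (simp add: keys_add_nat mdeg_add)
  ultimately have "(\<Sum>\<alpha>\<in>?A. \<phi> (mps_coeff (F i) \<alpha>) * monom_eval (xy_vars d) (case_sum x y) \<alpha>)
      = (\<Sum>j<d. \<Sum>k<d. \<phi> (mps_coeff (F i) (mix j k)) * monom_eval (xy_vars d) (case_sum x y) (mix j k))"
  proof (rule sum_mixed)
    fix \<alpha> assume "\<alpha> \<in> ?A" "\<phi> (mps_coeff (F i) \<alpha>) * monom_eval (xy_vars d) (case_sum x y) \<alpha> \<noteq> 0"
    then have "mdeg \<alpha> = 2" "mps_coeff (F i) \<alpha> \<noteq> 0" using \<phi> by auto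
    then show "\<exists>j<d. \<exists>k<d. \<alpha> = mix j k" by (rule coeff_quadratic[OF i])
  qed
  also have "\<dots> = bil x y \<phi> i"
    unfolding bil_def by (intro sum.cong refl) (simp only: monom_eval_mix lessThan_iff)
  finally show ?thesis .
qed

lemma fgl_quadratic_part_bil: "i < d \<Longrightarrow> fgl_quadratic_part d F x y i = bil x y (\<lambda>c. c) i"
  using sum_quadratic_monoms[of i "\<lambda>c. c" x y] by (simp add: fgl_quadratic_part_def)

lemma ev_F_expand:
  assumes alg: "filtered_algebra E \<phi>" and i: "i < d" and s: "s \<ge> 2"
  shows "filtered_algebra.ev \<phi> (xy_vars d) s (case_sum x y) (F i)
    = x i + y i + bil x y \<phi> i + filtered_algebra.ev \<phi> (xy_vars d) s (case_sum x y) (cubic i)"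
proof -
  interpret f: filtered_algebra E \<phi> by (rule alg)
  let ?V = "xy_vars d" and ?z = "case_sum x y"
  let ?m = "\<lambda>\<alpha>. monom_eval ?V ?z \<alpha>"
  let ?A = "{\<alpha>. Poly_Mapping.keys \<alpha> \<subseteq> ?V \<and> mdeg \<alpha> = 2}"
  have "F i = F_high i + (mps_var (Inl i) + mps_var (Inr i))" unfolding F_high_def by simp
  then have "f.ev ?V s ?z (F i) = f.ev ?V s ?z (F_high i) + (x i + y i)"
    using i s f.ev_var[of ?V "Inl i" s ?z] f.ev_var[of ?V "Inr i" s ?z] by (simp add: f.ev_add)
  moreover have "f.ev ?V s ?z (F_high i) = bil x y \<phi> i + f.ev ?V s ?z (cubic i)"
  proof -
    have "f.ev ?V s ?z (F_high i) = (\<Sum>\<alpha>\<in>monoms_upto ?V s. (if mdeg \<alpha> = 2 then \<phi> (mps_coeff (F i) \<alpha>) * ?m \<alpha> else 0)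
        + \<phi> (mps_coeff (cubic i) \<alpha>) * ?m \<alpha>)"
      unfolding f.ev_def by (rule sum.cong) (auto simp: coeff_cubic coeff_F_high_quadratic f.\<phi>_0)
    also have "\<dots> = (\<Sum>\<alpha>\<in>monoms_upto ?V s. if mdeg \<alpha> = 2 then \<phi> (mps_coeff (F i) \<alpha>) * ?m \<alpha> else 0)
        + f.ev ?V s ?z (cubic i)"
      unfolding f.ev_def sum.distrib ..
    also have "(\<Sum>\<alpha>\<in>monoms_upto ?V s. if mdeg \<alpha> = 2 then \<phi> (mps_coeff (F i) \<alpha>) * ?m \<alpha> else 0)
        = (\<Sum>\<alpha>\<in>?A. \<phi> (mps_coeff (F i) \<alpha>) * ?m \<alpha>)"
      using s by (intro sum.mono_neutral_cong_right) auto
    finally show ?thesis using sum_quadratic_monoms[where \<phi> = \<phi>, OF i f.\<phi>_0, of x y] by simp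
  qed
  ultimately show ?thesis by (simp add: algebra_simps)
qed

section \<open>The Jacobi identity for C\<close>

abbreviation B :: "(nat \<Rightarrow> 'a) \<Rightarrow> (nat \<Rightarrow> 'a) \<Rightarrow> nat \<Rightarrow> 'a" where
  "B x y \<equiv> bil x y (\<lambda>c. c)"

text \<open>
  The coefficient of \<open>\<epsilon>\<^sup>3\<close> in the associative law for the points \<open>\<epsilon> u\<close>, \<open>\<epsilon> v\<close>, \<open>\<epsilon> w\<close> over
  the power series ring in \<open>\<epsilon>\<close>: the associator of the quadratic part is the coboundary of the
  cubic part.
\<close>

lemma bil_associator:
  "\<exists>T. \<forall>u v w. \<forall>i<d. B (B u v) w i - B u (B v w) i
     = T u (\<lambda>j. v j + w j) i + T v w i - T (\<lambda>j. u j + v j) w i - T u v i"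
proof -
  interpret f: filtered_algebra "fps_order_ge :: nat \<Rightarrow> 'a fps set" fps_const by (rule filtered_fps)
  define pt where "pt u = (\<lambda>j. fps_const (u j) * fps_X)" for u :: "nat \<Rightarrow> 'a"
  let ?V = "xy_vars d"
  define N where "N x y i = f.ev ?V 3 (case_sum x y) (F i)" for x y :: "nat \<Rightarrow> 'a fps" and i
  define cub where "cub x y i = f.ev ?V 3 (case_sum x y) (cubic i)" for x y :: "nat \<Rightarrow> 'a fps" and i
  define T where "T u v i = fps_nth (cub (pt u) (pt v) i) 3" for u v i
  have ptE: "\<forall>j<d. pt u j \<in> fps_order_ge 1" for u unfolding pt_def fps_order_ge_def by simp
  have V1: "\<forall>v\<in>?V. case_sum x y v \<in> fps_order_ge 1"
    if "\<forall>j<d. x j \<in> fps_order_ge 1" "\<forall>j<d. y j \<in> fps_order_ge 1" for x y :: "nat \<Rightarrow> 'a fps"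
    using that by (auto simp: xy_vars_def)
  have Nx: "N x y i = x i + y i + bil x y fps_const i + cub x y i" if "i < d" for x y i
    unfolding N_def cub_def by (rule ev_F_expand[OF filtered_fps that]) simp
  have cub3: "cub x y i \<in> fps_order_ge 3"
    if "i < d" "\<forall>j<d. x j \<in> fps_order_ge 1" "\<forall>j<d. y j \<in> fps_order_ge 1" for x y i
    unfolding cub_def using cubic_order[OF that(1)] by (intro f.ev_order[OF finite_xy_vars V1[OF that(2,3)]])
  \<comment> \<open>The third coefficient of the cubic part depends on the points only modulo the
    second power of the variable, so inside it a product of points may be replaced by their
    sum.\<close>
  have cub4: "fps_nth (cub x y i) 3 = fps_nth (cub x' y' i) 3"
    if "i < d" "\<forall>j<d. x j \<in> fps_order_ge 1" "\<forall>j<d. y j \<in> fps_order_ge 1"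
      "\<forall>j<d. x' j \<in> fps_order_ge 1" "\<forall>j<d. y' j \<in> fps_order_ge 1"
      "\<forall>j<d. x j - x' j \<in> fps_order_ge 2" "\<forall>j<d. y j - y' j \<in> fps_order_ge 2" for x y x' y' i
  proof -
    have "cub x y i - cub x' y' i \<in> fps_order_ge (3 + 1)"
      unfolding cub_def
    proof (rule f.ev_diff[OF finite_xy_vars V1[OF that(2,3)] V1[OF that(4,5)]])
      show "\<forall>v\<in>?V. case_sum x y v - case_sum x' y' v \<in> fps_order_ge (Suc 1)"
        using that(6,7) by (auto simp: xy_vars_def numeral_2_eq_2)
    qed (rule cubic_order[OF that(1)])
    then have "fps_nth (cub x y i - cub x' y' i) 3 = 0" unfolding fps_order_ge_def by simp
    then show ?thesis by simp
  qed
  have X_power: "fps_X * fps_X = (fps_X ^ 2 :: 'a fps)" by (simp add: power2_eq_square)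
  have const_sum: "fps_const (sum h A) = (\<Sum>a\<in>A. fps_const (h a))" for h :: "nat \<Rightarrow> 'a" and A
    by (induction A rule: infinite_finite_induct) (simp_all flip: fps_const_add)
  have bilpt: "bil (pt u) (pt v) fps_const i = fps_const (B u v i) * fps_X ^ 2" for u v i
  proof -
    have c: "fps_const c * (pt u j * pt v k) = fps_const (c * (u j * v k)) * fps_X ^ 2" for c j k
      unfolding pt_def by (simp add: mult_ac X_power[symmetric] flip: fps_const_mult)
    show ?thesis
      unfolding bil_def by (simp only: const_sum sum_distrib_right c)
  qed
  have Npt: "N (pt u) (pt v) i = pt (\<lambda>j. u j + v j) i + fps_const (B u v i) * fps_X ^ 2 + cub (pt u) (pt v) i"
    if "i < d" for u v i
    unfolding Nx[OF that] bilpt by (simp add: pt_def algebra_simps flip: fps_const_add)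
  have NE: "\<forall>j<d. N (pt u) (pt v) j \<in> fps_order_ge 1" for u v
  proof (intro allI impI)
    fix j assume j: "j < d"
    have "pt (\<lambda>j. u j + v j) j \<in> fps_order_ge 1" using ptE j by blast
    moreover have "fps_const (B u v j) * fps_X ^ 2 \<in> fps_order_ge 1"
      unfolding fps_order_ge_def by (simp add: fps_X_power_iff)
    moreover have "cub (pt u) (pt v) j \<in> fps_order_ge 1"
      using cub3[OF j ptE ptE] f.E_antimono[of 1 3] by simp
    ultimately show "N (pt u) (pt v) j \<in> fps_order_ge 1" unfolding Npt[OF j] by (intro f.E_add)
  qed
  have Ndiff: "\<forall>j<d. N (pt u) (pt v) j - pt (\<lambda>j. u j + v j) j \<in> fps_order_ge 2" for u v
  proof (intro allI impI)
    fix j assume j: "j < d"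
    have "fps_const (B u v j) * fps_X ^ 2 \<in> fps_order_ge 2"
      unfolding fps_order_ge_def by (simp add: fps_X_power_iff)
    moreover have "cub (pt u) (pt v) j \<in> fps_order_ge 2"
      using cub3[OF j ptE ptE] f.E_antimono[of 2 3] by simp
    ultimately show "N (pt u) (pt v) j - pt (\<lambda>j. u j + v j) j \<in> fps_order_ge 2"
      unfolding Npt[OF j] by (simp add: f.E_add)
  qed
  have pt_nth: "fps_nth (pt u j) n = (if n = 1 then u j else 0)" for u j n
    by (simp add: pt_def)
  have N2: "fps_nth (N (pt u) (pt v) j) 2 = B u v j" if "j < d" for u v j
    using cub3[OF that ptE[of u] ptE[of v]] unfolding Npt[OF that] fps_order_ge_def
    by (simp add: pt_nth fps_X_power_iff)
  have N3: "fps_nth (N (pt u) (pt v) j) 3 = T u v j" if "j < d" for u v j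
    unfolding Npt[OF that] by (simp add: pt_nth fps_X_power_iff T_def)
  have mult3: "fps_nth (x * pt w k) 3 = fps_nth x 2 * w k" "fps_nth (pt w k * x) 3 = w k * fps_nth x 2" for x w k
    by (simp_all add: pt_def mult.commute[of _ fps_X] mult.assoc mult.left_commute[of _ fps_X] numeral_3_eq_3 numeral_2_eq_2 mult.commute)
  have left: "fps_nth (N (N (pt u) (pt v)) (pt w) i) 3 = T u v i + B (B u v) w i + T (\<lambda>j. u j + v j) w i"
    if i: "i < d" for u v w i
  proof -
    have "fps_nth (bil (N (pt u) (pt v)) (pt w) fps_const i) 3 = B (B u v) w i"
      unfolding bil_def[of "N (pt u) (pt v)"] bil_def[of "B u v"]
      by (simp add: fps_sum_nth mult3 N2)
    moreover have "fps_nth (cub (N (pt u) (pt v)) (pt w) i) 3 = T (\<lambda>j. u j + v j) w i"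
      unfolding T_def using NE ptE Ndiff f.E_zero[of 2] by (intro cub4[OF i]) auto
    ultimately show ?thesis unfolding Nx[OF i, of "N (pt u) (pt v)"] by (simp add: N3[OF i] pt_nth)
  qed
  have right: "fps_nth (N (pt u) (N (pt v) (pt w)) i) 3 = T v w i + B u (B v w) i + T u (\<lambda>j. v j + w j) i"
    if i: "i < d" for u v w i
  proof -
    have "fps_nth (bil (pt u) (N (pt v) (pt w)) fps_const i) 3 = B u (B v w) i"
      unfolding bil_def[of "pt u"] bil_def[of u]
      by (simp add: fps_sum_nth mult3 N2)
    moreover have "fps_nth (cub (pt u) (N (pt v) (pt w)) i) 3 = T u (\<lambda>j. v j + w j) i"
      unfolding T_def using NE ptE Ndiff f.E_zero[of 2] by (intro cub4[OF i]) auto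
    ultimately show ?thesis unfolding Nx[OF i, of "pt u" "N (pt v) (pt w)"] by (simp add: N3[OF i] pt_nth)
  qed
  have "B (B u v) w i - B u (B v w) i
      = T u (\<lambda>j. v j + w j) i + T v w i - T (\<lambda>j. u j + v j) w i - T u v i" if i: "i < d" for u v w i
  proof -
    have "N (N (pt u) (pt v)) (pt w) i - N (pt u) (N (pt v) (pt w)) i \<in> fps_order_ge (Suc 3)"
      unfolding N_def by (rule ev_assoc[OF filtered_fps ptE ptE ptE _ i]) simp
    then have "fps_nth (N (N (pt u) (pt v)) (pt w) i - N (pt u) (N (pt v) (pt w)) i) 3 = 0"
      unfolding fps_order_ge_def by simp
    then show ?thesis using left[OF i, of u v w] right[OF i, of u v w] by (simp add: algebra_simps)
  qed
  then show ?thesis by blast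
qed

abbreviation C :: "(nat \<Rightarrow> 'a) \<Rightarrow> (nat \<Rightarrow> 'a) \<Rightarrow> nat \<Rightarrow> 'a" where
  "C x y i \<equiv> B x y i - B y x i"

lemma bil_diff: "B (\<lambda>j. x j - x' j) y i = B x y i - B x' y i" "B x (\<lambda>j. y j - y' j) i = B x y i - B x y' i"
  unfolding bil_def by (simp_all only: left_diff_distrib right_diff_distrib sum_subtractf)

text \<open>The left-hand side is the alternating sum of the associators of B over the six orders of
  u, v, w. The coboundary of T drops out: T(u, v + w) and T(u + v, w) are each symmetric in two
  arguments, and T(v, w) and T(u, v) have equal alternating sums, since a cyclic shift is
  even.\<close>

lemma jacobi_C:
  assumes "i < d"
  shows "C (C u v) w i + C (C v w) u i + C (C w u) v i = 0"
proof -
  obtain T where assoc: "\<forall>u v w. \<forall>i<d. B (B u v) w i - B u (B v w) i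
      = T u (\<lambda>j. v j + w j) i + T v w i - T (\<lambda>j. u j + v j) w i - T u v i"
    using bil_associator by (elim exE) (rule that)
  have T: "B (B u v) w i
      = B u (B v w) i + T u (\<lambda>j. v j + w j) i + T v w i - T (\<lambda>j. u j + v j) w i - T u v i" for u v w
    using assoc[rule_format, OF assms, of u v w] by (simp add: algebra_simps)
  show ?thesis
    unfolding bil_diff T[of u v w] T[of v u w] T[of v w u] T[of w v u] T[of w u v] T[of u w v]
    by (simp add: algebra_simps)
qed

text \<open>The structure constants of the Lie algebra on R^d.\<close>

definition sc :: "nat \<Rightarrow> nat \<Rightarrow> nat \<Rightarrow> 'a" where
  "sc i j k = fgl_bracket d F (coord_basis i) (coord_basis j) k"

lemma bil_basis:
  assumes "j < d" "k < d"
  shows "B (coord_basis j) (coord_basis k) i = mps_coeff (F i) (mix j k)"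
proof -
  have "B (coord_basis j) (coord_basis k) i
      = (\<Sum>j'<d. \<Sum>k'<d. if k' = k then (if j' = j then mps_coeff (F i) (mix j' k') else 0) else 0)"
    unfolding bil_def coord_basis_def by (intro sum.cong refl) auto
  then show ?thesis using assms by simp
qed

lemma sc_eq: "i < d \<Longrightarrow> j < d \<Longrightarrow> k < d \<Longrightarrow>
    sc i j k = mps_coeff (F k) (mix i j) - mps_coeff (F k) (mix j i)"
  by (simp add: sc_def fgl_bracket_def fun_diff_def fgl_quadratic_part_bil bil_basis)

lemma sc_outside: "k \<ge> d \<Longrightarrow> sc i j k = 0"
  by (simp add: sc_def fgl_bracket_def fun_diff_def fgl_quadratic_part_def)

lemma sc_skew: "sc i j k = - sc j i k"
  by (simp add: sc_def fgl_bracket_def fun_diff_def)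

lemma sc_jacobi:
  assumes "i < d" "j < d" "l < d" "k < d"
  shows "(\<Sum>m<d. sc i j m * sc m l k) + (\<Sum>m<d. sc j l m * sc m i k) + (\<Sum>m<d. sc l i m * sc m j k) = 0"
proof -
  let ?e = "coord_basis :: nat \<Rightarrow> nat \<Rightarrow> 'a"
  have "C (C (?e a) (?e b)) (?e c) k = (\<Sum>m<d. sc a b m * sc m c k)" if "a < d" "b < d" "c < d" for a b c
  proof -
    have "B x (?e c) k = (\<Sum>m<d. x m * mps_coeff (F k) (mix m c))" for x
    proof -
      have "B x (?e c) k = (\<Sum>m<d. \<Sum>k'<d. if k' = c then x m * mps_coeff (F k) (mix m k') else 0)"
        unfolding bil_def coord_basis_def by (intro sum.cong refl) auto
      then show ?thesis using that by simp
    qed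
    moreover have "B (?e c) x k = (\<Sum>m<d. x m * mps_coeff (F k) (mix c m))" for x
    proof -
      have "B (?e c) x k = (\<Sum>k'<d. if k' = c then \<Sum>m<d. x m * mps_coeff (F k) (mix k' m) else 0)"
        unfolding bil_def coord_basis_def by (intro sum.cong refl) (auto simp: mult.commute)
      then show ?thesis using that by simp
    qed
    ultimately show ?thesis
      using that assms(4)
      by (simp add: sum_subtractf[symmetric] bil_basis sc_eq right_diff_distrib[symmetric])
  qed
  then show ?thesis using jacobi_C[OF assms(4), of "?e i" "?e j" "?e l"] assms by simp
qed

end

section \<open>Extension of scalars to the field of fractions\<close>

abbreviation emb :: "'a::idom \<Rightarrow> 'a fract" where "emb x \<equiv> Fract x 1"

lemma emb_0: "emb 0 = 0"
  by (simp add: Zero_fract_def)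

lemma emb_add: "emb (x + y) = emb x + emb y"
  by simp

lemma emb_mult: "emb (x * y) = emb x * emb y"
  by simp

lemma emb_minus: "emb (- x) = - emb x"
  by simp

lemma emb_eq_0_iff: "emb x = 0 \<longleftrightarrow> x = 0"
  by (simp add: Zero_fract_def eq_fract)

lemma emb_sum: "emb (sum f A) = (\<Sum>i\<in>A. emb (f i))"
proof (induction A rule: infinite_finite_induct)
  case (insert x A)
  then show ?case by (simp only: sum.insert[OF insert.hyps] emb_add)
qed (simp_all add: emb_0)

lemma common_denominator:
  fixes f :: "nat \<Rightarrow> 'a::idom fract"
  shows "\<exists>q. q \<noteq> 0 \<and> (\<forall>i<n. \<exists>r. emb q * f i = emb r)"
proof (induction n)
  case 0
  then show ?case by (intro exI[of _ 1]) simp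
next
  case (Suc n)
  then obtain q where q: "q \<noteq> 0" "\<forall>i<n. \<exists>r. emb q * f i = emb r" by blast
  obtain a b where ab: "f n = Fract a b" "b \<noteq> 0" by (cases "f n") auto
  have "\<exists>r. emb (q * b) * f i = emb r" if "i < Suc n" for i
  proof (cases "i = n")
    case True
    have "emb (q * b) * f n = emb (q * a)" unfolding ab(1) using ab(2) by (simp add: eq_fract mult_ac)
    then show ?thesis using True by blast
  next
    case False
    then have "i < n" using that by simp
    then obtain r where r: "emb q * f i = emb r" using q(2) by blast
    have "emb (q * b) * f i = emb b * (emb q * f i)" unfolding emb_mult by (simp only: mult_ac)
    also have "\<dots> = emb (b * r)" unfolding r emb_mult ..
    finally show ?thesis by (rule exI)
  qed
  then show ?case using q(1) ab(2) by (intro exI[of _ "q * b"]) simp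
qed

context fgl_idom
begin

abbreviation FB :: "(nat \<Rightarrow> 'a fract) \<Rightarrow> (nat \<Rightarrow> 'a fract) \<Rightarrow> nat \<Rightarrow> 'a fract" where
  "FB \<equiv> fract_bracket d (fgl_bracket d F)"

lemma FB_eq: "FB u v k = (\<Sum>i<d. \<Sum>j<d. u i * v j * emb (sc i j k))"
  by (simp add: fract_bracket_def sc_def)

lemma FB_linear: "Vector_Spaces.linear coord_scale coord_scale (FB u)"
proof -
  have "FB u (v + w) = FB u v + FB u w" for v w
    by (rule ext) (simp only: FB_eq plus_fun_apply distrib_left distrib_right sum.distrib)
  moreover have "FB u (coord_scale c v) = coord_scale c (FB u v)" for c v
    by (rule ext) (simp add: FB_eq coord_scale_def sum_distrib_left mult_ac)
  ultimately show ?thesis unfolding Vector_Spaces.linear_iff using vector_space_coord_scale by blast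
qed

lemma FB_skew: "FB u v = - FB v u"
proof
  fix k
  have "FB u v k = (\<Sum>j<d. \<Sum>i<d. u i * v j * emb (sc i j k))"
    unfolding FB_eq by (rule sum.swap)
  also have "\<dots> = (\<Sum>j<d. \<Sum>i<d. - (v j * u i * emb (sc j i k)))"
    by (intro sum.cong refl) (subst sc_skew, simp only: emb_minus mult_ac mult_minus_right)
  finally show "FB u v k = (- FB v u) k"
    by (simp only: FB_eq sum_negf uminus_apply)
qed

lemma FB_outside: "k \<ge> d \<Longrightarrow> FB u v k = 0"
  by (simp only: FB_eq sc_outside emb_0 mult_zero_right sum.neutral_const)

lemma FB_FB:
  "FB (FB u v) w k = (\<Sum>i<d. \<Sum>j<d. \<Sum>l<d. u i * v j * w l * (\<Sum>m<d. emb (sc i j m) * emb (sc m l k)))"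
proof -
  let ?t = "\<lambda>i j l m. u i * v j * w l * (emb (sc i j m) * emb (sc m l k))"
  have "FB (FB u v) w k = (\<Sum>m<d. \<Sum>l<d. (\<Sum>i<d. \<Sum>j<d. u i * v j * emb (sc i j m)) * w l * emb (sc m l k))"
    by (simp only: FB_eq)
  also have "\<dots> = (\<Sum>m<d. \<Sum>l<d. \<Sum>i<d. \<Sum>j<d. ?t i j l m)"
    unfolding sum_distrib_right by (intro sum.cong refl) (simp only: mult_ac)
  also have "\<dots> = (\<Sum>l<d. \<Sum>m<d. \<Sum>i<d. \<Sum>j<d. ?t i j l m)" by (rule sum.swap)
  also have "\<dots> = (\<Sum>l<d. \<Sum>i<d. \<Sum>m<d. \<Sum>j<d. ?t i j l m)" by (intro sum.cong refl sum.swap)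
  also have "\<dots> = (\<Sum>i<d. \<Sum>l<d. \<Sum>m<d. \<Sum>j<d. ?t i j l m)" by (rule sum.swap)
  also have "\<dots> = (\<Sum>i<d. \<Sum>l<d. \<Sum>j<d. \<Sum>m<d. ?t i j l m)" by (intro sum.cong refl sum.swap)
  also have "\<dots> = (\<Sum>i<d. \<Sum>j<d. \<Sum>l<d. \<Sum>m<d. ?t i j l m)" by (intro sum.cong refl sum.swap)
  finally show ?thesis by (simp only: sum_distrib_left)
qed

lemma FB_cyclic: "FB (FB u v) w k + FB (FB v w) u k + FB (FB w u) v k = 0"
proof (cases "k < d")
  case True
  define S where "S i j l = (\<Sum>m<d. emb (sc i j m) * emb (sc m l k))" for i j l
  have S: "S i j l + S j l i + S l i j = 0" if "i < d" "j < d" "l < d" for i j l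
  proof -
    have "S i j l + S j l i + S l i j = emb ((\<Sum>m<d. sc i j m * sc m l k) + (\<Sum>m<d. sc j l m * sc m i k) + (\<Sum>m<d. sc l i m * sc m j k))"
      unfolding S_def by (simp only: emb_add emb_sum emb_mult)
    then show ?thesis using sc_jacobi[OF that True] emb_0 by simp
  qed
  have rot: "(\<Sum>a<d. \<Sum>b<d. \<Sum>c<d. f a b c) = (\<Sum>c<d. \<Sum>a<d. \<Sum>b<d. f a b c)"
    for f :: "nat \<Rightarrow> nat \<Rightarrow> nat \<Rightarrow> 'a fract"
  proof -
    have "(\<Sum>a<d. \<Sum>b<d. \<Sum>c<d. f a b c) = (\<Sum>a<d. \<Sum>c<d. \<Sum>b<d. f a b c)" by (intro sum.cong refl sum.swap)
    also have "\<dots> = (\<Sum>c<d. \<Sum>a<d. \<Sum>b<d. f a b c)" by (rule sum.swap)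
    finally show ?thesis .
  qed
  have "FB (FB u v) w k = (\<Sum>i<d. \<Sum>j<d. \<Sum>l<d. u i * v j * w l * S i j l)"
    unfolding FB_FB S_def ..
  moreover have "FB (FB v w) u k = (\<Sum>i<d. \<Sum>j<d. \<Sum>l<d. v j * w l * u i * S j l i)"
    unfolding FB_FB S_def by (rule rot)
  moreover have "FB (FB w u) v k = (\<Sum>i<d. \<Sum>j<d. \<Sum>l<d. w l * u i * v j * S l i j)"
    unfolding FB_FB S_def by (subst rot, subst rot) (rule refl)
  ultimately have "FB (FB u v) w k + FB (FB v w) u k + FB (FB w u) v k
      = (\<Sum>i<d. \<Sum>j<d. \<Sum>l<d. u i * v j * w l * (S i j l + S j l i + S l i j))"
    by (simp only: sum.distrib[symmetric] distrib_left mult_ac)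
  also have "\<dots> = 0" using S by (intro sum.neutral ballI) simp
  finally show ?thesis .
qed (simp add: FB_outside)

lemma FB_jacobi: "FB u (FB v w) = FB (FB u v) w + FB v (FB u w)"
proof
  fix k
  have neg: "FB (- x) y = - FB x y" for x y
    by (rule ext) (simp add: FB_eq sum_negf)
  have a: "FB v (FB u w) = FB (FB w u) v"
    using FB_skew[of v "FB u w"] FB_skew[of u w] neg[of "FB w u" v] by simp
  have b: "FB u (FB v w) k = - FB (FB v w) u k" using fun_cong[OF FB_skew[of u "FB v w"], of k] by simp
  have "FB (FB v w) u k + (FB (FB u v) w k + FB (FB w u) v k) = 0"
    using FB_cyclic[of u v w k] by (simp only: add_ac)
  then have "FB (FB u v) w k + FB (FB w u) v k = - FB (FB v w) u k" by (simp only: add_eq_0_iff)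
  then show "FB u (FB v w) k = (FB (FB u v) w + FB v (FB u w)) k"
    unfolding plus_fun_apply a b by (rule sym)
qed

lemma FB_basis: "i < d \<Longrightarrow> j < d \<Longrightarrow> FB (coord_basis i) (coord_basis j) k = emb (sc i j k)"
proof -
  assume ij: "i < d" "j < d"
  have "FB (coord_basis i) (coord_basis j) k
      = (\<Sum>i'<d. \<Sum>j'<d. if j' = j then (if i' = i then emb (sc i' j' k) else 0) else 0)"
    unfolding FB_eq coord_basis_def by (intro sum.cong refl) auto
  then show ?thesis using ij by simp
qed

end

section \<open>Perfectness after extension of scalars\<close>

lemma coord_space_expand:
  fixes u :: "nat \<Rightarrow> 'k::field"
  assumes "u \<in> coord_space d"
  shows "u = (\<Sum>i<d. coord_scale (u i) (coord_basis i))"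
proof
  fix k
  have "(\<Sum>i<d. coord_scale (u i) (coord_basis i)) k = (\<Sum>i<d. coord_scale (u i) (coord_basis i) k)"
    by (induction d) auto
  also have "\<dots> = (\<Sum>i<d. if i = k then u i else 0)"
    by (rule sum.cong) (auto simp: coord_scale_def coord_basis_def)
  finally show "u k = (\<Sum>i<d. coord_scale (u i) (coord_basis i)) k"
    using assms by (auto simp: coord_space_def)
qed

lemma coord_basis_in: "i < d \<Longrightarrow> coord_basis i \<in> coord_space d"
  by (auto simp: coord_space_def coord_basis_def)

context standard_group_setting
begin

text \<open>If \<open>x\<close> were not a combination of brackets, a linear form could be
  prescribed as 0 on a basis of their span and 1 at \<open>x\<close>. Clearing denominators on the
  basis vectors gives a form over R that vanishes on brackets, and \<open>linear_form_zero\<close>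
  makes it zero.\<close>

lemma bracket_perfect:
  assumes dim: "krull_dim (tring :: 'a ring) > 1"
    and tfg: "topologically_finitely_generated G (standard_group_topology M d)"
  shows "coord_space d \<subseteq> module.span coord_scale {FB x y |x y. x \<in> coord_space d \<and> y \<in> coord_space d}"
proof (rule ccontr)
  interpret vector_space "coord_scale :: 'a fract \<Rightarrow> _" by (rule vector_space_coord_scale)
  interpret vp: vector_space_pair "coord_scale :: 'a fract \<Rightarrow> _" "(*) :: 'a fract \<Rightarrow> _"
    by unfold_locales (auto simp: algebra_simps)
  let ?L = "coord_space d :: (nat \<Rightarrow> 'a fract) set"
  let ?S = "{FB x y |x y. x \<in> ?L \<and> y \<in> ?L}"
  assume "\<not> ?L \<subseteq> span ?S"
  then obtain x where x: "x \<in> ?L" "x \<notin> span ?S" by blast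
  obtain B0 where B0: "B0 \<subseteq> ?S" "independent B0" "?S \<subseteq> span B0"
    using maximal_independent_subset[of ?S] by blast
  have xB0: "x \<notin> span B0" using x(2) span_mono[OF B0(1)] by blast
  then have "independent (insert x B0)" using B0(2) by (rule independent_insertI)
  from vp.linear_independent_extend[OF this, of "\<lambda>b. if b = x then 1 else 0"]
  obtain h where h: "Vector_Spaces.linear coord_scale (*) h" "\<forall>b\<in>insert x B0. h b = (if b = x then 1 else 0)"
    by blast
  interpret h: Vector_Spaces.linear "coord_scale :: 'a fract \<Rightarrow> _" "(*)" h by (rule h(1))
  have "h b = 0" if "b \<in> B0" for b using h(2) that xB0 span_base by auto
  then have "span B0 \<subseteq> {v. h v = 0}"
    by (intro span_minimal) (auto simp: subspace_def h.add h.scale h.zero)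
  then have hS: "h v = 0" if "v \<in> ?S" for v using that B0(3) by blast
  define l where "l i = h (coord_basis i)" for i
  have hl: "h u = (\<Sum>i<d. u i * l i)" if "u \<in> ?L" for u
  proof -
    have "h u = h (\<Sum>i<d. coord_scale (u i) (coord_basis i))" using coord_space_expand[OF that] by simp
    then show ?thesis by (simp add: h.sum h.scale l_def)
  qed
  obtain q where q: "q \<noteq> 0" "\<forall>i<d. \<exists>r. emb q * l i = emb r" using common_denominator[of d l] by blast
  then obtain lam where lam: "\<And>i. i < d \<Longrightarrow> emb q * l i = emb (lam i)" by metis
  have "(\<Sum>i<d. lam i * mps_coeff (F i) (mix j k)) = (\<Sum>i<d. lam i * mps_coeff (F i) (mix k j))"
    if jk: "j < d" "k < d" for j k
  proof -
    have "FB (coord_basis j) (coord_basis k) \<in> ?L" by (simp add: coord_space_def FB_outside)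
    then have "(\<Sum>i<d. emb (sc j k i) * l i) = h (FB (coord_basis j) (coord_basis k))"
      by (simp only: hl FB_basis[OF jk])
    also have "\<dots> = 0" using coord_basis_in jk by (intro hS) blast
    finally have "0 = emb q * (\<Sum>i<d. emb (sc j k i) * l i)" by simp
    also have "\<dots> = (\<Sum>i<d. emb (sc j k i) * (emb q * l i))" by (simp only: sum_distrib_left mult.left_commute)
    also have "\<dots> = (\<Sum>i<d. emb (sc j k i * lam i))" by (rule sum.cong) (simp_all only: lam lessThan_iff emb_mult)
    also have "\<dots> = emb (\<Sum>i<d. sc j k i * lam i)" by (simp only: emb_sum)
    finally have "emb (\<Sum>i<d. sc j k i * lam i) = 0" by (rule sym)
    then have "(\<Sum>i<d. sc j k i * lam i) = 0" by (simp only: emb_eq_0_iff)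
    moreover have "sc j k i * lam i = lam i * mps_coeff (F i) (mix j k) - lam i * mps_coeff (F i) (mix k j)"
      if "i < d" for i
      unfolding sc_eq[OF jk that] by (simp only: right_diff_distrib mult.commute[of _ "lam i"])
    ultimately have "(\<Sum>i<d. lam i * mps_coeff (F i) (mix j k) - lam i * mps_coeff (F i) (mix k j)) = 0"
      by simp
    then show ?thesis by (simp add: sum_subtractf)
  qed
  then have "lam i = 0" if "i < d" for i using linear_form_zero[OF dim tfg] that by blast
  then have "l i = 0" if "i < d" for i
    using lam[OF that] that q(1) emb_eq_0_iff[of q] by (simp add: emb_0)
  then have "h x = 0" using hl[OF x(1)] by simp
  moreover have "h x = 1" using h(2) by simp
  ultimately show False by simp
qed

end

theorem theorem5p1:
  fixes p d :: nat
    and M :: "'a::idom set"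
    and F :: "nat \<Rightarrow> (nat + nat, 'a) mps"
  assumes "Factorial_Ring.prime p"
    and "noetherian_local_pro_p_domain p M"
    and "CHAR('a) = 0"
    and "krull_dim (ring_of_type_algebra :: 'a ring) > 1"
    and "formal_group_law d F"
    and "topologically_finitely_generated (standard_group M d F) (standard_group_topology M d)"
  shows "lie_nilpotent (coord_scale :: 'a fract \<Rightarrow> _) (fract_bracket d (fgl_bracket d F))
           (soluble_radical coord_scale (fract_bracket d (fgl_bracket d F)) (coord_space d))"
proof -
  interpret S: standard_group_setting p M d F
    using assms by unfold_locales (auto simp: prime_gt_0_nat)
  interpret V: vector_space "coord_scale :: 'a fract \<Rightarrow> _" by (rule vector_space_coord_scale)
  interpret perfect_lie_algebra "coord_scale :: 'a fract \<Rightarrow> _" "fract_bracket d (fgl_bracket d F)" "coord_space d"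
  proof (intro perfect_lie_algebra.intro perfect_lie_algebra_axioms.intro subquotient_trace.intro)
    show "vector_space (coord_scale :: 'a fract \<Rightarrow> _)" by (rule vector_space_coord_scale)
    show "Vector_Spaces.linear coord_scale coord_scale (fract_bracket d (fgl_bracket d F) x)" for x
      by (rule S.FB_linear)
    show "fract_bracket d (fgl_bracket d F) x y = - fract_bracket d (fgl_bracket d F) y x" for x y
      by (rule S.FB_skew)
    show "fract_bracket d (fgl_bracket d F) x (fract_bracket d (fgl_bracket d F) y z)
        = fract_bracket d (fgl_bracket d F) (fract_bracket d (fgl_bracket d F) x y) z
          + fract_bracket d (fgl_bracket d F) y (fract_bracket d (fgl_bracket d F) x z)" for x y z
      by (rule S.FB_jacobi)
    show "V.subspace (coord_space d)"
      by (auto simp: V.subspace_def coord_space_def coord_scale_def)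
    have "coord_space d \<subseteq> V.span (coord_basis ` {..<d})"
    proof
      fix u :: "nat \<Rightarrow> 'a fract" assume "u \<in> coord_space d"
      from coord_space_expand[OF this] show "u \<in> V.span (coord_basis ` {..<d})"
        by (metis (no_types, lifting) V.span_base V.span_scale V.span_sum imageI)
    qed
    then show "\<exists>E. finite E \<and> coord_space d \<subseteq> V.span E" by blast
    show "fract_bracket d (fgl_bracket d F) x y \<in> coord_space d" for x y
      by (simp add: coord_space_def S.FB_outside)
    show "coord_space d \<subseteq> V.span {fract_bracket d (fgl_bracket d F) x y |x y. x \<in> coord_space d \<and> y \<in> coord_space d}"
      by (rule S.bracket_perfect[OF assms(4,6)])
    show "of_nat n \<noteq> (0 :: 'a fract)" if "n > 0" for n
    proof -
      have "of_nat n \<noteq> (0 :: 'a)" using assms(3) that by (simp add: of_nat_eq_0_iff_char_dvd)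
      then show ?thesis by (simp add: Fract_of_nat_eq[symmetric] emb_eq_0_iff)
    qed
  qed
  show ?thesis by (rule soluble_radical_nilpotent)
qed

end
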